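(* Let $n=3$ and let $k$ be a field. If $F=(f_1,f_2,f_3)\in\mathrm{Aut}_k\,k[x_1,x_2,x_3]$ satisfies one of the following conditions for some $\mathbf{w}=(w_1,w_2,w_3)\in(\Gamma_+)^3$, then $F$ belongs to $\mathrm{T}_3(k)$: (1) $\deg_{\mathbf{w}}f_i\leq\max\{w_1,w_2,w_3\}$ for $i=1,2$. (2) $\deg_{\mathbf{w}}f_2-\max\{w_1,w_2,w_3\}<\deg_{\mathbf{w}}f_1<\max\{w_1,w_2,w_3\}$.
   Context: $\Gamma$ is a totally ordered additive group, i.e. an additive (abelian) group with a total ordering such that $\alpha\leq\beta$ implies $\alpha+\gamma\leq\beta+\gamma$; $\Gamma_+=\{\gamma\in\Gamma\mid\gamma>0\}$. $\mathrm{Aut}_k\,k[x_1,\ldots,x_n]$ is the group of $k$-algebra automorphisms, and $F=(f_1,\ldots,f_n)$ means $f_i=F(x_i)$. For nonzero $f$, $\deg_{\mathbf{w}}f$ is the maximum of $\sum_ia_iw_i$ over monomials $x_1^{a_1}\cdots x_n^{a_n}$ appearing in $f$ with nonzero coefficient. $F$ is affine if each $f_i$ has total degree $1$, and elementary if there exist $1\leq l\leq n$, $a\in k^\times$ and $p\in k[\{x_i\mid i\neq l\}]$ with $f_l=ax_l+p$ and $f_i=x_i$ for $i\neq l$. The tame subgroup $\mathrm{T}_n(k)$ is the subgroup of $\mathrm{Aut}_k\,k[x_1,\ldots,x_n]$ generated by all affine automorphisms and all elementary automorphisms. *)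

theory Defs
  imports
    "HOL-Library.Poly_Mapping"
    "HOL-Library.Numeral_Type"
    "HOL-Algebra.Generated_Groups"
begin

text \<open>
  The polynomial ring over a field \<open>'k\<close> in the variables indexed by a finite type \<open>'n\<close>: a monomial
  is its exponent vector, a polynomial maps finitely many monomials to nonzero coefficients, and
  the ring operations are those of \<^theory>\<open>HOL-Library.Poly_Mapping\<close>.
  For \<open>n\<close> variables take the numeral type \<open>n\<close> as index type; its elements are \<open>1, \<dots>, n\<close>, with
  \<open>n = 0\<close>.
\<close>

type_synonym ('n, 'k) mpol = "('n \<Rightarrow>\<^sub>0 nat) \<Rightarrow>\<^sub>0 'k"

definition Const :: "'k::field \<Rightarrow> ('n, 'k) mpol" where
  "Const c = Poly_Mapping.single 0 c"

definition Var :: "'n \<Rightarrow> ('n, 'k::field) mpol" where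
  "Var i = Poly_Mapping.single (Poly_Mapping.single i 1) 1"

text \<open>
  The subalgebra generated by the variables with index in \<open>I\<close>.
\<close>

definition polys_in :: "'n set \<Rightarrow> ('n, 'k::field) mpol set" where
  "polys_in I = {p. \<forall>m\<in>Poly_Mapping.keys p. Poly_Mapping.keys m \<subseteq> I}"

text \<open>
  The inner sum is the multiple \<open>a\<^sub>i w\<^sub>i\<close> of an element of an additive group by a natural number.
  The weighted degree is meaningful only for nonzero polynomials; at zero it is an unspecified
  value.
\<close>

definition mdeg :: "('n::finite \<Rightarrow> 'g::linordered_ab_group_add) \<Rightarrow> ('n \<Rightarrow>\<^sub>0 nat) \<Rightarrow> 'g" where
  "mdeg w m = (\<Sum>i\<in>UNIV. \<Sum>j<Poly_Mapping.lookup m i. w i)"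

definition wdeg ::
  "('n::finite \<Rightarrow> 'g::linordered_ab_group_add) \<Rightarrow> ('n, 'k::field) mpol \<Rightarrow> 'g" where
  "wdeg w f = Max (mdeg w ` Poly_Mapping.keys f)"

definition total_deg :: "('n::finite, 'k::field) mpol \<Rightarrow> int" where
  "total_deg = wdeg (\<lambda>_. 1)"

definition alg_aut :: "(('n, 'k::field) mpol \<Rightarrow> ('n, 'k) mpol) \<Rightarrow> bool" where
  "alg_aut F \<longleftrightarrow> bij F \<and> (\<forall>p q. F (p + q) = F p + F q) \<and> (\<forall>p q. F (p * q) = F p * F q)
     \<and> (\<forall>c. F (Const c) = Const c)"

definition Aut :: "(('n, 'k::field) mpol \<Rightarrow> ('n, 'k) mpol) monoid" where
  "Aut = \<lparr>carrier = {F. alg_aut F}, mult = (\<circ>), one = id\<rparr>"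

definition affine_aut :: "(('n::finite, 'k::field) mpol \<Rightarrow> ('n, 'k) mpol) \<Rightarrow> bool" where
  "affine_aut F \<longleftrightarrow> F \<in> carrier Aut \<and> (\<forall>i. total_deg (F (Var i)) = 1)"

definition elementary_aut :: "(('n, 'k::field) mpol \<Rightarrow> ('n, 'k) mpol) \<Rightarrow> bool" where
  "elementary_aut F \<longleftrightarrow> F \<in> carrier Aut \<and>
     (\<exists>l a p. a \<noteq> 0 \<and> p \<in> polys_in (- {l}) \<and> F (Var l) = Const a * Var l + p \<and>
        (\<forall>i. i \<noteq> l \<longrightarrow> F (Var i) = Var i))"

definition Tame :: "(('n::finite, 'k::field) mpol \<Rightarrow> ('n, 'k) mpol) set" where
  "Tame = generate Aut ({F. affine_aut F} \<union> {F. elementary_aut F})"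

lemma alg_aut_inv:
  assumes "alg_aut F" shows "alg_aut (inv_into UNIV F)"
proof -
  let ?G = "inv_into UNIV F"
  have b: "bij F" and add: "\<And>p q. F (p + q) = F p + F q" and mult: "\<And>p q. F (p * q) = F p * F q"
    and const: "\<And>c. F (Const c) = Const c"
    using assms unfolding alg_aut_def by blast+
  have s: "F (?G x) = x" for x using b by (rule bij_is_surj[THEN surj_f_inv_f])
  have i: "x = ?G y" if "F x = y" for x y using that b by (simp add: bij_inv_eq_iff)
  have "?G (p + q) = ?G p + ?G q" for p q by (rule i[symmetric], simp only: add s)
  moreover have "?G (p * q) = ?G p * ?G q" for p q by (rule i[symmetric], simp only: mult s)
  moreover have "?G (Const c) = Const c" for c by (rule i[symmetric], simp only: const)
  ultimately show ?thesis
    using b by (simp add: alg_aut_def bij_imp_bij_inv)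
qed

lemma group_Aut: "group (Aut :: (('n, 'k::field) mpol \<Rightarrow> ('n, 'k) mpol) monoid)"
proof (rule groupI)
  fix F G :: "('n, 'k) mpol \<Rightarrow> ('n, 'k) mpol"
  assume "F \<in> carrier Aut" "G \<in> carrier Aut"
  then show "F \<otimes>\<^bsub>Aut\<^esub> G \<in> carrier Aut"
    by (simp add: Aut_def alg_aut_def bij_comp)
next
  fix F :: "('n, 'k) mpol \<Rightarrow> ('n, 'k) mpol"
  assume "F \<in> carrier Aut"
  then have F: "alg_aut F" by (simp add: Aut_def)
  then have "inv_into UNIV F \<circ> F = id" by (simp add: alg_aut_def bij_is_inj)
  with F show "\<exists>G\<in>carrier Aut. G \<otimes>\<^bsub>Aut\<^esub> F = \<one>\<^bsub>Aut\<^esub>"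
    by (intro bexI[of _ "inv_into UNIV F"]) (simp_all add: Aut_def alg_aut_inv)
qed (simp_all add: Aut_def alg_aut_def comp_assoc)

end

theory Submission
  imports Defs "HOL-Computational_Algebra.Formal_Laurent_Series" "HOL-Combinatorics.Transposition"
begin

text \<open>
  Let \<open>m\<close> be an index of maximal weight, let \<open>a\<close>, \<open>b\<close> be the other two indices and put
  \<open>R = k[x\<^sub>a, x\<^sub>b]\<close>. As the weights are positive, the degree conditions leave little room for
  \<open>f\<^sub>1\<close> and \<open>f\<^sub>2\<close>. Under the first condition each of them is a constant multiple of \<open>x\<^sub>m\<close> plus an
  element of \<open>R\<close>, and a linear combination puts one of them into \<open>R\<close>. Under the second
  condition \<open>f\<^sub>1 \<in> R\<close> and \<open>f\<^sub>2 = g\<^sub>1 x\<^sub>m + g\<^sub>0\<close> with \<open>g\<^sub>0, g\<^sub>1 \<in> R\<close> and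
  \<open>deg g\<^sub>1 < deg f\<^sub>1\<close>, and here \<open>g\<^sub>1\<close> is a constant: if it is not \<open>0\<close>, two elements of \<open>R\<close> are algebraically
  dependent modulo \<open>g\<^sub>1\<close> (\<open>dependent_modulo\<close>), so \<open>g\<^sub>1\<close> divides a nonzero polynomial in \<open>f\<^sub>1\<close> and
  \<open>g\<^sub>0\<close>, hence one in \<open>f\<^sub>1\<close> and \<open>f\<^sub>2\<close>; since \<open>F\<close> is an automorphism, the divisor \<open>g\<^sub>1\<close> is
  itself a polynomial in \<open>f\<^sub>1\<close> and \<open>f\<^sub>2\<close>, by its degree in \<open>x\<^sub>m\<close> a polynomial in \<open>f\<^sub>1\<close> alone, and by
  its weighted degree a constant.

  So in all cases \<open>F\<close> has two coordinates \<open>u \<in> R\<close> and \<open>v \<in> k x\<^sub>m + R\<close>. If \<open>v \<in> R\<close>, then \<open>u\<close> and \<open>v\<close>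
  generate \<open>R\<close>; otherwise \<open>v\<close> becomes \<open>x\<^sub>m\<close> after an elementary automorphism, and \<open>u\<close> together
  with the third coordinate at \<open>x\<^sub>m = 0\<close> generates \<open>R\<close>. Either way \<open>u\<close> belongs to a pair of
  generators of \<open>R\<close> (\<open>coordinate_pair_in_Tame\<close>), and the theorem of Jung and van der Kulk (\<open>plane_aut_in_Tame\<close>), valid over
  every field, allows one to assume that \<open>F\<close> sends two variables to variables. Such an \<open>F\<close>
  is elementary up to a permutation of the variables (\<open>fixing_two_variables_in_Tame\<close>).

  For the theorem of Jung and van der Kulk, let \<open>X\<close>, \<open>Y\<close> generate \<open>k[s, t]\<close>. If both have positive
  degree in \<open>t\<close>, it suffices that the leading term of one of them is a constant
  times a power of the leading term of the other; then an elementary automorphism lowers a degree.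
  To see this (\<open>leading_terms_dependent\<close>), embed \<open>k[s, t]\<close> into \<open>k((s))((1/t))\<close> with its valuation
  \<open>\<nu> = - deg\<^sub>t\<close>, let the degrees be \<open>v g\<close> and \<open>u g\<close> with \<open>u\<close>, \<open>v\<close> coprime, and replace \<open>X\<close>, \<open>Y\<close> by
  the Laurent monomials \<open>\<theta> = X\<^sup>u / Y\<^sup>v\<close> of value \<open>0\<close> and \<open>z\<close> of value \<open>g\<close>. The Jacobian of \<open>X\<close>, \<open>Y\<close> is
  a nonzero polynomial, so the Jacobian of \<open>z\<close>, \<open>\<theta>\<close> has value at most \<open>g (u + v + 1) - 2\<close>.
  On the other hand \<open>s\<close> is a polynomial \<open>f(X, Y)\<close> of value \<open>0\<close>. If \<open>W\<close> is the weighted degree of \<open>f\<close>,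
  then \<open>z\<^sup>W f(X, Y)\<close> is a polynomial in \<open>z\<close> and \<open>\<theta>\<close> of value \<open>W g\<close>, and its restriction to \<open>z = 0\<close>
  vanishes to order at most \<open>W / (u v)\<close> at every nonzero point. The value of a polynomial
  is at most its multiplicity at the centre times the value of the Jacobian
  (\<open>subdegree_le_mult_jac\<close>, by repeated blowing up). Hence \<open>W g \<le> W / (u v) (g (u + v + 1) - 2)\<close>, that
  is \<open>u v < u + v + 1\<close>, and as \<open>u\<close>, \<open>v\<close> are coprime, one of them is \<open>1\<close>. Nothing in this depends on the
  characteristic: the Jacobian of a generating pair does not vanish over any field.
\<close>

unbundle fps_syntax

section \<open>Polynomials with embedded coefficients\<close>

definition pev :: "('a::comm_ring_1 \<Rightarrow> 'b::comm_ring_1) \<Rightarrow> 'a poly \<Rightarrow> 'b \<Rightarrow> 'b" where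
  "pev \<kappa> p x = poly (map_poly \<kappa> p) x"

definition unital_hom :: "('a::comm_ring_1 \<Rightarrow> 'b::comm_ring_1) \<Rightarrow> bool" where
  "unital_hom \<kappa> \<longleftrightarrow> (\<forall>a b. \<kappa> (a + b) = \<kappa> a + \<kappa> b) \<and> (\<forall>a b. \<kappa> (a * b) = \<kappa> a * \<kappa> b) \<and> \<kappa> 1 = 1"

lemma unital_hom_0: assumes "unital_hom \<kappa>" shows "\<kappa> 0 = 0"
proof -
  have "\<kappa> (0 + 0) = \<kappa> 0 + \<kappa> 0" using assms unfolding unital_hom_def by blast
  thus ?thesis by simp
qed

context
  fixes \<kappa> :: "'a::comm_ring_1 \<Rightarrow> 'b::comm_ring_1"
  assumes hom: "unital_hom \<kappa>"
begin

lemma hom_simps: "\<kappa> 0 = 0" "\<kappa> 1 = 1" "\<kappa> (a + b) = \<kappa> a + \<kappa> b" "\<kappa> (a * b) = \<kappa> a * \<kappa> b"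
  using hom unital_hom_0[OF hom] unfolding unital_hom_def by blast+

lemma pev_0 [simp]: "pev \<kappa> 0 x = 0"
  by (simp add: pev_def)

lemma pev_pCons: "pev \<kappa> (pCons a p) x = \<kappa> a + x * pev \<kappa> p x"
  by (simp add: pev_def map_poly_pCons hom_simps)

lemma pev_add: "pev \<kappa> (p + q) x = pev \<kappa> p x + pev \<kappa> q x"
proof -
  have "map_poly \<kappa> (p + q) = map_poly \<kappa> p + map_poly \<kappa> q"
    by (rule poly_eqI) (simp add: coeff_map_poly hom_simps)
  thus ?thesis by (simp add: pev_def)
qed

lemma pev_smult: "pev \<kappa> (smult a p) x = \<kappa> a * pev \<kappa> p x"
proof -
  have "map_poly \<kappa> (smult a p) = smult (\<kappa> a) (map_poly \<kappa> p)"
    by (rule poly_eqI) (simp add: coeff_map_poly hom_simps)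
  thus ?thesis by (simp add: pev_def)
qed

lemma pev_mult: "pev \<kappa> (p * q) x = pev \<kappa> p x * pev \<kappa> q x"
  by (induction p) (simp_all add: pev_add pev_smult pev_pCons hom_simps algebra_simps)

lemma pev_pcompose: "pev \<kappa> (pcompose p q) x = pev \<kappa> p (pev \<kappa> q x)"
  by (induction p) (simp_all add: pev_add pev_mult pev_pCons pcompose_pCons hom_simps)

lemma pev_sum: "pev \<kappa> (sum f S) x = (\<Sum>i\<in>S. pev \<kappa> (f i) x)"
  by (induction S rule: infinite_finite_induct) (simp_all add: pev_add)

lemma pev_monom: "pev \<kappa> (monom c n) x = \<kappa> c * x ^ n"
  by (simp add: pev_def map_poly_monom hom_simps poly_monom)

lemma pev_altdef:
  assumes "degree p \<le> N"
  shows "pev \<kappa> p x = (\<Sum>i\<le>N. \<kappa> (coeff p i) * x ^ i)"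
proof -
  have "degree (map_poly \<kappa> p) \<le> N" using assms map_poly_degree_leq[of \<kappa> p] by linarith
  hence "(\<Sum>i\<le>degree (map_poly \<kappa> p). coeff (map_poly \<kappa> p) i * x ^ i) = (\<Sum>i\<le>N. coeff (map_poly \<kappa> p) i * x ^ i)"
    by (intro sum.mono_neutral_left) (auto simp: coeff_eq_0)
  hence "pev \<kappa> p x = (\<Sum>i\<le>N. coeff (map_poly \<kappa> p) i * x ^ i)"
    by (simp add: pev_def poly_altdef)
  thus ?thesis by (simp add: coeff_map_poly hom_simps)
qed

end

text \<open>
  The order of vanishing at \<open>\<beta>\<close> is the exponent of a monomial that occurs in
  the Taylor expansion at \<open>\<beta>\<close>; this is how a bound on the order becomes a bound
  on a multiplicity.
\<close>

lemma coeff_pcompose_order: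
  fixes q :: "'a::field poly"
  assumes "q \<noteq> 0"
  shows "coeff (pcompose q [:\<beta>, 1:]) (order \<beta> q) \<noteq> 0"
proof -
  obtain r where r: "q = [:-\<beta>, 1:] ^ order \<beta> q * r" "\<not> [:-\<beta>, 1:] dvd r"
    using order_decomp[OF assms] by blast
  define n where "n = order \<beta> q"
  have q: "q = [:-\<beta>, 1:] ^ n * r" using r(1) unfolding n_def .
  have pw: "pcompose (x ^ n) [:\<beta>, 1:] = (pcompose x [:\<beta>, 1:]) ^ n" for x :: "'a poly" and n
    by (induction n) (simp_all add: pcompose_mult pcompose_1)
  have "pcompose q [:\<beta>, 1:] = [:0, 1:] ^ n * pcompose r [:\<beta>, 1:]"
    by (subst q, subst pcompose_mult, subst pw) (simp add: pcompose_pCons)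
  also have "[:0, 1:] ^ n = (monom 1 n :: 'a poly)" by (simp add: monom_altdef)
  finally have "coeff (pcompose q [:\<beta>, 1:]) n = coeff (pcompose r [:\<beta>, 1:]) 0"
    by (simp add: coeff_monom_mult)
  also have "\<dots> = poly (pcompose r [:\<beta>, 1:]) 0" by (simp add: poly_0_coeff_0)
  also have "\<dots> = poly r \<beta>" by (simp add: poly_pcompose)
  also have "\<dots> \<noteq> 0" using r(2) by (simp add: poly_eq_0_iff_dvd)
  finally show ?thesis unfolding n_def .
qed

text \<open>
  Away from \<open>0\<close> the lowest monomial is a unit and may be divided out.
\<close>

lemma order_le_width:
  fixes q :: "'a::field poly"
  assumes "q \<noteq> 0" "\<beta> \<noteq> 0" "\<And>e. coeff q e \<noteq> 0 \<Longrightarrow> e1 \<le> e \<and> e \<le> e2"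
  shows "order \<beta> q \<le> e2 - e1"
proof -
  define r where "r = poly_shift e1 q"
  have q: "q = monom 1 e1 * r"
    by (rule poly_eqI) (use assms(3) in \<open>force simp: coeff_monom_mult r_def coeff_poly_shift\<close>)
  have r0: "r \<noteq> 0" using q assms(1) by auto
  have "degree r \<le> e2 - e1"
  proof (rule degree_le, intro allI impI)
    fix i assume "e2 - e1 < i"
    show "coeff r i = 0"
    proof (rule ccontr)
      assume "coeff r i \<noteq> 0"
      hence "coeff q (i + e1) \<noteq> 0" by (simp add: r_def coeff_poly_shift)
      with assms(3) have "i + e1 \<le> e2" by blast
      with \<open>e2 - e1 < i\<close> show False by linarith
    qed
  qed
  moreover have "order \<beta> (monom 1 e1) = 0"
    by (rule order_0I) (simp add: poly_monom assms(2))
  hence "order \<beta> q = order \<beta> r" using q assms(1) order_mult[of "monom 1 e1" r \<beta>] by simp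
  ultimately show ?thesis using order_degree[OF r0, of \<beta>] by linarith
qed

section \<open>Laurent series over a field\<close>

text \<open>
  The bounds on the supports need not be attained, so the same range of summation serves for a
  series and for its coefficientwise derivative.
\<close>

lemma fls_times_nth_wide:
  fixes f g :: "'a::comm_semiring_0 fls"
  assumes "\<And>i. i < p \<Longrightarrow> f $$ i = 0" "\<And>i. i < q \<Longrightarrow> g $$ i = 0"
  shows "(f * g) $$ n = (\<Sum>i=p..n - q. f $$ i * g $$ (n - i))"
proof (cases "f = 0 \<or> g = 0")
  case True
  thus ?thesis by auto
next
  case False
  have "p \<le> fls_subdegree f" "q \<le> fls_subdegree g"
    using False assms by (auto intro!: fls_subdegree_geI)
  hence "(\<Sum>i=fls_subdegree f..n - fls_subdegree g. f $$ i * g $$ (n - i)) = (\<Sum>i=p..n - q. f $$ i * g $$ (n - i))"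
    by (intro sum.mono_neutral_left) auto
  thus ?thesis by (simp add: fls_times_nth(2))
qed

definition integral_fls :: "'a::zero fls \<Rightarrow> bool" where
  "integral_fls f \<longleftrightarrow> (\<forall>n<0. f $$ n = 0)"

lemma integral_fls_iff: "integral_fls f \<longleftrightarrow> fls_subdegree f \<ge> 0"
  unfolding integral_fls_def by (auto intro: fls_subdegree_ge0I)

lemma integral_fls_add: "integral_fls f \<Longrightarrow> integral_fls g \<Longrightarrow> integral_fls (f + g)"
  for f g :: "'a::comm_ring_1 fls" by (simp add: integral_fls_def)

lemma integral_fls_diff: "integral_fls f \<Longrightarrow> integral_fls g \<Longrightarrow> integral_fls (f - g)"
  for f g :: "'a::comm_ring_1 fls" by (simp add: integral_fls_def)

lemma integral_fls_mult: "integral_fls f \<Longrightarrow> integral_fls g \<Longrightarrow> integral_fls (f * g)"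
  for f g :: "'a::comm_ring_1 fls" by (simp add: integral_fls_iff fls_mult_subdegree_ge_0)

lemma integral_fls_nth0_mult: "integral_fls f \<Longrightarrow> integral_fls g \<Longrightarrow> (f * g) $$ 0 = f $$ 0 * g $$ 0"
  for f g :: "'a::comm_ring_1 fls"
  by (subst fls_times_nth_wide[of 0 _ 0]) (auto simp: integral_fls_def)

lemma subdegree_pos:
  fixes f :: "'a::comm_ring_1 fls"
  assumes "integral_fls f" "f $$ 0 = 0" "f \<noteq> 0"
  shows "fls_subdegree f > 0"
  using assms by (intro fls_subdegree_greaterI) (auto simp: integral_fls_def order_le_less)

lemma unital_hom_fls_const: "unital_hom (fls_const :: 'k::field \<Rightarrow> 'k fls)"
  unfolding unital_hom_def by (simp add: fls_plus_const)

lemma integral_pev: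
  fixes x :: "'k::field fls"
  assumes "integral_fls x"
  shows "integral_fls (pev fls_const p x)"
  by (induction p)
     (auto simp: pev_pCons[OF unital_hom_fls_const] pev_0[OF unital_hom_fls_const]
       intro!: integral_fls_add integral_fls_mult assms, auto simp: integral_fls_def)

text \<open>
  The lowest nonzero coefficient of \<open>p\<close> gives a term that no other term can cancel.
\<close>

lemma pev_transcendental_pos:
  fixes x :: "'k::field fls"
  assumes "fls_subdegree x > 0" "p \<noteq> 0"
  shows "pev fls_const p x \<noteq> 0"
  using assms(2)
proof (induction p)
  case (pCons a p)
  have x: "integral_fls x" "x \<noteq> 0" "x $$ 0 = 0" using assms(1) by (auto simp: integral_fls_iff)
  show ?case
  proof (cases "a = 0")
    case True
    with pCons x show ?thesis by (auto simp: pev_pCons[OF unital_hom_fls_const])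
  next
    case False
    have "pev fls_const (pCons a p) x $$ 0 = a"
      using integral_fls_nth0_mult[OF x(1) integral_pev[OF x(1), of p]] x(3)
      by (simp add: pev_pCons[OF unital_hom_fls_const])
    with False show ?thesis by auto
  qed
qed simp

text \<open>
  The term of highest degree has the strictly smallest value.
\<close>

lemma pev_transcendental_neg:
  fixes x :: "'k::field fls"
  assumes "fls_subdegree x < 0" "p \<noteq> 0"
  shows "pev fls_const p x \<noteq> 0 \<and> fls_subdegree (pev fls_const p x) = int (degree p) * fls_subdegree x"
  using assms(2)
proof (induction p)
  case (pCons a p)
  have x: "x \<noteq> 0" using assms(1) by auto
  show ?case
  proof (cases "p = 0")
    case True
    with pCons show ?thesis
      by (simp add: pev_pCons[OF unital_hom_fls_const] pev_0[OF unital_hom_fls_const])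
  next
    case False
    define r where "r = x * pev fls_const p x"
    have r: "r \<noteq> 0" "fls_subdegree r = int (degree p + 1) * fls_subdegree x"
      using pCons False x by (auto simp: r_def algebra_simps)
    have neg: "fls_subdegree r < 0" using r(2) assms(1) by (simp add: mult_less_0_iff)
    have "fls_subdegree (r + fls_const a) = fls_subdegree r"
      by (rule fls_subdegree_eqI) (use neg r nth_fls_subdegree_nonzero[OF r(1)] in auto)
    moreover have "pev fls_const (pCons a p) x = r + fls_const a"
      by (simp add: r_def pev_pCons[OF unital_hom_fls_const])
    ultimately show ?thesis using False r neg by auto
  qed
qed simp

text \<open>
  The field \<open>k\<close> is algebraically closed in \<open>k((s))\<close>. So the residue of
  an element of \<open>k((s))((\<tau>))\<close> is either in \<open>k\<close>, and then it can be
  subtracted, or it is transcendental, and then nonzero polynomials over \<open>k\<close> do not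
  vanish at it.
\<close>

lemma pev_transcendental:
  fixes x :: "'k::field fls"
  assumes "x \<notin> range fls_const" "p \<noteq> 0"
  shows "pev fls_const p x \<noteq> 0"
proof -
  consider "fls_subdegree x > 0" | "fls_subdegree x < 0" | "fls_subdegree x = 0" by linarith
  thus ?thesis
  proof cases
    case 1
    thus ?thesis using pev_transcendental_pos assms by blast
  next
    case 2
    thus ?thesis using pev_transcendental_neg assms by blast
  next
    case 3
    define c y where "c = x $$ 0" and "y = x - fls_const c"
    have y: "y \<noteq> 0" using assms(1) by (auto simp: y_def)
    have "integral_fls y" using 3 unfolding y_def
      by (intro integral_fls_diff) (auto simp: integral_fls_iff)
    moreover have "y $$ 0 = 0" by (simp add: y_def c_def)
    ultimately have "fls_subdegree y > 0" using y by (intro subdegree_pos)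
    moreover have "pcompose p [:c, 1:] \<noteq> 0"
      using assms(2) by (simp add: pcompose_eq_0_iff)
    ultimately have "pev fls_const (pcompose p [:c, 1:]) y \<noteq> 0" by (rule pev_transcendental_pos)
    moreover have "pev fls_const (pcompose p [:c, 1:]) y = pev fls_const p x"
      by (simp add: pev_pcompose[OF unital_hom_fls_const] pev_pCons[OF unital_hom_fls_const]
          pev_0[OF unital_hom_fls_const] y_def)
    ultimately show ?thesis by simp
  qed
qed

section \<open>Iterated Laurent series and their Jacobian\<close>

definition cst :: "'k::field \<Rightarrow> 'k fls fls" where
  "cst c = fls_const (fls_const c)"

lemma cst_simps [simp]: "cst 0 = 0" "cst 1 = 1" "cst (a + b) = cst a + cst b" "cst (a * b) = cst a * cst b"
  "cst a = 0 \<longleftrightarrow> a = 0"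
  by (simp_all add: cst_def fls_plus_const)

lemma unital_hom_cst: "unital_hom cst"
  by (simp add: unital_hom_def)

lemma integral_cst [simp]: "integral_fls (cst c)"
  by (simp add: integral_fls_def cst_def)

lemma cst_nth0 [simp]: "cst c $$ 0 = fls_const c"
  by (simp add: cst_def)

lemma subdegree_cst [simp]: "fls_subdegree (cst c) = 0"
  by (simp add: cst_def)

lemma integral_pev_cst:
  assumes "integral_fls y"
  shows "integral_fls (pev cst p y) \<and> pev cst p y $$ 0 = pev fls_const p (y $$ 0)"
proof (induction p)
  case 0
  show ?case by (simp add: pev_0[OF unital_hom_cst] pev_0[OF unital_hom_fls_const] integral_fls_def)
next
  case (pCons a p)
  thus ?case using assms integral_fls_nth0_mult[OF assms, of "pev cst p y"]
    by (auto simp: pev_pCons[OF unital_hom_cst] pev_pCons[OF unital_hom_fls_const]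
      intro!: integral_fls_add integral_fls_mult)
qed

text \<open>
  The derivation \<open>\<partial>/\<partial>s\<close> of \<open>k((s))((\<tau>))\<close>; the
  derivation \<open>\<partial>/\<partial>\<tau>\<close> is \<open>fls_deriv\<close>.
\<close>

definition ds :: "'k::field fls fls \<Rightarrow> 'k fls fls" where
  "ds f = Abs_fls (\<lambda>n. fls_deriv (f $$ n))"

lemma ds_nth [simp]: "ds f $$ n = fls_deriv (f $$ n)"
proof -
  have "\<And>n. n < fls_subdegree f \<Longrightarrow> fls_deriv (f $$ n) = 0" by simp
  thus ?thesis unfolding ds_def by (subst nth_Abs_fls_lower_bound[of "fls_subdegree f"]) auto
qed

lemma ds_add: "ds (f + g) = ds f + ds g"
  by (rule fls_eqI) simp

lemma ds_mult: "ds (f * g) = f * ds g + ds f * g"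
proof (rule fls_eqI)
  fix n
  let ?p = "fls_subdegree f" and ?q = "fls_subdegree g"
  have "ds (f * g) $$ n = fls_deriv (\<Sum>i=?p..n - ?q. f $$ i * g $$ (n - i))"
    by (simp add: fls_times_nth_wide[of ?p f ?q g])
  also have "\<dots> = (\<Sum>i=?p..n - ?q. f $$ i * fls_deriv (g $$ (n - i)) + fls_deriv (f $$ i) * g $$ (n - i))"
    by (simp add: fls_deriv_sum)
  also have "\<dots> = (f * ds g + ds f * g) $$ n"
    using fls_times_nth_wide[of ?p f ?q "ds g" n] fls_times_nth_wide[of ?p "ds f" ?q g n]
    by (simp add: sum.distrib)
  finally show "ds (f * g) $$ n = (f * ds g + ds f * g) $$ n" .
qed

lemma ds_cst [simp]: "ds (cst c) = 0"
  by (rule fls_eqI) (simp add: cst_def)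

text \<open>
  The coefficient of \<open>da \<and> db\<close> with respect to \<open>ds \<and> d\<tau>\<close>.
  Its value replaces the discrepancy of the divisorial valuation \<open>\<nu>\<close>: blowing up
  the point with parameters \<open>a\<close>, \<open>b\<close> divides it by \<open>a\<close>.
\<close>

definition jac :: "'k::field fls fls \<Rightarrow> 'k fls fls \<Rightarrow> 'k fls fls" where
  "jac a b = ds a * fls_deriv b - fls_deriv a * ds b"

lemma jac_self [simp]: "jac a a = 0"
  by (simp add: jac_def)

lemma jac_swap: "jac b a = - jac a b"
  by (simp add: jac_def)

lemma jac_cst [simp]: "jac a (cst c) = 0"
  by (simp add: jac_def) (simp add: cst_def)

lemma jac_add: "jac a (b + c) = jac a b + jac a c"
  by (simp add: jac_def ds_add algebra_simps)

lemma jac_mult: "jac a (b * c) = b * jac a c + jac a b * c"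
  by (simp add: jac_def ds_mult algebra_simps)

lemma jac_diff_cst [simp]: "jac a (b - cst c) = jac a b"
  using jac_add[of a "b - cst c" "cst c"] by simp

lemma integral_jac:
  assumes "integral_fls a" "integral_fls b"
  shows "integral_fls (jac a b)"
proof -
  have "integral_fls (ds f)" "integral_fls (fls_deriv f)" if "integral_fls f" for f :: "'a fls fls"
  proof -
    show "integral_fls (ds f)" using that by (auto simp: integral_fls_def)
    show "integral_fls (fls_deriv f)" unfolding integral_fls_def
    proof (intro allI impI)
      fix n :: int assume "n < 0"
      hence "n + 1 = 0 \<or> n + 1 < 0" by linarith
      thus "fls_deriv f $$ n = 0"
      proof
        assume "n + 1 < 0"
        hence "f $$ (n + 1) = 0" using that unfolding integral_fls_def by blast
        thus ?thesis by simp
      qed simp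
    qed
  qed
  thus ?thesis using assms unfolding jac_def by (intro integral_fls_diff integral_fls_mult) auto
qed

section \<open>The value of a polynomial is bounded by its multiplicity\<close>

definition bipoly :: "(nat \<Rightarrow> nat \<Rightarrow> 'k::field) \<Rightarrow> nat \<Rightarrow> 'k fls fls \<Rightarrow> 'k fls fls \<Rightarrow> 'k fls fls" where
  "bipoly c N a b = (\<Sum>(i, j)\<in>{..N} \<times> {..N}. cst (c i j) * a ^ i * b ^ j)"

lemma bipoly_swap: "bipoly (\<lambda>i j. c j i) N b a = bipoly c N a b"
  unfolding bipoly_def
  by (rule sum.reindex_bij_witness[of _ prod.swap prod.swap]) (auto simp: algebra_simps)

lemma bipoly_support:
  "bipoly c N a b = (\<Sum>(i, j)\<in>{(i, j) \<in> {..N} \<times> {..N}. c i j \<noteq> 0}. cst (c i j) * a ^ i * b ^ j)"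
  unfolding bipoly_def by (rule sum.mono_neutral_right) auto

text \<open>
  Order a sum by powers of \<open>z\<close> and look at the part \<open>Q\<^sub>0\<close> without
  \<open>z\<close>. If the residue of \<open>y\<close> is not a constant, it is transcendental and
  \<open>Q\<^sub>0\<close> alone determines the value of the sum. If it is a constant
  \<open>\<beta>\<close>, Taylor expansion at \<open>\<beta>\<close> gives a polynomial in the two
  local parameters \<open>z\<close> and \<open>y - \<beta>\<close> whose multiplicity at the
  origin is at most the order of \<open>Q\<^sub>0\<close> at \<open>\<beta>\<close>.
\<close>

lemma expand_at_centre:
  fixes z y :: "'k::field fls fls"
  assumes z: "fls_subdegree z > 0" and y: "integral_fls y" and fin: "finite S"
    and Q0: "(\<Sum>i\<in>{i\<in>S. \<alpha> i = 0}. monom (c i) (\<delta> i)) \<noteq> 0" (is "?Q0 \<noteq> 0")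
  defines "e \<equiv> (\<Sum>i\<in>S. cst (c i) * z ^ \<alpha> i * y ^ \<delta> i)"
  shows "y $$ 0 \<notin> range fls_const \<Longrightarrow> e \<noteq> 0 \<and> fls_subdegree e = 0"
    and "y $$ 0 = fls_const \<beta> \<Longrightarrow>
      \<exists>c' N. e = bipoly c' N z (y - cst \<beta>) \<and> order \<beta> ?Q0 \<le> N \<and> c' 0 (order \<beta> ?Q0) \<noteq> 0"
proof -
  define Q where "Q l = (\<Sum>i\<in>{i\<in>S. \<alpha> i = l}. monom (c i) (\<delta> i))" for l
  define N where "N = (\<Sum>i\<in>S. \<alpha> i + \<delta> i)"
  have N: "\<alpha> i \<le> N" "\<delta> i \<le> N" if "i \<in> S" for i
    using member_le_sum[of i S "\<lambda>i. \<alpha> i + \<delta> i"] fin that unfolding N_def by auto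
  have Q: "pev cst (Q l) y = (\<Sum>i\<in>{i\<in>S. \<alpha> i = l}. cst (c i) * y ^ \<delta> i)" for l
    by (simp add: Q_def pev_sum[OF unital_hom_cst] pev_monom[OF unital_hom_cst])
  have "e = (\<Sum>l\<in>{..N}. \<Sum>i\<in>{i\<in>S. \<alpha> i = l}. cst (c i) * z ^ \<alpha> i * y ^ \<delta> i)"
    unfolding e_def by (rule sum.group[symmetric]) (use fin N in auto)
  also have "\<dots> = (\<Sum>l\<in>{..N}. z ^ l * pev cst (Q l) y)"
    by (intro sum.cong refl) (simp add: Q sum_distrib_left mult_ac)
  finally have e: "e = (\<Sum>l\<in>{..N}. z ^ l * pev cst (Q l) y)" .
  have deg: "degree (Q l) \<le> N" for l
    unfolding Q_def by (intro degree_sum_le) (use fin N in \<open>auto intro: order_trans[OF degree_monom_le]\<close>)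
  have zz: "integral_fls z" "z $$ 0 = 0" using z by (auto simp: integral_fls_iff)
  {
    assume *: "y $$ 0 \<notin> range fls_const"
    have "integral_fls (\<Sum>l<n. z ^ Suc l * pev cst (Q (Suc l)) y) \<and> (\<Sum>l<n. z ^ Suc l * pev cst (Q (Suc l)) y) $$ 0 = 0" for n
    proof (induction n)
      case (Suc n)
      have zp: "integral_fls (z ^ l)" for l
        by (induction l) (auto intro!: integral_fls_mult zz, simp add: integral_fls_def)
      have "integral_fls (z ^ n * pev cst (Q (Suc n)) y)"
        using zp integral_pev_cst[OF y] by (intro integral_fls_mult) auto
      hence "integral_fls (z * (z ^ n * pev cst (Q (Suc n)) y))" "(z * (z ^ n * pev cst (Q (Suc n)) y)) $$ 0 = 0"
        using zz by (auto intro!: integral_fls_mult simp: integral_fls_nth0_mult)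
      with Suc show ?case by (auto intro!: integral_fls_add simp: mult.assoc)
    qed (simp add: integral_fls_def)
    note 1 = this[of N]
    have e': "e = pev cst (Q 0) y + (\<Sum>l<N. z ^ Suc l * pev cst (Q (Suc l)) y)"
      unfolding e lessThan_Suc_atMost[symmetric] by (subst sum.lessThan_Suc_shift) simp
    have "integral_fls e" "e $$ 0 = pev fls_const (Q 0) (y $$ 0)"
      using 1 integral_pev_cst[OF y, of "Q 0"] unfolding e' by (auto intro!: integral_fls_add)
    moreover have "pev fls_const (Q 0) (y $$ 0) \<noteq> 0"
      using pev_transcendental[OF *] Q0 by (simp add: Q_def)
    ultimately show "e \<noteq> 0 \<and> fls_subdegree e = 0"
      by (auto simp: integral_fls_def intro!: fls_subdegree_eqI)
  }
  {
    assume *: "y $$ 0 = fls_const \<beta>"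
    define R where "R l = pcompose (Q l) [:\<beta>, 1:]" for l
    have R: "pev cst (Q l) y = pev cst (R l) (y - cst \<beta>)" for l
      by (simp add: R_def pev_pcompose[OF unital_hom_cst] pev_pCons[OF unital_hom_cst] pev_0[OF unital_hom_cst])
    have degR: "degree (R l) \<le> N" for l using deg[of l] by (simp add: R_def degree_pcompose)
    have "e = (\<Sum>l\<in>{..N}. \<Sum>h\<in>{..N}. cst (coeff (R l) h) * z ^ l * (y - cst \<beta>) ^ h)"
      unfolding e R
      by (intro sum.cong refl) (simp add: pev_altdef[OF unital_hom_cst degR] sum_distrib_left mult_ac)
    hence "e = bipoly (\<lambda>l h. coeff (R l) h) N z (y - cst \<beta>)"
      by (simp add: bipoly_def sum.cartesian_product)
    moreover have Q00: "Q 0 \<noteq> 0" using Q0 by (simp add: Q_def)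
    have "order \<beta> (Q 0) \<le> N" using order_degree[OF Q00] deg[of 0] le_trans by blast
    moreover have "coeff (R 0) (order \<beta> (Q 0)) \<noteq> 0"
      unfolding R_def by (rule coeff_pcompose_order[OF Q00])
    ultimately show "\<exists>c' N. e = bipoly c' N z (y - cst \<beta>) \<and> order \<beta> ?Q0 \<le> N \<and> c' 0 (order \<beta> ?Q0) \<noteq> 0"
      unfolding Q_def by blast
  }
qed

lemma subdegree_div:
  fixes a b :: "'a::field fls"
  assumes "a \<noteq> 0" "b \<noteq> 0"
  shows "fls_subdegree (b / a) = fls_subdegree b - fls_subdegree a"
  using assms by (simp add: field_simps fls_divide_subdegree)

lemma subdegree_power:
  fixes f :: "'a::field fls"
  assumes "f \<noteq> 0"
  shows "fls_subdegree (f ^ n) = int n * fls_subdegree f"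
  by (induction n) (simp_all add: assms algebra_simps)

text \<open>
  One blowing up. With \<open>y = b / a\<close> and \<open>m\<^sub>0\<close> the multiplicity of
  the polynomial, division by \<open>a ^ m\<^sub>0\<close> gives the strict transform
  \<open>e\<close>. Its restriction to \<open>a = 0\<close> is a nonzero polynomial in
  \<open>y\<close> of degree at most \<open>m\<^sub>0\<close>, so its multiplicity at the new
  centre is again at most \<open>m\<^sub>0\<close>. The value of the polynomial drops by
  \<open>m\<^sub>0\<close> times the value of \<open>a\<close>, the value of the Jacobian drops by
  the value of \<open>a\<close>.
\<close>

lemma subdegree_le_mult_jac_step:
  fixes a b :: "'k::field fls fls"
  assumes IH: "\<And>(a' :: 'k fls fls) b' c' N' i' j' m'. nat (fls_subdegree (jac a' b')) < nat (fls_subdegree (jac a b)) \<Longrightarrow>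
      fls_subdegree a' > 0 \<Longrightarrow> fls_subdegree b' > 0 \<Longrightarrow> jac a' b' \<noteq> 0 \<Longrightarrow>
      i' \<le> N' \<Longrightarrow> j' \<le> N' \<Longrightarrow> i' + j' \<le> m' \<Longrightarrow> c' i' j' \<noteq> 0 \<Longrightarrow>
      fls_subdegree (bipoly c' N' a' b') \<le> int m' * fls_subdegree (jac a' b')"
    and ab: "fls_subdegree a > 0" "fls_subdegree a \<le> fls_subdegree b" and J: "jac a b \<noteq> 0"
    and ij: "i \<le> N" "j \<le> N" "i + j \<le> m" "c i j \<noteq> 0"
  shows "fls_subdegree (bipoly c N a b) \<le> int m * fls_subdegree (jac a b)"
proof -
  \<comment> \<open>the coordinate of the chart of the blowing up in which \<open>a\<close> is the exceptional divisor\<close>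
  define y where "y = b / a"
  have nz: "a \<noteq> 0" "b \<noteq> 0" using ab by auto
  have b: "b = a * y" by (simp add: y_def nz)
  have y: "integral_fls y" using ab nz by (simp add: integral_fls_iff y_def subdegree_div)
  have Jy: "jac a b = a * jac a y" by (simp add: b jac_mult)
  have Jy0: "jac a y \<noteq> 0" using Jy J by auto
  have a: "integral_fls a" using ab by (simp add: integral_fls_iff)
  have Jyp: "fls_subdegree (jac a y) \<ge> 0" using integral_jac[OF a y] by (simp add: integral_fls_iff)
  have Jdeg: "fls_subdegree (jac a b) = fls_subdegree a + fls_subdegree (jac a y)"
    using Jy Jy0 nz by simp
  define S where "S = {(i, j) \<in> {..N} \<times> {..N}. c i j \<noteq> 0}"
  have fin: "finite S" by (rule finite_subset[of _ "{..N} \<times> {..N}"]) (auto simp: S_def)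
  have ijS: "(i, j) \<in> S" using ij by (simp add: S_def)
  define m0 where "m0 = Min ((\<lambda>(i, j). i + j) ` S)"
  have m0: "m0 \<le> i + j" if "(i, j) \<in> S" for i j
    unfolding m0_def using fin that by (intro Min_le) force+
  have "m0 \<in> (\<lambda>(i, j). i + j) ` S" unfolding m0_def using fin ijS by (intro Min_in) auto
  then obtain i1 j1 where i1: "(i1, j1) \<in> S" "i1 + j1 = m0" by auto
  have m0m: "m0 \<le> m" using m0[OF ijS] ij by simp
  define \<alpha> \<delta> c1 where "\<alpha> = (\<lambda>(i, j). i + j - m0)" and "\<delta> = (snd :: nat \<times> nat \<Rightarrow> nat)" and "c1 = (\<lambda>(i, j). c i j)"
  define e where "e = (\<Sum>p\<in>S. cst (c1 p) * a ^ \<alpha> p * y ^ \<delta> p)"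
  \<comment> \<open>total transform = exceptional divisor to the multiplicity, times strict transform\<close>
  have eb: "bipoly c N a b = a ^ m0 * e"
    unfolding bipoly_support S_def[symmetric] e_def sum_distrib_left
  proof (intro sum.cong refl, clarify)
    fix i j assume "(i, j) \<in> S"
    hence "a ^ (i + j) = a ^ m0 * a ^ (i + j - m0)" using m0 by (simp flip: power_add)
    thus "cst (c i j) * a ^ i * b ^ j = a ^ m0 * (cst (c1 (i, j)) * a ^ \<alpha> (i, j) * y ^ \<delta> (i, j))"
      by (simp add: b \<alpha>_def \<delta>_def c1_def power_mult_distrib power_add mult_ac)
  qed
  define Q where "Q = (\<Sum>p\<in>{p\<in>S. \<alpha> p = 0}. monom (c1 p) (\<delta> p))"
  have "coeff Q j1 = (\<Sum>p\<in>{p\<in>S. \<alpha> p = 0}. if p = (i1, j1) then c i1 j1 else 0)"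
    unfolding Q_def coeff_sum
  proof (intro sum.cong refl)
    fix p assume p: "p \<in> {p \<in> S. \<alpha> p = 0}"
    obtain i' j' where pij: "p = (i', j')" by (cases p)
    have "i' + j' = m0" using p m0[of i' j'] by (auto simp: pij \<alpha>_def)
    thus "coeff (monom (c1 p) (\<delta> p)) j1 = (if p = (i1, j1) then c i1 j1 else 0)"
      using i1 by (auto simp: pij \<delta>_def c1_def coeff_monom)
  qed
  also have "\<dots> = c i1 j1" using fin i1 by (subst sum.delta) (auto simp: \<alpha>_def)
  finally have Q0: "Q \<noteq> 0" using i1 by (auto simp: S_def)
  have degQ: "degree Q \<le> m0"
    unfolding Q_def
  proof (intro degree_sum_le)
    fix p assume p: "p \<in> {p \<in> S. \<alpha> p = 0}"
    obtain i' j' where pij: "p = (i', j')" by (cases p)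
    have "i' + j' = m0" using p m0[of i' j'] by (auto simp: pij \<alpha>_def)
    thus "degree (monom (c1 p) (\<delta> p)) \<le> m0"
      using degree_monom_le[of "c1 p" "\<delta> p"] by (auto simp: pij \<delta>_def)
  qed (use fin in auto)
  have fin_le: ?thesis if "e = 0 \<or> fls_subdegree e \<le> int m0 * fls_subdegree (jac a y)"
  proof (cases "e = 0")
    case True
    thus ?thesis using ab Jyp Jdeg by (simp add: eb)
  next
    case False
    hence "fls_subdegree (bipoly c N a b) = int m0 * fls_subdegree a + fls_subdegree e"
      using nz by (simp add: eb subdegree_power)
    also have "\<dots> \<le> int m0 * fls_subdegree (jac a b)"
      using that False by (simp add: Jdeg algebra_simps)
    also have "\<dots> \<le> int m * fls_subdegree (jac a b)"
      using m0m ab Jyp Jdeg by (intro mult_right_mono) auto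
    finally show ?thesis .
  qed
  note centre = expand_at_centre[OF ab(1) y fin Q0[unfolded Q_def], folded Q_def e_def]
  show ?thesis
  proof (cases "y $$ 0 \<in> range fls_const")
    case False
    thus ?thesis using centre(1) fin_le Jyp by simp
  next
    case True
    then obtain \<beta> where \<beta>: "y $$ 0 = fls_const \<beta>" by auto
    define b1 where "b1 = y - cst \<beta>"
    obtain c' N' where c': "e = bipoly c' N' a b1" "order \<beta> Q \<le> N'" "c' 0 (order \<beta> Q) \<noteq> 0"
      using centre(2)[OF \<beta>] unfolding b1_def by blast
    have Jb1: "jac a b1 = jac a y" by (simp add: b1_def)
    have b1: "b1 \<noteq> 0"
    proof
      assume "b1 = 0"
      hence "jac a b1 = 0" using jac_cst[of a 0] by simp
      with Jb1 Jy0 show False by simp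
    qed
    have "integral_fls b1" "b1 $$ 0 = 0" using y \<beta> by (auto simp: b1_def intro!: integral_fls_diff)
    hence pos: "fls_subdegree b1 > 0" using b1 by (intro subdegree_pos)
    have "order \<beta> Q \<le> m0" using order_degree[OF Q0] degQ le_trans by blast
    hence "fls_subdegree (bipoly c' N' a b1) \<le> int m0 * fls_subdegree (jac a b1)"
      using Jdeg Jyp ab pos Jb1 Jy0 c' by (intro IH[of a b1 0 N' "order \<beta> Q" m0 c']) auto
    thus ?thesis using fin_le c' Jb1 by simp
  qed
qed

text \<open>
  The value of the Jacobian is a nonnegative integer that decreases with every blowing up, so
  after finitely many steps the residue of the quotient is transcendental and the value of the
  strict transform is \<open>0\<close>.
\<close>

lemma subdegree_le_mult_jac:
  fixes a b :: "'k::field fls fls"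
  assumes "fls_subdegree a > 0" "fls_subdegree b > 0" "jac a b \<noteq> 0"
    and "i \<le> N" "j \<le> N" "i + j \<le> m" "c i j \<noteq> 0"
  shows "fls_subdegree (bipoly c N a b) \<le> int m * fls_subdegree (jac a b)"
  using assms
proof (induction "nat (fls_subdegree (jac a b))" arbitrary: a b c N i j m rule: less_induct)
  case less
  note IH = less.hyps
  show ?case
  proof (cases "fls_subdegree a \<le> fls_subdegree b")
    case True
    show ?thesis
      by (rule subdegree_le_mult_jac_step[where i = i and j = j]) (use IH less.prems True in auto)
  next
    case False
    have "fls_subdegree (bipoly (\<lambda>i j. c j i) N b a) \<le> int m * fls_subdegree (jac b a)"
      by (rule subdegree_le_mult_jac_step[where i = j and j = i])
         (use IH less.prems False jac_swap[of a b] in auto)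
    thus ?thesis using jac_swap[of a b] bipoly_swap[of c N b a] by simp
  qed
qed

section \<open>Leading terms of a generating pair\<close>

text \<open>
  Multiplied by \<open>x\<close> to avoid the exponent \<open>n - 1\<close>.
\<close>

lemma derivation_power:
  fixes D :: "'a::comm_ring_1 \<Rightarrow> 'a"
  assumes "\<And>x y. D (x * y) = x * D y + D x * y"
  shows "x * D (x ^ n) = of_nat n * x ^ n * D x"
proof (induction n)
  case 0
  have "D (1 * 1) = 1 * D 1 + D 1 * 1" by (rule assms)
  hence "D 1 = 0" by simp
  thus ?case by simp
next
  case (Suc n)
  have "x * D (x ^ Suc n) = x * (x * D (x ^ n)) + x * (D x * x ^ n)" by (simp add: assms algebra_simps)
  also have "\<dots> = of_nat (Suc n) * x ^ Suc n * D x" by (simp only: Suc) (simp add: algebra_simps)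
  finally show ?case .
qed

text \<open>
  Logarithmic derivative of \<open>X = \<theta>\<^sup>j / z\<^sup>v\<close>, with denominators
  cleared.
\<close>

lemma derivation_quotient_of_powers:
  fixes D :: "'a::field \<Rightarrow> 'a"
  assumes D: "\<And>x y. D (x * y) = x * D y + D x * y" and "z \<noteq> 0" and X: "X * z ^ v = \<theta> ^ j"
  shows "D X * (z * \<theta>) = X * (of_nat j * z * D \<theta> - of_nat v * \<theta> * D z)"
proof -
  have "D (X * z ^ v) = D (\<theta> ^ j)" by (simp add: X)
  hence "z * \<theta> * (X * D (z ^ v) + D X * z ^ v) = z * \<theta> * D (\<theta> ^ j)" by (simp add: D)
  hence "X * \<theta> * (z * D (z ^ v)) + D X * (z * \<theta>) * z ^ v = z * (\<theta> * D (\<theta> ^ j))"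
    by (simp add: algebra_simps)
  hence "X * \<theta> * (of_nat v * z ^ v * D z) + D X * (z * \<theta>) * z ^ v = z * (of_nat j * (X * z ^ v) * D \<theta>)"
    by (simp add: derivation_power[of D, OF D] X)
  hence "z ^ v * (D X * (z * \<theta>)) = z ^ v * (X * (of_nat j * z * D \<theta> - of_nat v * \<theta> * D z))"
    by (simp add: algebra_simps)
  thus ?thesis using \<open>z \<noteq> 0\<close> by simp
qed

text \<open>
  The substitution is unimodular, so the logarithmic forms \<open>dX/X \<and> dY/Y\<close> and
  \<open>dz/z \<and> d\<theta>/\<theta>\<close> agree. The determinant enters as the image of the
  integer \<open>1\<close>, so the identity holds in every characteristic.
\<close>

lemma jac_monomial_change:
  fixes X Y z \<theta> :: "'k::field fls fls"
  assumes nz: "z \<noteq> 0" "\<theta> \<noteq> 0" and X: "X * z ^ v = \<theta> ^ j" and Y: "Y * z ^ u = \<theta> ^ i"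
    and uv: "u * j = v * i + 1"
  shows "jac X Y * (z * \<theta>) = X * Y * jac z \<theta>"
proof -
  have fd: "fls_deriv (x * y) = x * fls_deriv y + fls_deriv x * y" for x y :: "'k fls fls" by simp
  define s t where "s = ds \<theta>" and "t = fls_deriv \<theta>"
  define p q where "p = ds z" and "q = fls_deriv z"
  note ders = derivation_quotient_of_powers[of ds, OF ds_mult nz(1) X] derivation_quotient_of_powers[of fls_deriv, OF fd nz(1) X]
    derivation_quotient_of_powers[of ds, OF ds_mult nz(1) Y] derivation_quotient_of_powers[of fls_deriv, OF fd nz(1) Y]
  define U V I J :: "'k fls fls" where "U = of_nat u" and "V = of_nat v" and "I = of_nat i" and "J = of_nat j"
  have UV: "U * J = V * I + 1" using uv unfolding U_def V_def I_def J_def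
    by (metis of_nat_1 of_nat_add of_nat_mult)
  have "jac X Y * (z * \<theta>) * (z * \<theta>) = (ds X * (z * \<theta>)) * (fls_deriv Y * (z * \<theta>)) - (fls_deriv X * (z * \<theta>)) * (ds Y * (z * \<theta>))"
    by (simp add: jac_def algebra_simps)
  also have "\<dots> = X * Y * ((J * z * s - V * \<theta> * p) * (I * z * t - U * \<theta> * q) - (J * z * t - V * \<theta> * q) * (I * z * s - U * \<theta> * p))"
    unfolding ders by (simp add: U_def V_def I_def J_def s_def t_def p_def q_def algebra_simps)
  also have "\<dots> = X * Y * (z * \<theta> * ((U * J - V * I) * (p * t - q * s)))"
    by (simp add: algebra_simps)
  also have "\<dots> = X * Y * jac z \<theta> * (z * \<theta>)"
    unfolding UV by (simp add: jac_def s_def t_def p_def q_def algebra_simps)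
  finally show ?thesis using nz by simp
qed

text \<open>
  The step described at the beginning. The assumption on the value of the Jacobian holds for
  polynomials in \<open>s\<close> and \<open>t = 1/\<tau>\<close> because \<open>dt = -
  \<tau>\<^sup>-\<^sup>2 d\<tau>\<close>, and \<open>c\<close> is the coefficient array of a
  nonconstant polynomial \<open>f\<close> for which \<open>f(X, Y)\<close> has no pole.
\<close>

lemma leading_terms_dependent:
  fixes X Y :: "'k::field fls fls"
  assumes X: "fls_subdegree X < 0" and Y: "fls_subdegree Y < 0"
    and J: "jac X Y \<noteq> 0" "fls_subdegree (jac X Y) \<le> -2"
    and c: "i0 \<le> N" "j0 \<le> N" "i0 + j0 > 0" "c i0 j0 \<noteq> 0"
    and val: "bipoly c N X Y \<noteq> 0" "fls_subdegree (bipoly c N X Y) \<ge> 0"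
  obtains \<beta> n where "\<beta> \<noteq> 0" "n > 0"
    "fls_subdegree (Y - cst \<beta> * X ^ n) > fls_subdegree Y \<or> fls_subdegree (X - cst \<beta> * Y ^ n) > fls_subdegree X"
proof -
  have nz: "X \<noteq> 0" "Y \<noteq> 0" using X Y by auto
  define p q where "p = nat (- fls_subdegree X)" and "q = nat (- fls_subdegree Y)"
  have pq: "p > 0" "q > 0" "fls_subdegree X = - int p" "fls_subdegree Y = - int q"
    using X Y by (auto simp: p_def q_def)
  define g where "g = gcd p q"
  have g0: "g > 0" using pq by (simp add: g_def)
  define v u where "v = p div g" and "u = q div g"
  have uv: "p = v * g" "q = u * g" by (simp_all add: v_def u_def g_def)
  have uv0: "u > 0" "v > 0" using uv pq by (auto intro!: Nat.gr0I)
  have cop: "coprime u v" unfolding v_def u_def g_def using pq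
    by (metis div_gcd_coprime gcd.commute less_numeral_extra(3))
  obtain j' i' where bez: "u * j' = v * i' + 1"
    using bezout_nat[of u v] uv0 cop by auto
  \<comment> \<open>unimodular change of exponents: \<open>X = \<theta> ^ j' / z ^ v\<close> and \<open>Y = \<theta> ^ i' / z ^ u\<close>\<close>
  define z \<theta> where "z = X ^ i' / Y ^ j'" and "\<theta> = X ^ u / Y ^ v"
  have nz': "z \<noteq> 0" "\<theta> \<noteq> 0" using nz by (auto simp: z_def \<theta>_def)
  have nuz: "fls_subdegree z = int g"
  proof -
    have "fls_subdegree z = int j' * int q - int i' * int p"
      using nz by (simp add: z_def subdegree_div subdegree_power pq)
    also have "\<dots> = int g * (int (u * j') - int (v * i'))" by (simp add: uv algebra_simps)
    finally show ?thesis by (simp add: bez)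
  qed
  have nut: "fls_subdegree \<theta> = 0"
    using nz by (simp add: \<theta>_def subdegree_div subdegree_power pq uv)
  have Xz: "X * z ^ v = \<theta> ^ j'" 
  proof -
    have "X * z ^ v = X ^ (v * i' + 1) / Y ^ (v * j')"
      by (simp add: z_def power_divide power_mult[symmetric] mult.commute)
    thus ?thesis unfolding bez[symmetric] by (simp add: \<theta>_def power_divide power_mult)
  qed
  have Yz: "Y * z ^ u = \<theta> ^ i'" 
  proof -
    have "Y * z ^ u = X ^ (u * i') * Y / Y ^ (u * j')"
      by (simp add: z_def power_divide power_mult[symmetric] mult.commute)
    also have "\<dots> = X ^ (u * i') / Y ^ (v * i')" using nz by (simp add: bez)
    finally show ?thesis by (simp add: \<theta>_def power_divide power_mult)
  qed
  have Jz: "jac X Y * (z * \<theta>) = X * Y * jac z \<theta>"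
    by (rule jac_monomial_change[OF nz' Xz Yz bez])
  hence Jz0: "jac z \<theta> \<noteq> 0" using J nz' nz by auto
  have "fls_subdegree (jac X Y * (z * \<theta>)) = fls_subdegree (X * Y * jac z \<theta>)" by (simp only: Jz)
  hence "fls_subdegree (jac X Y) + int g = - int p - int q + fls_subdegree (jac z \<theta>)"
    using J nz nz' Jz0 by (simp add: nuz nut pq)
  hence Jle: "fls_subdegree (jac z \<theta>) \<le> int (g * (u + v + 1)) - 2"
    using J(2) by (simp add: uv algebra_simps)
  define S where "S = {(i, j) \<in> {..N} \<times> {..N}. c i j \<noteq> 0}"
  have fin: "finite S" by (rule finite_subset[of _ "{..N} \<times> {..N}"]) (auto simp: S_def)
  have ijS: "(i0, j0) \<in> S" using c by (simp add: S_def)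
  define W where "W = Max ((\<lambda>(i, j). v * i + u * j) ` S)"
  have W: "v * i + u * j \<le> W" if "(i, j) \<in> S" for i j
    unfolding W_def using fin that by (intro Max_ge) force+
  have "W \<in> (\<lambda>(i, j). v * i + u * j) ` S" unfolding W_def using fin ijS by (intro Max_in) auto
  then obtain i1 j1 where i1: "(i1, j1) \<in> S" "v * i1 + u * j1 = W" by auto
  have W0: "W > 0" using W[OF ijS] c uv0 by (cases "i0 = 0") (auto intro: Nat.gr0I)
  define \<alpha> \<delta> c1 where "\<alpha> = (\<lambda>(i, j). W - (v * i + u * j))" and "\<delta> = (\<lambda>(i, j). j' * i + i' * j)"
    and "c1 = (\<lambda>(i, j). c i j)"
  define e where "e = (\<Sum>p\<in>S. cst (c1 p) * z ^ \<alpha> p * \<theta> ^ \<delta> p)"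
  have eb: "e = z ^ W * bipoly c N X Y"
    unfolding bipoly_support S_def[symmetric] e_def sum_distrib_left
  proof (intro sum.cong refl, clarify)
    fix i j assume ij: "(i, j) \<in> S"
    have "z ^ W * X ^ i * Y ^ j = z ^ (W - (v * i + u * j)) * z ^ (v * i + u * j) * X ^ i * Y ^ j"
      using W[OF ij] by (simp flip: power_add)
    also have "\<dots> = z ^ (W - (v * i + u * j)) * ((X * z ^ v) ^ i * (Y * z ^ u) ^ j)"
      by (simp add: power_add power_mult[symmetric] power_mult_distrib mult_ac)
    also have "(X * z ^ v) ^ i * (Y * z ^ u) ^ j = \<theta> ^ (j' * i + i' * j)"
      unfolding Xz Yz by (simp add: power_add power_mult)
    finally show "cst (c1 (i, j)) * z ^ \<alpha> (i, j) * \<theta> ^ \<delta> (i, j) = z ^ W * (cst (c i j) * X ^ i * Y ^ j)"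
      by (simp add: c1_def \<alpha>_def \<delta>_def mult_ac)
  qed
  have e0: "e \<noteq> 0" using nz' val by (simp add: eb)
  have nue: "fls_subdegree e \<ge> int W * int g"
    using nz' val by (simp add: eb subdegree_power nuz)
  define Q where "Q = (\<Sum>p\<in>{p\<in>S. \<alpha> p = 0}. monom (c1 p) (\<delta> p))"
  \<comment> \<open>on the leading form the exponent of \<open>\<theta>\<close> determines \<open>i\<close>, and \<open>i\<close> ranges over at most \<open>W / v\<close>\<close>
  have top: "u * \<delta> (i, j) = i + i' * W" "v * i + u * j = W" if "(i, j) \<in> S" "\<alpha> (i, j) = 0" for i j
  proof -
    show w: "v * i + u * j = W" using that W[OF that(1)] by (simp add: \<alpha>_def)
    have "u * \<delta> (i, j) = (u * j') * i + i' * (u * j)" by (simp add: \<delta>_def algebra_simps)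
    also have "\<dots> = i + i' * (v * i + u * j)" unfolding bez by (simp add: algebra_simps)
    finally show "u * \<delta> (i, j) = i + i' * W" by (simp add: w)
  qed
  have tinj: "p1 = p2" if "p1 \<in> S" "\<alpha> p1 = 0" "p2 \<in> S" "\<alpha> p2 = 0" "\<delta> p1 = \<delta> p2" for p1 p2
  proof -
    obtain a b a' b' where ab: "p1 = (a, b)" "p2 = (a', b')" by (cases p1, cases p2)
    have "a = a'" using top(1)[of a b] top(1)[of a' b'] that by (simp add: ab)
    have "v * a' + u * b = v * a' + u * b'" using top(2)[of a b] top(2)[of a' b'] that \<open>a = a'\<close> by (simp add: ab)
    hence "b = b'" using uv0 by simp
    thus ?thesis using \<open>a = a'\<close> by (simp add: ab)
  qed
  have coQ: "coeff Q (\<delta> p) = c1 p" if "p \<in> S" "\<alpha> p = 0" for p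
  proof -
    have "coeff Q (\<delta> p) = (\<Sum>p'\<in>{p\<in>S. \<alpha> p = 0}. if p' = p then c1 p else 0)"
      unfolding Q_def coeff_sum using tinj that by (intro sum.cong refl) (auto simp: coeff_monom)
    thus ?thesis using fin that by (subst (asm) sum.delta) auto
  qed
  have \<alpha>1: "\<alpha> (i1, j1) = 0" using i1 by (simp add: \<alpha>_def)
  have Q0: "Q \<noteq> 0" using coQ[OF i1(1) \<alpha>1] i1 by (auto simp: S_def c1_def)
  have Qsupp: "\<exists>p\<in>S. \<alpha> p = 0 \<and> \<delta> p = k" if "coeff Q k \<noteq> 0" for k
  proof -
    have "\<exists>p\<in>{p\<in>S. \<alpha> p = 0}. coeff (monom (c1 p) (\<delta> p)) k \<noteq> 0"
      using that unfolding Q_def coeff_sum by (metis (mono_tags, lifting) sum.neutral)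
    thus ?thesis by (auto simp: coeff_monom split: if_splits)
  qed
  note centre = expand_at_centre[OF _ _ fin Q0[unfolded Q_def], of z \<theta>, folded Q_def e_def]
  have int\<theta>: "integral_fls \<theta>" by (simp add: integral_fls_iff nut)
  have zpos: "fls_subdegree z > 0" using nuz g0 by simp
  \<comment> \<open>a transcendental residue would force the value \<open>0\<close>, but \<open>z ^ W\<close> makes the value positive\<close>
  have "\<theta> $$ 0 \<in> range fls_const"
  proof (rule ccontr)
    assume "\<not> ?thesis"
    hence "fls_subdegree e = 0" using centre(1)[OF zpos int\<theta>] by blast
    moreover have "int W * int g > 0" using W0 g0 by simp
    ultimately show False using nue by linarith
  qed
  then obtain \<beta> where \<beta>: "\<theta> $$ 0 = fls_const \<beta>" by auto
  have \<beta>0: "\<beta> \<noteq> 0" using nth_fls_subdegree_nonzero[OF nz'(2)] \<beta> nut by auto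
  define \<eta> where "\<eta> = \<theta> - cst \<beta>"
  have J\<eta>: "jac z \<eta> = jac z \<theta>" by (simp add: \<eta>_def)
  have \<eta>0: "\<eta> \<noteq> 0"
  proof
    assume "\<eta> = 0"
    hence "jac z \<eta> = 0" using jac_cst[of z 0] by simp
    with J\<eta> Jz0 show False by simp
  qed
  have "integral_fls \<eta>" "\<eta> $$ 0 = 0" using int\<theta> \<beta> by (auto simp: \<eta>_def intro!: integral_fls_diff)
  hence \<eta>pos: "fls_subdegree \<eta> > 0" using \<eta>0 by (intro subdegree_pos)
  define h where "h = order \<beta> Q"
  obtain c' N' where c': "e = bipoly c' N' z \<eta>" "h \<le> N'" "c' 0 h \<noteq> 0"
    using centre(2)[OF zpos int\<theta> \<beta>] unfolding \<eta>_def h_def by blast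
  have "fls_subdegree e \<le> int h * fls_subdegree (jac z \<theta>)"
    unfolding c'(1) J\<eta>[symmetric]
    by (rule subdegree_le_mult_jac[of _ _ 0 _ h]) (use zpos \<eta>pos Jz0 J\<eta> c' in auto)
  hence main: "int W * int g \<le> int h * fls_subdegree (jac z \<theta>)" using nue by linarith
  have huv: "u * v * h \<le> W"
  proof -
    define k1 where "k1 = Min {k. coeff Q k \<noteq> 0}"
    define k2 where "k2 = degree Q"
    have fk: "finite {k. coeff Q k \<noteq> 0}" by (rule finite_subset[of _ "{..degree Q}"]) (auto intro: le_degree)
    have nek: "{k. coeff Q k \<noteq> 0} \<noteq> {}" using Q0 leading_coeff_0_iff by blast
    have k1: "coeff Q k1 \<noteq> 0" using Min_in[OF fk nek] unfolding k1_def by blast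
    have k2: "coeff Q k2 \<noteq> 0" using Q0 by (simp add: k2_def)
    have hk: "h \<le> k2 - k1" unfolding h_def
    proof (rule order_le_width[OF Q0 \<beta>0])
      fix k assume "coeff Q k \<noteq> 0"
      thus "k1 \<le> k \<and> k \<le> k2" using fk by (auto simp: k1_def k2_def intro: le_degree)
    qed
    obtain a1 b1 where 1: "(a1, b1) \<in> S" "\<alpha> (a1, b1) = 0" "\<delta> (a1, b1) = k1" using Qsupp[OF k1] by auto
    obtain a2 b2 where 2: "(a2, b2) \<in> S" "\<alpha> (a2, b2) = 0" "\<delta> (a2, b2) = k2" using Qsupp[OF k2] by auto
    have "u * (k2 - k1) = a2 - a1" using top(1)[OF 1(1,2)] top(1)[OF 2(1,2)] 1(3) 2(3)
      by (simp add: diff_mult_distrib2)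
    hence "u * v * (k2 - k1) = v * (a2 - a1)" by (simp add: mult_ac)
    also have "\<dots> \<le> v * a2" by (rule mult_le_mono2) simp
    also have "v * a2 \<le> W" using top(2)[OF 2(1,2)] by simp
    finally have "u * v * (k2 - k1) \<le> W" .
    thus ?thesis using mult_le_mono2[OF hk, of "u * v"] by linarith
  qed
  define K where "K = fls_subdegree (jac z \<theta>)"
  have K0: "K > 0"
  proof (rule ccontr)
    assume "\<not> K > 0"
    hence "int h * K \<le> 0" by (simp add: mult_le_0_iff)
    moreover have "int W * int g > 0" using W0 g0 by simp
    ultimately show False using main unfolding K_def by linarith
  qed
  have "int (u * v) * (int W * int g) \<le> int (u * v) * (int h * K)"
    using main unfolding K_def by (intro mult_left_mono) auto
  also have "\<dots> = int (u * v * h) * K" by simp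
  also have "\<dots> \<le> int W * K" using huv K0 by (intro mult_right_mono) (simp_all only: of_nat_le_iff order_less_imp_le)
  finally have "int W * (int (u * v) * int g) \<le> int W * K" by (simp add: mult_ac)
  hence "int (u * v) * int g \<le> K" using W0 by simp
  also have "K \<le> int (g * (u + v + 1)) - 2" using Jle by (simp add: K_def)
  finally have "int g * int (u * v) < int g * int (u + v + 1)" by (simp add: algebra_simps)
  hence small: "u * v < u + v + 1" using g0 by (simp only: mult_less_cancel_left_pos of_nat_0_less_iff of_nat_less_iff)
  have "u = 1 \<or> v = 1"
  proof (rule ccontr)
    assume "\<not> ?thesis"
    hence "u \<ge> 2" "v \<ge> 2" using uv0 by auto
    then obtain u' v' where 2: "u = u' + 2" "v = v' + 2" by (metis add.commute le_Suc_ex)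
    with small have "u' = 0" "v' = 0" by (auto simp: algebra_simps)
    with 2 cop show False by simp
  qed
  thus thesis
  proof
    assume u1: "u = 1"
    \<comment> \<open>\<open>\<theta> = X / Y ^ v\<close> is close to the constant \<open>\<beta>\<close>\<close>
    have "X - cst \<beta> * Y ^ v = Y ^ v * \<eta>" using nz by (simp add: \<eta>_def \<theta>_def u1 algebra_simps)
    hence "fls_subdegree (X - cst \<beta> * Y ^ v) > fls_subdegree X"
      using nz \<eta>0 \<eta>pos by (simp add: subdegree_power pq uv u1)
    thus thesis using that[of \<beta> v] \<beta>0 uv0 by blast
  next
    assume v1: "v = 1"
    have "Y - cst (1 / \<beta>) * X ^ u = - cst (1 / \<beta>) * Y * \<eta>"
    proof -
      have "cst \<beta> * cst (1 / \<beta>) = 1" using \<beta>0 by (simp flip: cst_simps(4))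
      thus ?thesis using nz by (simp add: \<eta>_def \<theta>_def v1 algebra_simps)
    qed
    hence "fls_subdegree (Y - cst (1 / \<beta>) * X ^ u) > fls_subdegree Y"
      using nz \<eta>0 \<eta>pos \<beta>0 by simp
    thus thesis using that[of "1 / \<beta>" u] \<beta>0 uv0 by simp
  qed
qed

section \<open>Evaluation and endomorphisms of polynomial rings\<close>

abbreviation keys where "keys \<equiv> Poly_Mapping.keys"
abbreviation lookup where "lookup \<equiv> Poly_Mapping.lookup"
abbreviation single where "single \<equiv> Poly_Mapping.single"

definition meval :: "('k::field \<Rightarrow> 'r::comm_ring_1) \<Rightarrow> ('n::finite \<Rightarrow> 'r) \<Rightarrow> ('n, 'k) mpol \<Rightarrow> 'r" where
  "meval \<kappa> \<sigma> p = (\<Sum>m\<in>keys p. \<kappa> (lookup p m) * (\<Prod>i\<in>UNIV. \<sigma> i ^ lookup m i))"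

lemma mpol_induct [case_names single add]:
  assumes "\<And>m c. P (single m c)" "\<And>p q. P p \<Longrightarrow> P q \<Longrightarrow> P (p + q)"
  shows "P (p :: ('n, 'k::field) mpol)"
proof (induction p rule: update_induct)
  case const
  show ?case using assms(1)[of 0 0] by simp
next
  case (update f a b)
  have "Poly_Mapping.update a b f = f + single a b"
    by (rule poly_mapping_eqI)
       (use update.hyps in \<open>auto simp: lookup_add lookup_single lookup_update when_def in_keys_iff\<close>)
  thus ?case using assms update.IH by metis
qed

lemma Var_power: "Var i ^ n = (single (single i n) 1 :: ('n, 'k::field) mpol)"
  by (induction n) (simp_all add: Var_def mult_single single_add[symmetric] del: single_one flip: single_one)

lemma single_mpol_conv: "single m c = Const c * (\<Prod>i\<in>UNIV. Var i ^ lookup m i)"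
  for m :: "'n::finite \<Rightarrow>\<^sub>0 nat" and c :: "'k::field"
proof -
  have pr: "(\<Prod>i\<in>S. single (f i) (1::'k)) = single (\<Sum>i\<in>S. f i) 1" if "finite S" for S and f :: "'n \<Rightarrow> 'n \<Rightarrow>\<^sub>0 nat"
    using that by (induction S rule: finite_induct) (simp_all add: mult_single)
  have "(\<Sum>i\<in>UNIV. single i (lookup m i)) = m"
    by (rule poly_mapping_eqI) (simp add: lookup_sum lookup_single when_def)
  thus ?thesis by (simp add: Var_power pr Const_def mult_single)
qed

context
  fixes \<kappa> :: "'k::field \<Rightarrow> 'r::comm_ring_1"
  assumes hom: "unital_hom \<kappa>"
begin

lemma meval_superset:
  assumes "finite A" "keys p \<subseteq> A"
  shows "meval \<kappa> \<sigma> p = (\<Sum>m\<in>A. \<kappa> (lookup p m) * (\<Prod>i\<in>UNIV. \<sigma> i ^ lookup m i))"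
  unfolding meval_def using assms
  by (intro sum.mono_neutral_left) (auto simp: in_keys_iff hom_simps[OF hom])

lemma meval_add: "meval \<kappa> \<sigma> (p + q) = meval \<kappa> \<sigma> p + meval \<kappa> \<sigma> q"
proof -
  let ?A = "keys p \<union> keys q"
  show ?thesis
    using meval_superset[of ?A "p + q" \<sigma>] meval_superset[of ?A p \<sigma>] meval_superset[of ?A q \<sigma>] keys_add[of p q]
    by (simp add: lookup_add hom_simps[OF hom] algebra_simps sum.distrib)
qed

lemma meval_single: "meval \<kappa> \<sigma> (single m c) = \<kappa> c * (\<Prod>i\<in>UNIV. \<sigma> i ^ lookup m i)"
  using meval_superset[of "{m}" "single m c" \<sigma>] by simp

lemma meval_Const: "meval \<kappa> \<sigma> (Const c) = \<kappa> c"
  by (simp add: Const_def meval_single)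

lemma meval_Var: "meval \<kappa> \<sigma> (Var i) = \<sigma> i"
proof -
  have "(\<Prod>j\<in>UNIV. \<sigma> j ^ lookup (single i (1::nat)) j) = (\<Prod>j\<in>UNIV. if j = i then \<sigma> i else 1)"
    by (intro prod.cong refl) (auto simp: lookup_single when_def)
  thus ?thesis by (simp add: Var_def meval_single hom_simps[OF hom])
qed

lemma meval_mult: "meval \<kappa> \<sigma> (p * q) = meval \<kappa> \<sigma> p * meval \<kappa> \<sigma> q"
proof (induction p rule: mpol_induct)
  case (single m c)
  show ?case
    by (induction q rule: mpol_induct)
       (simp_all add: mult_single meval_single meval_add distrib_left lookup_add power_add prod.distrib
          hom_simps[OF hom] mult_ac distrib_right)
qed (simp add: meval_add distrib_right)

end

lemma polys_in_iff: "p \<in> polys_in I \<longleftrightarrow> (\<forall>m\<in>keys p. \<forall>i. i \<notin> I \<longrightarrow> lookup m i = 0)"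
proof -
  have "keys m \<subseteq> I \<longleftrightarrow> (\<forall>i. i \<notin> I \<longrightarrow> lookup m i = 0)" for m :: "'a \<Rightarrow>\<^sub>0 nat"
    by (auto simp: in_keys_iff)
  thus ?thesis by (simp add: polys_in_def)
qed

lemma meval_cong:
  fixes \<sigma> \<tau> :: "'n::finite \<Rightarrow> 'r::comm_ring_1"
  assumes "p \<in> polys_in I" "\<And>i. i \<in> I \<Longrightarrow> \<sigma> i = \<tau> i"
  shows "meval \<kappa> \<sigma> p = meval \<kappa> \<tau> p"
  unfolding meval_def
proof (intro sum.cong refl arg_cong2[where f = "(*)"] prod.cong)
  fix m :: "'n \<Rightarrow>\<^sub>0 nat" and i assume "m \<in> keys p"
  moreover have "\<forall>m\<in>keys p. \<forall>i. i \<notin> I \<longrightarrow> lookup m i = 0" using assms(1) unfolding polys_in_iff .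
  ultimately have "i \<in> I \<or> lookup m i = 0" by metis
  thus "\<sigma> i ^ lookup m i = \<tau> i ^ lookup m i" using assms(2) by auto
qed

definition alg_end :: "(('n, 'k::field) mpol \<Rightarrow> ('n, 'k) mpol) \<Rightarrow> bool" where
  "alg_end F \<longleftrightarrow> (\<forall>p q. F (p + q) = F p + F q) \<and> (\<forall>p q. F (p * q) = F p * F q) \<and> (\<forall>c. F (Const c) = Const c)"

lemma alg_aut_iff: "alg_aut F \<longleftrightarrow> bij F \<and> alg_end F"
  by (auto simp: alg_aut_def alg_end_def)

lemma Const_simps: "Const 0 = 0" "Const 1 = 1" "Const (a + b) = Const a + Const b" "Const (a * b) = Const a * Const b"
  by (simp_all add: Const_def single_add mult_single)

lemma unital_hom_Const: "unital_hom Const"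
  by (simp add: unital_hom_def Const_simps)

lemma Const_eq_0_iff [simp]: "Const c = 0 \<longleftrightarrow> c = 0"
  by (auto simp: Const_def) (metis lookup_single_eq lookup_zero)

lemma alg_end_hom:
  assumes "alg_end F"
  shows "F (p + q) = F p + F q" "F (p * q) = F p * F q" "F (Const c) = Const c" "F 0 = 0" "F 1 = 1"
    "F (- p) = - F p" "F (p - q) = F p - F q" "F (p ^ n) = F p ^ n"
    "F (sum f S) = (\<Sum>i\<in>S. F (f i))" "F (prod f S) = (\<Prod>i\<in>S. F (f i))"
proof -
  show add: "F (p + q) = F p + F q" for p q using assms unfolding alg_end_def by blast
  show mult: "F (p * q) = F p * F q" for p q using assms unfolding alg_end_def by blast
  show c: "F (Const c) = Const c" for c using assms unfolding alg_end_def by blast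
  show z: "F 0 = 0" using c[of 0] by (simp add: Const_simps)
  show o: "F 1 = 1" using c[of 1] by (simp add: Const_simps)
  show m: "F (- p) = - F p" for p using add[of p "- p"] z by (simp add: eq_neg_iff_add_eq_0 add.commute)
  show "F (p - q) = F p - F q" using add[of p "- q"] m[of q] by simp
  show "F (p ^ n) = F p ^ n" by (induction n) (simp_all add: o mult)
  show "F (sum f S) = (\<Sum>i\<in>S. F (f i))" by (induction S rule: infinite_finite_induct) (simp_all add: z add)
  show "F (prod f S) = (\<Prod>i\<in>S. F (f i))" by (induction S rule: infinite_finite_induct) (simp_all add: o mult)
qed

definition subst :: "('n::finite \<Rightarrow> ('n, 'k::field) mpol) \<Rightarrow> ('n, 'k) mpol \<Rightarrow> ('n, 'k) mpol" where
  "subst = meval Const"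

lemma alg_end_subst: "alg_end (subst \<sigma>)"
  by (simp add: alg_end_def subst_def meval_add[OF unital_hom_Const] meval_mult[OF unital_hom_Const] meval_Const[OF unital_hom_Const])

lemma subst_Var [simp]: "subst \<sigma> (Var i) = \<sigma> i"
  by (simp add: subst_def meval_Var[OF unital_hom_Const])

lemma alg_end_meval:
  assumes F: "alg_end F" and hom: "unital_hom \<kappa>"
  shows "meval \<kappa> \<sigma> (F p) = meval \<kappa> (\<lambda>i. meval \<kappa> \<sigma> (F (Var i))) p"
proof (induction p rule: mpol_induct)
  case (single m c)
  have pw: "meval \<kappa> \<sigma> (q ^ n) = meval \<kappa> \<sigma> q ^ n" for q n
    by (induction n) (simp_all add: meval_mult[OF hom] meval_Const[OF hom, of _ 1, unfolded Const_simps] hom_simps[OF hom])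
  have pr: "meval \<kappa> \<sigma> (prod f S) = (\<Prod>i\<in>S. meval \<kappa> \<sigma> (f i))" for f S
    by (induction S rule: infinite_finite_induct)
       (simp_all add: meval_mult[OF hom] meval_Const[OF hom, of _ 1, unfolded Const_simps] hom_simps[OF hom])
  show ?case
    by (subst single_mpol_conv)
       (simp add: alg_end_hom[OF F] meval_mult[OF hom] meval_Const[OF hom] pr pw meval_single[OF hom])
qed (simp add: alg_end_hom[OF F] meval_add[OF hom])

lemma alg_end_id: "alg_end id" by (simp add: alg_end_def)

lemma alg_end_comp: "alg_end F \<Longrightarrow> alg_end G \<Longrightarrow> alg_end (F \<circ> G)"
  by (simp add: alg_end_def)

lemma subst_Var_eq: "subst Var p = p"
proof (induction p rule: mpol_induct)
  case (single m c)
  show ?case by (subst (2) single_mpol_conv) (simp add: subst_def meval_single[OF unital_hom_Const])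
qed (simp add: alg_end_hom[OF alg_end_subst])

lemma alg_end_eq_subst: "alg_end F \<Longrightarrow> F p = subst (\<lambda>i. F (Var i)) p"
  using alg_end_meval[OF _ unital_hom_Const, of F Var p] by (simp flip: subst_def add: subst_Var_eq)

lemma alg_end_cong:
  fixes F G :: "('n::finite, 'k::field) mpol \<Rightarrow> ('n, 'k) mpol"
  assumes "alg_end F" "alg_end G" "p \<in> polys_in I" "\<And>i. i \<in> I \<Longrightarrow> F (Var i) = G (Var i)"
  shows "F p = G p"
  unfolding alg_end_eq_subst[OF assms(1), of p] alg_end_eq_subst[OF assms(2), of p] subst_def
  using assms(3,4) by (rule meval_cong)

lemma polys_in_UNIV [simp]: "p \<in> polys_in UNIV"
  by (simp add: polys_in_def)

lemma alg_end_ext: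
  fixes F G :: "('n::finite, 'k::field) mpol \<Rightarrow> ('n, 'k) mpol"
  assumes "alg_end F" "alg_end G" "\<And>i. F (Var i) = G (Var i)"
  shows "F = G"
  using alg_end_cong[OF assms(1,2) polys_in_UNIV assms(3)] by blast

lemma polys_in_mono: "I \<subseteq> J \<Longrightarrow> p \<in> polys_in I \<Longrightarrow> p \<in> polys_in J"
  unfolding polys_in_iff by blast

lemma polys_in_add: "p \<in> polys_in I \<Longrightarrow> q \<in> polys_in I \<Longrightarrow> p + q \<in> polys_in I"
  unfolding polys_in_iff using keys_add[of p q] by blast

lemma polys_in_uminus: "p \<in> polys_in I \<Longrightarrow> - p \<in> polys_in I"
  for p :: "('n, 'k::field) mpol"
  unfolding polys_in_iff by (auto simp: in_keys_iff)

lemma polys_in_diff: "p \<in> polys_in I \<Longrightarrow> q \<in> polys_in I \<Longrightarrow> p - q \<in> polys_in I"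
  for p :: "('n, 'k::field) mpol"
  using polys_in_add[OF _ polys_in_uminus[of q I], of p] by simp

lemma polys_in_mult: "p \<in> polys_in I \<Longrightarrow> q \<in> polys_in I \<Longrightarrow> p * q \<in> polys_in I"
  unfolding polys_in_iff using keys_mult[of p q] by (fastforce simp: lookup_add)

lemma polys_in_Const [simp]: "Const c \<in> polys_in I"
  by (auto simp: polys_in_iff Const_def)

lemma polys_in_0 [simp]: "0 \<in> polys_in I"
  by (simp add: polys_in_iff)

lemma polys_in_1 [simp]: "1 \<in> polys_in I"
  using polys_in_Const[of 1] by (simp add: Const_simps)

lemma Var_in_polys_in [simp]: "Var i \<in> polys_in I \<longleftrightarrow> i \<in> I"
  by (auto simp: polys_in_iff Var_def lookup_single when_def)

lemma polys_in_power: "p \<in> polys_in I \<Longrightarrow> p ^ n \<in> polys_in I"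
  by (induction n) (simp_all add: polys_in_mult)

lemma polys_in_sum: "(\<And>i. i \<in> S \<Longrightarrow> f i \<in> polys_in I) \<Longrightarrow> sum f S \<in> polys_in I"
  by (induction S rule: infinite_finite_induct) (simp_all add: polys_in_add)

lemmas polys_in_intros = polys_in_add polys_in_uminus polys_in_diff polys_in_mult polys_in_power

lemma mpol_sum_singles: "p = (\<Sum>m\<in>keys p. single m (lookup p m))"
  by (rule poly_mapping_eqI) (auto simp: lookup_sum lookup_single when_def in_keys_iff)

lemma polys_in_induct [consumes 1, case_names Const Var add mult]:
  fixes p :: "('n::finite, 'k::field) mpol"
  assumes p: "p \<in> polys_in I" and c: "\<And>c. P (Const c)" and v: "\<And>i. i \<in> I \<Longrightarrow> P (Var i)"
    and a: "\<And>p q. P p \<Longrightarrow> P q \<Longrightarrow> P (p + q)" and m: "\<And>p q. P p \<Longrightarrow> P q \<Longrightarrow> P (p * q)"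
  shows "P p"
proof -
  have P0: "P 0" "P 1" using c[of 0] c[of 1] by (simp_all add: Const_simps)
  have pw: "P (Var i ^ n)" if "i \<in> I \<or> n = 0" for i n
  proof (cases "i \<in> I")
    case True
    have "P (Var i ^ n)" for n by (induction n) (auto intro: m v[OF True] P0)
    thus ?thesis .
  next
    case False
    thus ?thesis using that P0 by simp
  qed
  have pr: "P (prod f S)" if "\<And>i. i \<in> S \<Longrightarrow> P (f i)" for f and S :: "'n set"
    using that by (induction S rule: infinite_finite_induct) (auto simp: P0 m)
  have sm: "P (sum f S)" if "\<And>i. i \<in> S \<Longrightarrow> P (f i)" for f and S :: "('n \<Rightarrow>\<^sub>0 nat) set"
    using that by (induction S rule: infinite_finite_induct) (auto simp: P0 a)
  have "P (\<Sum>m\<in>keys p. single m (lookup p m))"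
  proof (rule sm)
    fix t assume "t \<in> keys p"
    hence "i \<in> I \<or> lookup t i = 0" for i using p unfolding polys_in_iff by metis
    thus "P (single t (lookup p t))" by (subst single_mpol_conv) (intro m c pr pw)
  qed
  thus ?thesis using mpol_sum_singles[of p] by simp
qed

lemma alg_end_polys_in:
  fixes F :: "('n::finite, 'k::field) mpol \<Rightarrow> ('n, 'k) mpol"
  assumes "alg_end F" "p \<in> polys_in I" "\<And>i. i \<in> I \<Longrightarrow> F (Var i) \<in> polys_in J"
  shows "F p \<in> polys_in J"
  using assms(2)
  by (induction p rule: polys_in_induct) (auto simp: alg_end_hom[OF assms(1)] assms(3) polys_in_intros)

lemma expand_in_variable:
  fixes p :: "('n::finite, 'k::field) mpol"
  assumes "p \<in> polys_in (insert l I)"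
  obtains r N where "\<And>i. r i \<in> polys_in (I - {l})" "p = (\<Sum>i\<le>N. r i * Var l ^ i)"
proof -
  define r where "r i = (\<Sum>m\<in>{m\<in>keys p. lookup m l = i}. single (m - single l i) (lookup p m))" for i
  define N where "N = (\<Sum>m\<in>keys p. lookup m l)"
  have N: "lookup m l \<le> N" if "m \<in> keys p" for m
    unfolding N_def using that by (intro member_le_sum) auto
  have "r i \<in> polys_in (I - {l})" for i
    unfolding r_def
  proof (rule polys_in_sum)
    fix m assume "m \<in> {m\<in>keys p. lookup m l = i}"
    thus "single (m - single l i) (lookup p m) \<in> polys_in (I - {l})"
      using assms by (auto simp: polys_in_iff lookup_minus lookup_single when_def)
  qed
  moreover have "p = (\<Sum>i\<le>N. r i * Var l ^ i)"
  proof -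
    have "(\<Sum>i\<le>N. r i * Var l ^ i) = (\<Sum>i\<in>{..N}. \<Sum>m\<in>{m\<in>keys p. lookup m l = i}. single m (lookup p m))"
    proof (intro sum.cong refl)
      fix i
      have "m - single l i + single l i = m" if "lookup m l = i" for m :: "'n \<Rightarrow>\<^sub>0 nat"
        by (rule poly_mapping_eqI) (use that in \<open>auto simp: lookup_add lookup_minus lookup_single when_def\<close>)
      thus "r i * Var l ^ i = (\<Sum>m\<in>{m\<in>keys p. lookup m l = i}. single m (lookup p m))"
        unfolding r_def sum_distrib_right Var_power by (intro sum.cong refl) (simp add: mult_single)
    qed
    also have "\<dots> = (\<Sum>m\<in>keys p. single m (lookup p m))"
      by (rule sum.group) (use N in auto)
    finally show ?thesis using mpol_sum_singles[of p] by simp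
  qed
  ultimately show thesis using that by blast
qed

section \<open>Weighted degrees and degrees in one variable\<close>

lemma mdeg_add:
  fixes w :: "'n::finite \<Rightarrow> 'g::linordered_ab_group_add"
  shows "mdeg w (m + n) = mdeg w m + mdeg w n"
proof -
  have "(\<Sum>j<a + b. c) = (\<Sum>j<a. c) + (\<Sum>j<b. c)" for a b :: nat  and c :: 'g
    by (induction b) (simp_all add: algebra_simps)
  thus ?thesis by (simp add: mdeg_def lookup_add sum.distrib)
qed

lemma mdeg_0 [simp]: "mdeg w 0 = 0"
  by (simp add: mdeg_def)

lemma mdeg_single: "mdeg w (single i n) = (\<Sum>j<n. w i)"
proof -
  have "mdeg w (single i n) = (\<Sum>l\<in>UNIV. if l = i then (\<Sum>j<n. w i) else 0)"
    unfolding mdeg_def by (intro sum.cong refl) (auto simp: lookup_single when_def)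
  thus ?thesis by simp
qed

lemma mdeg_nonneg: "(\<And>i. w i \<ge> 0) \<Longrightarrow> mdeg w m \<ge> 0"
  unfolding mdeg_def by (intro sum_nonneg) auto

lemma mdeg_le_wdeg: "m \<in> keys p \<Longrightarrow> mdeg w m \<le> wdeg w p"
  unfolding wdeg_def by (intro Max_ge) auto

lemma wdeg_attained: "p \<noteq> 0 \<Longrightarrow> \<exists>m\<in>keys p. mdeg w m = wdeg w p"
  unfolding wdeg_def using Max_in[of "mdeg w ` keys p"] by (metis finite_imageI finite_keys image_is_empty keys_eq_empty imageE)

lemma wdeg_eqI: "m \<in> keys p \<Longrightarrow> mdeg w m = d \<Longrightarrow> (\<And>m. m \<in> keys p \<Longrightarrow> mdeg w m \<le> d) \<Longrightarrow> wdeg w p = d"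
  unfolding wdeg_def by (intro Max_eqI) auto

lemma wdeg_Const [simp]: "c \<noteq> 0 \<Longrightarrow> wdeg w (Const c) = 0"
  by (simp add: wdeg_def Const_def)

lemma wdeg_Var [simp]: "wdeg w (Var i :: ('n::finite, 'k::field) mpol) = w i"
  by (simp add: wdeg_def Var_def mdeg_single)

lemma Var_neq_0 [simp]: "Var i \<noteq> (0 :: ('n, 'k::field) mpol)"
  unfolding Var_def by (metis keys_single keys_zero insert_not_empty one_neq_zero)

lemma wdeg_add_dominant:
  assumes "p \<noteq> 0" "\<And>m. m \<in> keys q \<Longrightarrow> mdeg w m < wdeg w p"
  shows "p + q \<noteq> 0 \<and> wdeg w (p + q) = wdeg w p"
proof -
  obtain m where m: "m \<in> keys p" "mdeg w m = wdeg w p" using wdeg_attained[OF assms(1)] by blast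
  have "m \<notin> keys q" using assms(2) m(2) by force
  hence mk: "m \<in> keys (p + q)" using m(1) by (auto simp: in_keys_iff lookup_add)
  have "wdeg w (p + q) = wdeg w p"
  proof (rule wdeg_eqI[OF mk m(2)])
    fix m' assume "m' \<in> keys (p + q)"
    hence "m' \<in> keys p \<or> m' \<in> keys q" using keys_add[of p q] by blast
    thus "mdeg w m' \<le> wdeg w p" using mdeg_le_wdeg assms(2) by (metis less_imp_le)
  qed
  thus ?thesis using mk by auto
qed

text \<open>
  The product of the leading forms is nonzero, as the polynomial ring is a domain, and all other
  contributions have smaller degree.
\<close>

lemma wdeg_mult:
  fixes p q :: "('n::{finite, linorder}, 'k::field) mpol"
  assumes "p \<noteq> 0" "q \<noteq> 0"
  shows "wdeg w (p * q) = wdeg w p + wdeg w q"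
proof -
  define top where "top f = (\<Sum>m\<in>{m\<in>keys f. mdeg w m = wdeg w f}. single m (lookup f m))" for f :: "('n, 'k) mpol"
  have top: "lookup (top f) m = (if mdeg w m = wdeg w f then lookup f m else 0)" for f m
    by (auto simp: top_def lookup_sum lookup_single when_def in_keys_iff)
  have top0: "top f \<noteq> 0" if f: "f \<noteq> 0" for f
  proof -
    obtain m where m: "m \<in> keys f" "mdeg w m = wdeg w f" using wdeg_attained[OF f] by blast
    hence "lookup (top f) m \<noteq> 0" using top[of f m] by (simp add: in_keys_iff)
    thus ?thesis by auto
  qed
  have kt: "m \<in> keys f \<and> mdeg w m = wdeg w f" if "m \<in> keys (top f)" for f m
    using that top[of f m] by (auto simp: in_keys_iff split: if_splits)
  have low: "mdeg w m < wdeg w f" if "m \<in> keys (f - top f)" for f m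
  proof -
    have "mdeg w m \<noteq> wdeg w f" "m \<in> keys f" using that top[of f m]
      by (auto simp: in_keys_iff lookup_minus split: if_splits)
    thus ?thesis using mdeg_le_wdeg[of m f w] by simp
  qed
  have "top p * top q \<noteq> 0" using top0 assms by simp
  then obtain m where m: "m \<in> keys (top p * top q)" using keys_eq_empty[of "top p * top q"] by blast
  have tt: "mdeg w m = wdeg w p + wdeg w q" if "m \<in> keys (top p * top q)" for m
  proof -
    obtain a b where "m = a + b" "a \<in> keys (top p)" "b \<in> keys (top q)"
      using \<open>m \<in> keys (top p * top q)\<close> keys_mult[of "top p" "top q"] by blast
    thus ?thesis using kt[of a p] kt[of b q] by (simp add: mdeg_add)
  qed
  have wt: "wdeg w (top p * top q) = wdeg w p + wdeg w q"
    by (rule wdeg_eqI[OF m tt[OF m]]) (simp add: tt)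
  have "mdeg w m < wdeg w (top p * top q)" if "m \<in> keys (top p * (q - top q) + (p - top p) * q)" for m
  proof -
    from that have "m \<in> keys (top p * (q - top q)) \<or> m \<in> keys ((p - top p) * q)"
      using keys_add[of "top p * (q - top q)" "(p - top p) * q"] by blast
    thus ?thesis
    proof
      assume "m \<in> keys (top p * (q - top q))"
      then obtain a b where ab: "m = a + b" "a \<in> keys (top p)" "b \<in> keys (q - top q)"
        using keys_mult[of "top p" "q - top q"] by blast
      show ?thesis unfolding wt ab(1) mdeg_add
        using kt[OF ab(2)] low[OF ab(3)] by simp
    next
      assume "m \<in> keys ((p - top p) * q)"
      then obtain a b where ab: "m = a + b" "a \<in> keys (p - top p)" "b \<in> keys q"
        using keys_mult[of "p - top p" q] by blast
      show ?thesis unfolding wt ab(1) mdeg_add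
        by (rule add_less_le_mono[OF low[OF ab(2)] mdeg_le_wdeg[OF ab(3)]])
    qed
  qed
  hence "wdeg w (top p * top q + (top p * (q - top q) + (p - top p) * q)) = wdeg w (top p * top q)"
    using wdeg_add_dominant[OF \<open>top p * top q \<noteq> 0\<close>] by blast
  moreover have "top p * top q + (top p * (q - top q) + (p - top p) * q) = p * q"
    by (simp add: algebra_simps)
  ultimately show ?thesis by (simp add: wt)
qed

lemma wdeg_power:
  fixes p :: "('n::{finite, linorder}, 'k::field) mpol"
  assumes "p \<noteq> 0"
  shows "wdeg w (p ^ n) = (\<Sum>j<n. wdeg w p)"
  using assms wdeg_Const[of 1 w] by (induction n) (simp_all add: wdeg_mult Const_simps add.commute)

lemma nsum_strict_mono:
  fixes d :: "'g::linordered_ab_group_add" and i n :: nat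
  assumes "d > 0" "i < n"
  shows "(\<Sum>j<i. d) < (\<Sum>j<n. d)"
  using assms(2)
proof (induction n)
  case (Suc n)
  have "(\<Sum>j<i. d) \<le> (\<Sum>j<n. d)" using Suc by (cases "i = n") auto
  also have "\<dots> < (\<Sum>j<Suc n. d)" using assms(1) by simp
  finally show ?case .
qed simp

text \<open>
  If the coefficients have degree \<open>0\<close> and \<open>h\<close> has positive degree, the
  terms of a polynomial in \<open>h\<close> have different degrees and cannot cancel.
\<close>

lemma wdeg_power_sum:
  fixes h :: "('n::{finite, linorder}, 'k::field) mpol"
  assumes h: "h \<noteq> 0" "wdeg w h > 0"
    and r: "\<And>i. r i \<noteq> 0 \<Longrightarrow> wdeg w (r i) = 0"
    and p: "p = (\<Sum>i\<le>N. r i * h ^ i)" "p \<noteq> 0"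
  obtains n where "n \<le> N" "r n \<noteq> 0" "wdeg w p = (\<Sum>j<n. wdeg w h)" "p = (\<Sum>i\<le>n. r i * h ^ i)"
proof -
  have "\<exists>i\<le>N. r i \<noteq> 0"
  proof (rule ccontr)
    assume "\<not> ?thesis"
    hence "p = 0" unfolding p(1) by (intro sum.neutral) auto
    with p(2) show False ..
  qed
  define n where "n = Max {i. i \<le> N \<and> r i \<noteq> 0}"
  have fin: "finite {i. i \<le> N \<and> r i \<noteq> 0}" by simp
  have n: "n \<le> N" "r n \<noteq> 0" using Max_in[OF fin] \<open>\<exists>i\<le>N. r i \<noteq> 0\<close> unfolding n_def by blast+
  have zero: "r i = 0" if "n < i" "i \<le> N" for i
    using Max_ge[OF fin, of i] that unfolding n_def by fastforce
  have p': "p = (\<Sum>i\<le>n. r i * h ^ i)"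
    unfolding p(1) by (rule sum.mono_neutral_right) (use n zero in auto)
  have top: "wdeg w (r n * h ^ n) = (\<Sum>j<n. wdeg w h)"
    using n h r by (simp add: wdeg_mult wdeg_power)
  have "mdeg w m < wdeg w (r n * h ^ n)" if m: "m \<in> keys (\<Sum>i<n. r i * h ^ i)" for m
  proof -
    obtain i where i: "i < n" "m \<in> keys (r i * h ^ i)"
      using m keys_sum[of "\<lambda>i. r i * h ^ i" "{..<n}"] by auto
    hence "r i \<noteq> 0" by auto
    hence "wdeg w (r i * h ^ i) = (\<Sum>j<i. wdeg w h)" using h r by (simp add: wdeg_mult wdeg_power)
    hence "mdeg w m \<le> (\<Sum>j<i. wdeg w h)" using mdeg_le_wdeg[OF i(2), of w] by simp
    also have "\<dots> < (\<Sum>j<n. wdeg w h)" by (rule nsum_strict_mono[OF h(2) i(1)])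
    finally show ?thesis by (simp add: top)
  qed
  hence "wdeg w (r n * h ^ n + (\<Sum>i<n. r i * h ^ i)) = (\<Sum>j<n. wdeg w h)"
    using wdeg_add_dominant[of "r n * h ^ n" "\<Sum>i<n. r i * h ^ i" w] n h top by simp
  moreover have "r n * h ^ n + (\<Sum>i<n. r i * h ^ i) = p"
    unfolding p' lessThan_Suc_atMost[symmetric] by simp
  ultimately show thesis using that n p' by metis
qed

definition vdeg :: "'n \<Rightarrow> ('n::finite, 'k::field) mpol \<Rightarrow> int" where
  "vdeg x = wdeg (\<lambda>i. if i = x then 1 else 0)"

lemma mdeg_indicator: "mdeg (\<lambda>i. if i = x then 1 else 0 :: int) m = int (lookup m x)"
proof -
  have "mdeg (\<lambda>i. if i = x then 1 else 0 :: int) m = (\<Sum>i\<in>UNIV. if i = x then int (lookup m x) else 0)"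
    unfolding mdeg_def by (intro sum.cong refl) auto
  thus ?thesis by simp
qed

lemma vdeg_nonneg: "p \<noteq> 0 \<Longrightarrow> vdeg x p \<ge> 0"
  unfolding vdeg_def using wdeg_attained[of p "\<lambda>i. if i = x then 1 else 0 :: int"]
  by (auto simp: mdeg_indicator)

lemma vdeg_eq_0_iff: "p \<noteq> 0 \<Longrightarrow> vdeg x p = 0 \<longleftrightarrow> p \<in> polys_in (- {x})"
proof
  assume "p \<noteq> 0" "vdeg x p = 0"
  thus "p \<in> polys_in (- {x})"
    unfolding polys_in_iff vdeg_def using mdeg_le_wdeg[of _ p "\<lambda>i. if i = x then 1 else 0 :: int"]
    by (auto simp: mdeg_indicator)
next
  assume "p \<noteq> 0" "p \<in> polys_in (- {x})"
  thus "vdeg x p = 0" using wdeg_attained[of p "\<lambda>i. if i = x then 1 else 0 :: int"]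
    unfolding vdeg_def polys_in_iff by (auto simp: mdeg_indicator)
qed

lemma vdeg_mult:
  fixes p q :: "('n::{finite, linorder}, 'k::field) mpol"
  shows "p \<noteq> 0 \<Longrightarrow> q \<noteq> 0 \<Longrightarrow> vdeg x (p * q) = vdeg x p + vdeg x q"
  unfolding vdeg_def by (rule wdeg_mult)

lemma polys_in_Int: "(\<And>x. x \<notin> I \<Longrightarrow> p \<in> polys_in (- {x})) \<Longrightarrow> p \<in> polys_in I"
  unfolding polys_in_iff by (metis Compl_iff insertI1)

lemma polys_in_factor:
  fixes p q :: "('n::{finite, linorder}, 'k::field) mpol"
  assumes "p * q \<in> polys_in I" "p \<noteq> 0" "q \<noteq> 0"
  shows "p \<in> polys_in I"
proof (rule polys_in_Int)
  fix x assume x: "x \<notin> I"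
  hence "p * q \<in> polys_in (- {x})" using assms(1) polys_in_mono[of I "- {x}"] by blast
  hence "vdeg x p + vdeg x q = 0" using assms vdeg_eq_0_iff[of "p * q" x] vdeg_mult[of p q x] by simp
  hence "vdeg x p = 0" using vdeg_nonneg[of p x] vdeg_nonneg[of q x] assms by linarith
  thus "p \<in> polys_in (- {x})" using vdeg_eq_0_iff assms by blast
qed

lemma polys_in_empty:
  fixes p :: "('n::finite, 'k::field) mpol"
  assumes "p \<in> polys_in {}"
  obtains c where "p = Const c"
proof -
  have "m = 0" if "m \<in> keys p" for m
    by (rule poly_mapping_eqI) (use assms that in \<open>auto simp: polys_in_iff\<close>)
  hence k: "keys p \<subseteq> {0}" by blast
  have "p = (\<Sum>m\<in>{0}. single m (lookup p m))"
    by (subst mpol_sum_singles, rule sum.mono_neutral_left) (use k in \<open>auto simp: in_keys_iff\<close>)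
  hence "p = Const (lookup p 0)" by (simp add: Const_def)
  thus thesis by (rule that)
qed

lemma mpol_unit_Const:
  fixes p q :: "('n::{finite, linorder}, 'k::field) mpol"
  assumes "p * q = 1"
  obtains c where "c \<noteq> 0" "p = Const c"
proof -
  have nz: "p \<noteq> 0" "q \<noteq> 0" using assms by auto
  have "p \<in> polys_in {}" by (rule polys_in_factor[of p q]) (use assms nz in auto)
  then obtain c where "p = Const c" by (rule polys_in_empty)
  thus thesis using that[of c] nz by auto
qed

lemma vdeg_power_sum:
  fixes h :: "('n::{finite, linorder}, 'k::field) mpol"
  assumes h: "h \<noteq> 0" "vdeg x h > 0"
    and r: "\<And>i. r i \<in> polys_in (- {x})"
    and p: "p = (\<Sum>i\<le>N. r i * h ^ i)" "p \<noteq> 0"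
  obtains n where "n \<le> N" "r n \<noteq> 0" "vdeg x p = int n * vdeg x h" "p = (\<Sum>i\<le>n. r i * h ^ i)"
proof (rule wdeg_power_sum[OF h[unfolded vdeg_def] _ p])
  show "r i \<noteq> 0 \<Longrightarrow> wdeg (\<lambda>i. if i = x then 1 else 0 :: int) (r i) = 0" for i
    using vdeg_eq_0_iff[of "r i" x] r[of i] by (simp add: vdeg_def)
  fix n assume "n \<le> N" "r n \<noteq> 0" "wdeg (\<lambda>i. if i = x then 1 else 0) p = (\<Sum>j<n. wdeg (\<lambda>i. if i = x then 1 else 0 :: int) h)"
    "p = (\<Sum>i\<le>n. r i * h ^ i)"
  thus thesis using that[of n] by (simp add: vdeg_def)
qed

text \<open>
  Expand \<open>P\<close> in the variable \<open>x\<^sub>l\<close>, the only one whose image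
  involves \<open>x\<close>. As powers of that image have different degrees in \<open>x\<close>,
  only the constant term of the expansion contributes to an image that is free of
  \<open>x\<close>.
\<close>

lemma endomorphism_image_free_of_variable:
  fixes F :: "('n::{finite, linorder}, 'k::field) mpol \<Rightarrow> ('n, 'k) mpol"
  assumes F: "alg_end F" and I: "l \<notin> I" "\<And>i. i \<in> I \<Longrightarrow> F (Var i) \<in> polys_in (- {x})"
    and h: "F (Var l) \<notin> polys_in (- {x})"
    and P: "P \<in> polys_in (insert l I)" "F P \<in> polys_in (- {x})"
  obtains P0 where "P0 \<in> polys_in I" "F P0 = F P"
proof (cases "F P = 0")
  case True
  thus thesis using that[of 0] by (simp add: alg_end_hom[OF F])
next
  case False
  have h0: "F (Var l) \<noteq> 0" using h by auto
  have hpos: "vdeg x (F (Var l)) > 0"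
    using h0 h vdeg_eq_0_iff[OF h0, of x] vdeg_nonneg[OF h0, of x] by linarith
  obtain r N where r: "\<And>i. r i \<in> polys_in (I - {l})" "P = (\<Sum>i\<le>N. r i * Var l ^ i)"
    using expand_in_variable[OF P(1)] by blast
  have rI: "r i \<in> polys_in I" for i using r(1)[of i] I(1) by simp
  have FP: "F P = (\<Sum>i\<le>N. F (r i) * F (Var l) ^ i)" by (simp add: r(2) alg_end_hom[OF F])
  obtain n where n: "vdeg x (F P) = int n * vdeg x (F (Var l))" "F P = (\<Sum>i\<le>n. F (r i) * F (Var l) ^ i)"
    using vdeg_power_sum[OF h0 hpos alg_end_polys_in[OF F rI I(2)] FP False] by blast
  have "n = 0" using n(1) hpos vdeg_eq_0_iff[OF False, of x] P(2) by simp
  hence "F (r 0) = F P" using n(2) by simp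
  thus thesis using that[OF rI] by blast
qed

text \<open>
  Comparing degrees in \<open>x\<close> in \<open>x = F(P)\<close> shows that both
  \<open>P\<close> in \<open>x\<^sub>l\<close> and \<open>F(x\<^sub>l)\<close> in \<open>x\<close>
  are effectively of degree \<open>1\<close>, and the product of the two leading coefficients is
  \<open>1\<close>.
\<close>

lemma triangular_endomorphism:
  fixes F :: "('n::{finite, linorder}, 'k::field) mpol \<Rightarrow> ('n, 'k) mpol"
  assumes F: "alg_end F" and I: "l \<notin> I" "\<And>i. i \<in> I \<Longrightarrow> F (Var i) \<in> polys_in J"
    and J: "x \<notin> J" "F (Var l) \<in> polys_in (insert x J)"
    and P: "P \<in> polys_in (insert l I)" "F P = Var x"
  obtains \<alpha> q where "\<alpha> \<noteq> 0" "q \<in> polys_in J" "F (Var l) = Const \<alpha> * Var x + q"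
proof -
  define h where "h = F (Var l)"
  have Jx: "p \<in> polys_in (- {x})" if "p \<in> polys_in J" for p :: "('n, 'k) mpol"
    using J(1) by (intro polys_in_mono[OF _ that]) auto
  have hx: "h \<notin> polys_in (- {x})"
  proof
    assume "h \<in> polys_in (- {x})"
    hence "F P \<in> polys_in (- {x})"
      using I by (intro alg_end_polys_in[OF F P(1)]) (auto simp: h_def intro: Jx)
    thus False by (simp add: P(2))
  qed
  have h0: "h \<noteq> 0" using hx by auto
  have hpos: "vdeg x h > 0"
    using h0 hx vdeg_eq_0_iff[OF h0, of x] vdeg_nonneg[OF h0, of x] by linarith
  obtain r N where r: "\<And>i. r i \<in> polys_in (I - {l})" "P = (\<Sum>i\<le>N. r i * Var l ^ i)"
    using expand_in_variable[OF P(1)] by blast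
  have rI: "r i \<in> polys_in I" for i using r(1)[of i] I(1) by simp
  have rJ: "F (r i) \<in> polys_in J" for i by (rule alg_end_polys_in[OF F rI I(2)])
  have FP: "Var x = (\<Sum>i\<le>N. F (r i) * h ^ i)" unfolding P(2)[symmetric] by (simp add: r(2) h_def alg_end_hom[OF F])
  obtain n where n: "vdeg x (Var x :: ('n, 'k) mpol) = int n * vdeg x h" "Var x = (\<Sum>i\<le>n. F (r i) * h ^ i)"
    using vdeg_power_sum[OF h0 hpos Jx[OF rJ] FP] by auto
  have "int n * vdeg x h = 1" using n(1) by (simp add: vdeg_def)
  hence n1: "n = 1" and deg1: "vdeg x h = 1" using hpos by (auto simp: zmult_eq_1_iff)
  have Vx: "Var x = F (r 0) + F (r 1) * h" using n(2) by (simp add: n1)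
  obtain s M where s: "\<And>i. s i \<in> polys_in (J - {x})" "h = (\<Sum>i\<le>M. s i * Var x ^ i)"
    using expand_in_variable[OF J(2)] unfolding h_def by blast
  have sJ: "s i \<in> polys_in J" for i using s(1)[of i] J(1) by simp
  have xpos: "vdeg x (Var x :: ('n, 'k) mpol) > 0" by (simp add: vdeg_def)
  obtain n' where n': "vdeg x h = int n' * vdeg x (Var x :: ('n, 'k) mpol)" "h = (\<Sum>i\<le>n'. s i * Var x ^ i)"
    using vdeg_power_sum[OF Var_neq_0 xpos Jx[OF sJ] s(2) h0] by blast
  have "n' = 1" using n'(1) deg1 by (simp add: vdeg_def)
  hence hs: "h = s 0 + s 1 * Var x" using n'(2) by simp
  have eq: "Var x * (1 - F (r 1) * s 1) = F (r 0) + F (r 1) * s 0"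
    using Vx unfolding hs by (simp add: algebra_simps)
  have "1 - F (r 1) * s 1 = 0"
  proof (rule ccontr)
    assume nz: "1 - F (r 1) * s 1 \<noteq> 0"
    have "F (r 0) + F (r 1) * s 0 \<in> polys_in (- {x})" by (intro polys_in_intros Jx rJ sJ)
    moreover have "F (r 0) + F (r 1) * s 0 \<noteq> 0" using eq nz by (metis Var_neq_0 mult_eq_0_iff)
    ultimately have "vdeg x (Var x * (1 - F (r 1) * s 1)) = 0" using vdeg_eq_0_iff eq by metis
    hence "vdeg x (Var x :: ('n, 'k) mpol) + vdeg x (1 - F (r 1) * s 1) = 0"
      using vdeg_mult[OF Var_neq_0 nz] by simp
    thus False using xpos vdeg_nonneg[OF nz, of x] by linarith
  qed
  hence "s 1 * F (r 1) = 1" by (simp add: mult.commute)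
  then obtain c where "c \<noteq> 0" "s 1 = Const c" by (rule mpol_unit_Const)
  thus thesis using that[of c "s 0"] sJ[of 0] hs by (simp add: h_def add.commute)
qed

section \<open>Generators of the tame group\<close>

lemma Tame_carrier: "F \<in> Tame \<Longrightarrow> alg_aut F"
proof -
  assume "F \<in> Tame"
  moreover have "{F :: ('a, 'b) mpol \<Rightarrow> ('a, 'b) mpol. affine_aut F} \<union> {F. elementary_aut F} \<subseteq> carrier Aut"
    by (auto simp: affine_aut_def elementary_aut_def)
  ultimately have "F \<in> carrier Aut" unfolding Tame_def using group.generate_in_carrier[OF group_Aut] by blast
  thus ?thesis by (simp add: Aut_def)
qed

lemma Tame_comp: "F \<in> Tame \<Longrightarrow> G \<in> Tame \<Longrightarrow> F \<circ> G \<in> Tame"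
  unfolding Tame_def using generate.eng[of F Aut _ G] by (simp add: Aut_def)

lemma Tame_inverse:
  fixes F :: "('n::finite, 'k::field) mpol \<Rightarrow> ('n, 'k) mpol"
  assumes "F \<in> Tame"
  obtains G where "G \<in> Tame" "F \<circ> G = id" "G \<circ> F = id"
proof -
  let ?A = "Aut :: (('n, 'k) mpol \<Rightarrow> ('n, 'k) mpol) monoid"
  interpret group ?A by (rule group_Aut)
  have sub: "{F. affine_aut F} \<union> {F. elementary_aut F} \<subseteq> carrier ?A"
    by (auto simp: affine_aut_def elementary_aut_def)
  have F: "F \<in> carrier ?A" using Tame_carrier[OF assms] by (simp add: Aut_def)
  define G where "G = inv\<^bsub>?A\<^esub> F"
  have "G \<in> Tame" using generate_m_inv_closed[OF sub, of F] assms unfolding Tame_def G_def by simp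
  moreover have "F \<circ> G = id" "G \<circ> F = id"
    using r_inv[OF F] l_inv[OF F] by (simp_all add: G_def Aut_def)
  ultimately show thesis by (rule that)
qed

lemma Tame_cancel_left:
  assumes "T \<in> Tame" "T \<circ> F \<in> Tame"
  shows "F \<in> Tame"
proof -
  obtain G where "G \<in> Tame" "G \<circ> T = id" using Tame_inverse[OF assms(1)] by blast
  moreover from this have "G \<circ> (T \<circ> F) = F" by (simp add: comp_assoc[symmetric])
  ultimately show ?thesis using Tame_comp[of G "T \<circ> F"] assms by simp
qed

lemma Tame_cancel_right:
  assumes "T \<in> Tame" "F \<circ> T \<in> Tame"
  shows "F \<in> Tame"
proof -
  obtain G where "G \<in> Tame" "T \<circ> G = id" using Tame_inverse[OF assms(1)] by blast
  moreover from this have "(F \<circ> T) \<circ> G = F" by (simp add: comp_assoc)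
  ultimately show ?thesis using Tame_comp[of "F \<circ> T" G] assms by simp
qed

lemma affine_in_Tame: "affine_aut F \<Longrightarrow> F \<in> Tame"
  unfolding Tame_def by (rule generate.incl) simp

lemma elementary_in_Tame: "elementary_aut F \<Longrightarrow> F \<in> Tame"
  unfolding Tame_def by (rule generate.incl) simp

definition permute :: "('n \<Rightarrow> 'n) \<Rightarrow> ('n::finite, 'k::field) mpol \<Rightarrow> ('n, 'k) mpol" where
  "permute f = subst (\<lambda>i. Var (f i))"

lemma permute_Var [simp]: "permute f (Var i) = Var (f i)"
  by (simp add: permute_def)

lemma alg_end_permute: "alg_end (permute f)"
  by (simp add: permute_def alg_end_subst)

lemma permute_in_Tame:
  assumes "bij f"
  shows "permute f \<in> Tame"
proof -
  have id: "permute g \<circ> permute h = id" if "\<And>i. g (h i) = i" for g h :: "'a \<Rightarrow> 'a"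
    by (rule alg_end_ext) (simp_all add: alg_end_comp alg_end_permute alg_end_id that)
  have "bij (permute f :: ('a, 'b) mpol \<Rightarrow> _)"
    using id[of "inv_into UNIV f" f] id[of f "inv_into UNIV f"] assms
    by (intro o_bij[of "permute (inv_into UNIV f)"]) (simp_all add: bij_is_inj bij_is_surj surj_f_inv_f)
  hence "affine_aut (permute f :: ('a, 'b) mpol \<Rightarrow> _)"
    by (simp add: affine_aut_def Aut_def alg_aut_iff alg_end_permute total_deg_def)
  thus ?thesis by (rule affine_in_Tame)
qed

definition shear :: "'n \<Rightarrow> 'k \<Rightarrow> ('n, 'k) mpol \<Rightarrow> ('n::finite, 'k::field) mpol \<Rightarrow> ('n, 'k) mpol" where
  "shear l \<alpha> q = subst (\<lambda>i. if i = l then Const \<alpha> * Var l + q else Var i)"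

lemma alg_end_shear: "alg_end (shear l \<alpha> q)"
  by (simp add: shear_def alg_end_subst)

lemma shear_Var: "shear l \<alpha> q (Var i) = (if i = l then Const \<alpha> * Var l + q else Var i)"
  by (simp add: shear_def)

lemma shear_fix:
  assumes "p \<in> polys_in (- {l})"
  shows "shear l \<alpha> q p = p"
  using alg_end_cong[OF alg_end_shear alg_end_id assms, of l \<alpha> q] by (simp add: shear_Var)

lemma shear_in_Tame:
  fixes q :: "('n::finite, 'k::field) mpol"
  assumes "\<alpha> \<noteq> 0" "q \<in> polys_in (- {l})"
  shows "shear l \<alpha> q \<in> Tame"
proof -
  have inv: "shear l \<alpha> q \<circ> shear l (1 / \<alpha>) (- Const (1 / \<alpha>) * q) = id"
    if "\<alpha> \<noteq> 0" "q \<in> polys_in (- {l})" for \<alpha> and q :: "('n, 'k) mpol"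
  proof (rule alg_end_ext)
    fix i
    have "Const (1 / \<alpha>) * (Const \<alpha> * Var l + q) - Const (1 / \<alpha>) * q = Const (1 / \<alpha>) * Const \<alpha> * Var l"
      by (simp add: algebra_simps)
    also have "Const (1 / \<alpha>) * Const \<alpha> = 1"
      using that(1) by (simp add: Const_simps(4)[symmetric] Const_simps(2))
    finally show "(shear l \<alpha> q \<circ> shear l (1 / \<alpha>) (- Const (1 / \<alpha>) * q)) (Var i) = id (Var i)"
      by (simp add: shear_Var alg_end_hom[OF alg_end_shear] shear_fix[OF that(2)])
  qed (simp_all add: alg_end_comp alg_end_shear alg_end_id)
  define \<alpha>' q' where "\<alpha>' = 1 / \<alpha>" and "q' = - Const (1 / \<alpha>) * q"
  have ok: "\<alpha>' \<noteq> 0" "q' \<in> polys_in (- {l})" using assms by (auto simp: \<alpha>'_def q'_def intro!: polys_in_intros)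
  have "- Const (1 / \<alpha>') * q' = q"
  proof -
    have "Const \<alpha> * Const (1 / \<alpha>) = (1 :: ('n, 'k) mpol)"
      using assms(1) by (simp add: Const_simps(4)[symmetric] Const_simps(2))
    thus ?thesis by (simp add: \<alpha>'_def q'_def mult.assoc[symmetric])
  qed
  hence "shear l \<alpha>' q' \<circ> shear l \<alpha> q = id" using inv[OF ok] by (simp add: \<alpha>'_def)
  moreover have "shear l \<alpha> q \<circ> shear l \<alpha>' q' = id" using inv[OF assms] by (simp add: \<alpha>'_def q'_def)
  ultimately have "bij (shear l \<alpha> q)" by (intro o_bij)
  hence "elementary_aut (shear l \<alpha> q)"
    unfolding elementary_aut_def using assms
    by (auto simp: Aut_def alg_aut_iff alg_end_shear shear_Var intro!: exI[of _ l] exI[of _ \<alpha>] exI[of _ q])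
  thus ?thesis by (rule elementary_in_Tame)
qed

section \<open>Polynomials in two variables as iterated Laurent series\<close>

lemma exponents_two_variables:
  assumes "a \<noteq> b" "p \<in> polys_in {a, b}" "m \<in> keys p"
  shows "single a (lookup m a) + single b (lookup m b) = m"
proof (rule poly_mapping_eqI)
  fix i
  have "i \<noteq> a \<Longrightarrow> i \<noteq> b \<Longrightarrow> lookup m i = 0"
    using assms unfolding polys_in_iff by (metis insertE singletonD)
  thus "lookup (single a (lookup m a) + single b (lookup m b)) i = lookup m i"
    using assms(1) by (auto simp: lookup_add lookup_single when_def)
qed

lemma inj_two_exponents: "x \<noteq> y \<Longrightarrow> inj (\<lambda>(i, j). single x i + single y j :: 'n \<Rightarrow>\<^sub>0 nat)"
proof (rule injI, clarify)
  fix i j i' j' assume xy: "x \<noteq> y" and "single x i + single y j = (single x i' + single y j' :: 'n \<Rightarrow>\<^sub>0 nat)"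
  hence "lookup (single x i + single y j) l = lookup (single x i' + single y j') l" for l by simp
  from this[of x] this[of y] show "i = i' \<and> j = j'"
    using xy by (simp add: lookup_add lookup_single when_def split: if_splits)
qed

text \<open>
  Evaluation as a double sum over a square of exponents, the form in which \<open>bipoly\<close>
  is given.
\<close>

lemma meval_two_variables:
  fixes p :: "('n::finite, 'k::field) mpol"
  assumes hom: "unital_hom \<kappa>" and ab: "a \<noteq> b" and p: "p \<in> polys_in {a, b}"
    and N: "\<And>m. m \<in> keys p \<Longrightarrow> lookup m a \<le> N \<and> lookup m b \<le> N"
  shows "meval \<kappa> \<sigma> p = (\<Sum>(i, j)\<in>{..N} \<times> {..N}. \<kappa> (lookup p (single a i + single b j)) * \<sigma> a ^ i * \<sigma> b ^ j)"
proof -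
  have pr: "(\<Prod>i\<in>UNIV. \<sigma> i ^ lookup (single a i' + single b j') i) = \<sigma> a ^ i' * \<sigma> b ^ j'" for i' j'
  proof -
    have "(\<Prod>i\<in>UNIV. \<sigma> i ^ lookup (single a i' + single b j') i)
        = (\<Prod>i\<in>UNIV. (if i = a then \<sigma> a ^ i' else 1) * (if i = b then \<sigma> b ^ j' else 1))"
      by (intro prod.cong refl) (use ab in \<open>auto simp: lookup_add lookup_single when_def\<close>)
    thus ?thesis by (simp add: prod.distrib)
  qed
  define g where "g = (\<lambda>(i, j). single a i + single b j :: 'n \<Rightarrow>\<^sub>0 nat)"
  have inj: "inj_on g ({..N} \<times> {..N})"
    using inj_two_exponents[OF ab] unfolding g_def by (rule inj_on_subset) simp
  have "keys p \<subseteq> g ` ({..N} \<times> {..N})"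
  proof
    fix m assume m: "m \<in> keys p"
    hence "m = g (lookup m a, lookup m b)" using exponents_two_variables[OF ab p] by (simp add: g_def)
    thus "m \<in> g ` ({..N} \<times> {..N})" using N[OF m] by blast
  qed
  hence "meval \<kappa> \<sigma> p = (\<Sum>m\<in>g ` ({..N} \<times> {..N}). \<kappa> (lookup p m) * (\<Prod>i\<in>UNIV. \<sigma> i ^ lookup m i))"
    by (intro meval_superset[OF hom]) auto
  also have "\<dots> = (\<Sum>x\<in>{..N} \<times> {..N}. \<kappa> (lookup p (g x)) * (\<Prod>i\<in>UNIV. \<sigma> i ^ lookup (g x) i))"
    by (rule sum.reindex_cong[OF inj]) auto
  finally show ?thesis by (simp add: g_def pr case_prod_unfold mult.assoc)
qed

lemma exponents_bounded: "\<exists>N. \<forall>m\<in>keys p. \<forall>i\<in>I. lookup m i \<le> N" if "finite I" for p :: "('n, 'k::field) mpol"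
proof -
  have "lookup m i \<le> (\<Sum>m\<in>keys p. \<Sum>i\<in>I. lookup m i)" if "m \<in> keys p" "i \<in> I" for m i
  proof -
    have "lookup m i \<le> (\<Sum>i\<in>I. lookup m i)" using that \<open>finite I\<close> by (intro member_le_sum) auto
    also have "\<dots> \<le> (\<Sum>m\<in>keys p. \<Sum>i\<in>I. lookup m i)" using that by (intro member_le_sum) auto
    finally show ?thesis .
  qed
  thus ?thesis by blast
qed

text \<open>
  The embedding \<open>k[x\<^sub>a, x\<^sub>b] \<rightarrow> k((s))((\<tau>))\<close> with
  \<open>x\<^sub>a \<mapsto> s\<close> and \<open>x\<^sub>b \<mapsto> 1/\<tau>\<close>; the degree
  in \<open>x\<^sub>b\<close> becomes the negative of the value.
\<close>

definition laurent :: "'n \<Rightarrow> 'n \<Rightarrow> ('n::finite, 'k::field) mpol \<Rightarrow> 'k fls fls" where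
  "laurent a b = meval cst (\<lambda>i. if i = a then fls_const fls_X else if i = b then fls_X_inv else 0)"

lemma laurent_nth:
  fixes p :: "('n::finite, 'k::field) mpol"
  assumes "a \<noteq> b" "p \<in> polys_in {a, b}"
  shows "n > 0 \<Longrightarrow> laurent a b p $$ n = 0"
    and "laurent a b p $$ (- int j) $$ int i = lookup p (single a i + single b j)"
proof -
  obtain N0 where N0: "\<And>m. m \<in> keys p \<Longrightarrow> lookup m a \<le> N0 \<and> lookup m b \<le> N0"
    using exponents_bounded[of "{a, b}" p] by auto
  define N where "N = N0 + i + j"
  have N: "\<And>m. m \<in> keys p \<Longrightarrow> lookup m a \<le> N \<and> lookup m b \<le> N" using N0 by (force simp: N_def)
  have tm: "cst c * (fls_const fls_X) ^ i * fls_X_inv ^ j = fls_const (fls_const c * fls_X ^ i) * fls_X_inv ^ j"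
    for c :: 'k and i j
  proof -
    have "(fls_const x) ^ i = fls_const (x ^ i)" for x :: "'k fls" by (induction i) simp_all
    thus ?thesis by (simp add: cst_def)
  qed
  have nth: "(cst c * (fls_const fls_X) ^ i * fls_X_inv ^ j) $$ k = (if k = - int j then fls_const c * fls_X ^ i else 0)"
    for c :: 'k and i j k unfolding tm by simp
  define \<sigma> :: "'n \<Rightarrow> 'k fls fls" where "\<sigma> i = (if i = a then fls_const fls_X else if i = b then fls_X_inv else 0)" for i
  have \<sigma>: "\<sigma> a = fls_const fls_X" "\<sigma> b = fls_X_inv" using assms(1) by (auto simp: \<sigma>_def)
  have "laurent a b p = (\<Sum>(i, j)\<in>{..N} \<times> {..N}. cst (lookup p (single a i + single b j)) * \<sigma> a ^ i * \<sigma> b ^ j)"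
    using meval_two_variables[OF unital_hom_cst assms N, of \<sigma>] unfolding laurent_def \<sigma>_def[abs_def] by simp
  hence sum: "laurent a b p $$ k = (\<Sum>(i, j)\<in>{..N} \<times> {..N}. if k = - int j then fls_const (lookup p (single a i + single b j)) * fls_X ^ i else 0)" for k
    by (simp add: fls_nth_sum case_prod_unfold nth \<sigma>)
  show "n > 0 \<Longrightarrow> laurent a b p $$ n = 0" unfolding sum by (intro sum.neutral) auto
  have "laurent a b p $$ (- int j) $$ int i
      = (\<Sum>(i', j')\<in>{..N} \<times> {..N}. if (i', j') = (i, j) then lookup p (single a i + single b j) else 0)"
    unfolding sum fls_nth_sum by (intro sum.cong refl) (simp add: case_prod_unfold)
  also have "\<dots> = (\<Sum>x\<in>{..N} \<times> {..N}. if x = (i, j) then lookup p (single a i + single b j) else 0)"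
    by (intro sum.cong refl) (simp add: case_prod_unfold prod_eq_iff)
  also have "\<dots> = lookup p (single a i + single b j)" by (subst sum.delta) (auto simp: N_def)
  finally show "laurent a b p $$ (- int j) $$ int i = lookup p (single a i + single b j)" .
qed

lemma laurent_hom:
  "laurent a b (p + q) = laurent a b p + laurent a b q"
  "laurent a b (p * q) = laurent a b p * laurent a b q"
  "laurent a b (Const c) = cst c"
  "laurent a b (p - q) = laurent a b p - laurent a b q"
  "laurent a b (p ^ n) = laurent a b p ^ n"
proof -
  show add: "laurent a b (p + q) = laurent a b p + laurent a b q" for p q
    by (simp add: laurent_def meval_add[OF unital_hom_cst])
  show mult: "laurent a b (p * q) = laurent a b p * laurent a b q" for p q
    by (simp add: laurent_def meval_mult[OF unital_hom_cst])
  show c: "laurent a b (Const c) = cst c" for c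
    by (simp add: laurent_def meval_Const[OF unital_hom_cst])
  show "laurent a b (p - q) = laurent a b p - laurent a b q" using add[of "p - q" q] by simp
  show "laurent a b (p ^ n) = laurent a b p ^ n"
    by (induction n) (simp_all add: mult c[of 1, unfolded Const_simps])
qed

lemma laurent_Var:
  assumes "a \<noteq> b"
  shows "laurent a b (Var a) = fls_const fls_X" "laurent a b (Var b) = fls_X_inv"
  using assms by (simp_all add: laurent_def meval_Var[OF unital_hom_cst])

lemma laurent_subdegree_nonpos:
  fixes p :: "('n::finite, 'k::field) mpol"
  assumes ab: "a \<noteq> b" and p: "p \<in> polys_in {a, b}" "p \<noteq> 0"
  shows "laurent a b p \<noteq> 0" "fls_subdegree (laurent a b p) \<le> 0"
    and "fls_subdegree (laurent a b p) = 0 \<Longrightarrow> p \<in> polys_in {a}"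
proof -
  have nz: "laurent a b p $$ (- int (lookup m b)) \<noteq> 0" if m: "m \<in> keys p" for m
  proof
    assume "laurent a b p $$ (- int (lookup m b)) = 0"
    hence "lookup p m = 0" using laurent_nth(2)[OF ab p(1), of "lookup m b" "lookup m a"] exponents_two_variables[OF ab p(1) m] by simp
    thus False using m by (simp add: in_keys_iff)
  qed
  obtain m where m: "m \<in> keys p" using p(2) keys_eq_empty by blast
  show "laurent a b p \<noteq> 0" using nz[OF m] by auto
  show "fls_subdegree (laurent a b p) \<le> 0"
    using fls_subdegree_leI[OF nz[OF m]] by linarith
  assume 0: "fls_subdegree (laurent a b p) = 0"
  have "lookup m b = 0" if "m \<in> keys p" for m
    using fls_subdegree_leI[OF nz[OF that]] 0 by linarith
  thus "p \<in> polys_in {a}" using p(1) unfolding polys_in_iff by (metis insertE insertI1 singletonD)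
qed

definition supp_le :: "'a::zero fls \<Rightarrow> int \<Rightarrow> bool" where
  "supp_le f c \<longleftrightarrow> (\<forall>n>c. f $$ n = 0)"

lemma supp_le_mult:
  fixes f g :: "'a::comm_ring_1 fls"
  assumes "supp_le f c" "supp_le g d"
  shows "supp_le (f * g) (c + d)"
  unfolding supp_le_def
proof (intro allI impI)
  fix n assume n: "n > c + d"
  show "(f * g) $$ n = 0"
    unfolding fls_times_nth(2)
  proof (rule sum.neutral, rule ballI)
    fix i
    have "i > c \<or> n - i > d" using n by linarith
    thus "f $$ i * g $$ (n - i) = 0" using assms unfolding supp_le_def by auto
  qed
qed

text \<open>
  The derivative \<open>\<partial>/\<partial>\<tau>\<close> of a polynomial in
  \<open>1/\<tau>\<close> is divisible by \<open>\<tau>\<^sup>-\<^sup>2\<close>, so the Jacobian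
  has no terms of order above \<open>-2\<close>.
\<close>

lemma jac_laurent_subdegree:
  assumes "a \<noteq> b" "p \<in> polys_in {a, b}" "q \<in> polys_in {a, b}" "jac (laurent a b p) (laurent a b q) \<noteq> 0"
  shows "fls_subdegree (jac (laurent a b p) (laurent a b q)) \<le> -2"
proof -
  have s: "supp_le (ds (laurent a b p)) 0" "supp_le (fls_deriv (laurent a b p)) (-2)" if "p \<in> polys_in {a, b}" for p
  proof -
    note z = laurent_nth(1)[OF assms(1) that]
    show "supp_le (ds (laurent a b p)) 0" using z by (simp add: supp_le_def)
    show "supp_le (fls_deriv (laurent a b p)) (-2)" unfolding supp_le_def
    proof (intro allI impI)
      fix n :: int assume "n > -2"
      hence "n = -1 \<or> n + 1 > 0" by linarith
      thus "fls_deriv (laurent a b p) $$ n = 0" using z by auto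
    qed
  qed
  have "supp_le (jac (laurent a b p) (laurent a b q)) (-2)"
    using supp_le_mult[OF s(1)[OF assms(2)] s(2)[OF assms(3)]] supp_le_mult[OF s(2)[OF assms(2)] s(1)[OF assms(3)]]
    by (simp add: supp_le_def jac_def)
  thus ?thesis using nth_fls_subdegree_nonzero[OF assms(4)] unfolding supp_le_def by force
qed

text \<open>
  If the Jacobian of a pair of generators vanished, the derivations \<open>jac X\<close> and
  \<open>jac Y\<close> would vanish on the whole polynomial ring, and so \<open>X\<close> and
  \<open>Y\<close> would be killed by both partial derivatives. Then
  \<open>\<partial>/\<partial>s\<close> would vanish on the ring they generate, which contains
  \<open>s\<close>.
\<close>

lemma jac_laurent_neq_0:
  fixes F :: "('n::finite, 'k::field) mpol \<Rightarrow> ('n, 'k) mpol"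
  assumes ab: "a \<noteq> b" and F: "alg_end F"
    and Pa: "Pa \<in> polys_in {a, b}" "F Pa = Var a" and Pb: "Pb \<in> polys_in {a, b}" "F Pb = Var b"
  shows "jac (laurent a b (F (Var a))) (laurent a b (F (Var b))) \<noteq> 0" (is "jac ?X ?Y \<noteq> 0")
proof
  assume J: "jac ?X ?Y = 0"
  have J': "jac ?Y ?X = 0" using J jac_swap[of ?X ?Y] by simp
  have kill: "D (laurent a b (F P)) = 0" if D: "\<And>x y. D (x * y) = x * D y + D x * y" "\<And>x y. D (x + y) = D x + D y"
      "\<And>c. D (cst c) = 0" and XY: "D ?X = 0" "D ?Y = 0" and P: "P \<in> polys_in {a, b}" for D P
    using P
  proof (induction P rule: polys_in_induct)
    case (Var i)
    thus ?case using XY by auto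
  qed (simp_all add: alg_end_hom[OF F] laurent_hom D(1-3))
  have zero: "ds u = 0 \<and> fls_deriv u = 0" if u: "jac u ?X = 0" "jac u ?Y = 0" for u
  proof -
    have "jac u (laurent a b (F Pa)) = 0" "jac u (laurent a b (F Pb)) = 0"
      using kill[of "jac u", OF jac_mult jac_add jac_cst u] Pa(1) Pb(1) by blast+
    moreover have "ds (fls_const fls_X :: 'k fls fls) = 1" by (rule fls_eqI) (simp)
    moreover have "ds (fls_X_inv :: 'k fls fls) = 0" by (rule fls_eqI) simp
    ultimately show ?thesis by (simp add: Pa Pb laurent_Var[OF ab] jac_def)
  qed
  have "ds ?X = 0" "ds ?Y = 0" using zero[of ?X] zero[of ?Y] J J' by simp_all
  hence "ds (laurent a b (F Pa)) = 0" using kill[of ds, OF ds_mult ds_add ds_cst] Pa(1) by blast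
  hence "ds (fls_const fls_X :: 'k fls fls) = 0" by (simp add: Pa laurent_Var[OF ab])
  hence "ds (fls_const fls_X :: 'k fls fls) $$ 0 = 0" by simp
  thus False by simp
qed

section \<open>The theorem of Jung and van der Kulk over a field\<close>

text \<open>
  Stated through the image of \<open>k[x\<^sub>a, x\<^sub>b]\<close>, because generation is what
  can be checked directly in the applications; injectivity then follows from tameness.
\<close>

definition plane_aut :: "'n \<Rightarrow> 'n \<Rightarrow> (('n::finite, 'k::field) mpol \<Rightarrow> ('n, 'k) mpol) \<Rightarrow> bool" where
  "plane_aut a b F \<longleftrightarrow> alg_end F \<and> (\<forall>i. i \<notin> {a, b} \<longrightarrow> F (Var i) = Var i)
     \<and> F ` polys_in {a, b} = polys_in {a, b}"

lemma plane_autD: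
  assumes "plane_aut a b F"
  shows "alg_end F" "i \<notin> {a, b} \<Longrightarrow> F (Var i) = Var i" "p \<in> polys_in {a, b} \<Longrightarrow> F p \<in> polys_in {a, b}"
    "p \<in> polys_in {a, b} \<Longrightarrow> \<exists>P\<in>polys_in {a, b}. F P = p"
proof -
  show "alg_end F" "i \<notin> {a, b} \<Longrightarrow> F (Var i) = Var i" using assms unfolding plane_aut_def by blast+
  have im: "F ` polys_in {a, b} = polys_in {a, b}" using assms unfolding plane_aut_def by blast
  show "F p \<in> polys_in {a, b}" if "p \<in> polys_in {a, b}" using im imageI[OF that, of F] by simp
  show "\<exists>P\<in>polys_in {a, b}. F P = p" if "p \<in> polys_in {a, b}"
  proof -
    have "p \<in> F ` polys_in {a, b}" using that unfolding im .
    thus ?thesis by (metis imageE)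
  qed
qed

lemma plane_aut_comp:
  assumes "plane_aut a b F" "plane_aut a b G"
  shows "plane_aut a b (F \<circ> G)"
proof -
  have "(F \<circ> G) ` polys_in {a, b} = polys_in {a, b}"
    using assms unfolding plane_aut_def by (simp only: image_comp[symmetric])
  thus ?thesis using assms unfolding plane_aut_def by (simp add: alg_end_comp)
qed

lemma plane_aut_shear:
  fixes q :: "('n::finite, 'k::field) mpol"
  assumes "\<alpha> \<noteq> 0" "l \<in> {a, b}" "q \<in> polys_in ({a, b} - {l})"
  shows "plane_aut a b (shear l \<alpha> q)"
proof -
  have ql: "q \<in> polys_in (- {l})" "q \<in> polys_in {a, b}"
    by (rule polys_in_mono[OF _ assms(3)]; blast)+
  have into: "shear l \<alpha> q p \<in> polys_in {a, b}" if "p \<in> polys_in {a, b}" for p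
  proof (rule alg_end_polys_in[OF alg_end_shear that])
    fix i assume "i \<in> {a, b}"
    thus "shear l \<alpha> q (Var i) \<in> polys_in {a, b}"
      using ql(2) assms(2) by (auto simp: shear_Var intro!: polys_in_add polys_in_mult)
  qed
  have onto: "\<exists>P\<in>polys_in {a, b}. shear l \<alpha> q P = p" if "p \<in> polys_in {a, b}" for p
    using that
  proof (induction p rule: polys_in_induct)
    case (Const c)
    show ?case by (rule bexI[of _ "Const c"]) (simp_all add: alg_end_hom[OF alg_end_shear])
  next
    case (Var i)
    show ?case
    proof (cases "i = l")
      case True
      have "shear l \<alpha> q (Const (1 / \<alpha>) * (Var l - q)) = Const (1 / \<alpha>) * Const \<alpha> * Var l"
        by (simp add: alg_end_hom[OF alg_end_shear] shear_fix[OF ql(1)] shear_Var)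
      also have "Const (1 / \<alpha>) * Const \<alpha> = (1 :: ('n, 'k) mpol)"
        using assms(1) by (simp add: Const_simps(4)[symmetric] Const_simps(2))
      finally show ?thesis using True assms(2) ql
        by (intro bexI[of _ "Const (1 / \<alpha>) * (Var l - q)"]) (auto intro!: polys_in_intros)
    next
      case False
      thus ?thesis using Var by (intro bexI[of _ "Var i"]) (auto simp: shear_Var)
    qed
  next
    case (add p r)
    then obtain P R where "P \<in> polys_in {a, b}" "shear l \<alpha> q P = p" "R \<in> polys_in {a, b}" "shear l \<alpha> q R = r" by blast
    thus ?case by (intro bexI[of _ "P + R"]) (auto simp: alg_end_hom[OF alg_end_shear] intro: polys_in_intros)
  next
    case (mult p r)
    then obtain P R where "P \<in> polys_in {a, b}" "shear l \<alpha> q P = p" "R \<in> polys_in {a, b}" "shear l \<alpha> q R = r" by blast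
    thus ?case by (intro bexI[of _ "P * R"]) (auto simp: alg_end_hom[OF alg_end_shear] intro: polys_in_intros)
  qed
  show ?thesis unfolding plane_aut_def using into onto assms(2) by (auto simp: alg_end_shear shear_Var)
qed

lemma plane_aut_swap: "plane_aut a b (permute (Transposition.transpose a b))"
proof -
  let ?t = "Transposition.transpose a b"
  have into: "permute ?t p \<in> polys_in {a, b}" if "p \<in> polys_in {a, b}" for p :: "('a, 'b) mpol"
    by (rule alg_end_polys_in[OF alg_end_permute that]) auto
  have "permute ?t \<circ> permute ?t = (id :: ('a, 'b) mpol \<Rightarrow> _)"
    by (rule alg_end_ext) (simp_all add: alg_end_comp alg_end_permute alg_end_id)
  hence "permute ?t (permute ?t p) = p" for p :: "('a, 'b) mpol" by (metis comp_apply id_apply)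
  hence "\<exists>P\<in>polys_in {a, b}. permute ?t P = p" if "p \<in> polys_in {a, b}" for p :: "('a, 'b) mpol"
    using into[OF that] by blast
  thus ?thesis unfolding plane_aut_def using into by (auto simp: alg_end_permute transpose_apply_other)
qed

text \<open>
  If the first coordinate is free of \<open>x\<^sub>b\<close>, the pair is triangular:
  \<open>x\<^sub>a\<close> is a polynomial in the first coordinate alone.
\<close>

lemma plane_aut_triangular_in_Tame:
  fixes F :: "('n::{finite, linorder}, 'k::field) mpol \<Rightarrow> ('n, 'k) mpol"
  assumes ab: "a \<noteq> b" and F: "plane_aut a b F" and Fa: "F (Var a) \<in> polys_in {a}"
  shows "F \<in> Tame"
proof -
  note FD = plane_autD[OF F]
  obtain Pa where Pa: "Pa \<in> polys_in {a, b}" "F Pa = Var a" using FD(4)[of "Var a"] by auto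
  obtain Pb where Pb: "Pb \<in> polys_in {a, b}" "F Pb = Var b" using FD(4)[of "Var b"] by auto
  have Fab: "F (Var a) \<in> polys_in (- {b})" by (rule polys_in_mono[OF _ Fa]) (use ab in auto)
  have Fb: "F (Var b) \<notin> polys_in (- {b})"
  proof
    assume "F (Var b) \<in> polys_in (- {b})"
    hence "F Pb \<in> polys_in (- {b})" using Fab by (intro alg_end_polys_in[OF FD(1) Pb(1)]) auto
    thus False by (simp add: Pb)
  qed
  obtain P0 where P0: "P0 \<in> polys_in {a}" "F P0 = Var a"
    using endomorphism_image_free_of_variable[OF FD(1), of b "{a}" b Pa] ab Fab Fb Pa by (auto simp: insert_commute)
  obtain \<alpha> c where c: "\<alpha> \<noteq> 0" "c \<in> polys_in {}" "F (Var a) = Const \<alpha> * Var a + c"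
    using triangular_endomorphism[OF FD(1), of a "{}" "{}" a P0] Fa P0 by auto
  obtain \<beta> q where q: "\<beta> \<noteq> 0" "q \<in> polys_in {a}" "F (Var b) = Const \<beta> * Var b + q"
    using triangular_endomorphism[OF FD(1), of b "{a}" "{a}" b Pb] Fa Pb ab FD(3)[of "Var b"]
    by (auto simp: insert_commute)
  have c': "c \<in> polys_in (- {i})" for i by (rule polys_in_mono[OF _ c(2)]) simp
  have "F = shear b \<beta> q \<circ> shear a \<alpha> c"
  proof (rule alg_end_ext)
    show "F (Var i) = (shear b \<beta> q \<circ> shear a \<alpha> c) (Var i)" for i
      using c q ab FD(2)[of i] shear_fix[OF c'] by (auto simp: shear_Var alg_end_hom[OF alg_end_shear])
  qed (simp_all add: FD(1) alg_end_comp alg_end_shear)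
  moreover have "shear b \<beta> q \<in> Tame" by (rule shear_in_Tame[OF q(1)]) (rule polys_in_mono[OF _ q(2)], use ab in auto)
  ultimately show ?thesis using Tame_comp shear_in_Tame[OF c(1) c'] by metis
qed

text \<open>
  Induction on the sum of the two degrees in \<open>x\<^sub>b\<close>: while both are positive,
  subtracting a multiple of a power of one coordinate from the other lowers the sum by
  \<open>leading_terms_dependent\<close>.
\<close>

theorem plane_aut_in_Tame:
  fixes F :: "('n::{finite, linorder}, 'k::field) mpol \<Rightarrow> ('n, 'k) mpol"
  assumes ab: "a \<noteq> b" and F: "plane_aut a b F"
  shows "F \<in> Tame"
  using F
proof (induction "nat (- fls_subdegree (laurent a b (F (Var a)))) + nat (- fls_subdegree (laurent a b (F (Var b))))"
    arbitrary: F rule: less_induct)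
  case less
  note F = less.prems and FD = plane_autD[OF less.prems]
  define X Y where "X = laurent a b (F (Var a))" and "Y = laurent a b (F (Var b))"
  obtain Pa where Pa: "Pa \<in> polys_in {a, b}" "F Pa = Var a" using FD(4)[of "Var a"] by auto
  obtain Pb where Pb: "Pb \<in> polys_in {a, b}" "F Pb = Var b" using FD(4)[of "Var b"] by auto
  have J: "jac X Y \<noteq> 0" unfolding X_def Y_def by (rule jac_laurent_neq_0[OF ab FD(1) Pa Pb])
  have J2: "fls_subdegree (jac X Y) \<le> -2"
    using J unfolding X_def Y_def by (intro jac_laurent_subdegree[OF ab]) (auto intro: FD(3))
  have R: "F (Var a) \<in> polys_in {a, b}" "F (Var b) \<in> polys_in {a, b}" by (auto intro: FD(3))
  have nz: "F (Var a) \<noteq> 0" "F (Var b) \<noteq> 0"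
  proof -
    have z: "laurent a b 0 = (0 :: 'k fls fls)" by (simp add: laurent_def meval_def)
    have jz: "jac u 0 = 0" "jac 0 u = 0" for u :: "'k fls fls"
      using jac_cst[of u 0] jac_swap[of u 0] by simp_all
    show "F (Var a) \<noteq> 0" "F (Var b) \<noteq> 0" using J z jz unfolding X_def Y_def by metis+
  qed
  consider "fls_subdegree X = 0" | "fls_subdegree Y = 0" | "fls_subdegree X < 0" "fls_subdegree Y < 0"
    using laurent_subdegree_nonpos(2)[OF ab R(1) nz(1)] laurent_subdegree_nonpos(2)[OF ab R(2) nz(2)]
    unfolding X_def Y_def by linarith
  thus ?case
  proof cases
    case 1
    hence "F (Var a) \<in> polys_in {a}" using laurent_subdegree_nonpos(3)[OF ab R(1) nz(1)] by (simp add: X_def)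
    thus ?thesis by (rule plane_aut_triangular_in_Tame[OF ab F])
  next
    case 2
    hence Fb: "F (Var b) \<in> polys_in {a}" using laurent_subdegree_nonpos(3)[OF ab R(2) nz(2)] by (simp add: Y_def)
    let ?t = "permute (Transposition.transpose a b) :: ('n, 'k) mpol \<Rightarrow> ('n, 'k) mpol"
    have "F \<circ> ?t \<in> Tame"
      by (rule plane_aut_triangular_in_Tame[OF ab plane_aut_comp[OF F plane_aut_swap]]) (simp add: Fb)
    thus ?thesis by (rule Tame_cancel_right[OF permute_in_Tame[OF bij_transpose]])
  next
    case 3
    obtain N where N: "\<And>m. m \<in> keys Pa \<Longrightarrow> lookup m a \<le> N \<and> lookup m b \<le> N"
      using exponents_bounded[of "{a, b}" Pa] by auto
    define c where "c i j = lookup Pa (single a i + single b j)" for i j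
    have "laurent a b (F Pa) = bipoly c N X Y"
      using meval_two_variables[OF unital_hom_cst ab Pa(1) N, where \<sigma> = "\<lambda>i. laurent a b (F (Var i))"]
      unfolding bipoly_def c_def X_def Y_def laurent_def alg_end_meval[OF FD(1) unital_hom_cst, of _ Pa] by simp
    hence bi: "bipoly c N X Y = fls_const fls_X" by (simp add: Pa laurent_Var[OF ab])
    have "\<exists>i j. i \<le> N \<and> j \<le> N \<and> i + j > 0 \<and> c i j \<noteq> 0"
    proof (rule ccontr)
      assume *: "\<not> ?thesis"
      have "bipoly c N X Y = (\<Sum>(i, j)\<in>{(0, 0)}. cst (c i j) * X ^ i * Y ^ j)"
        unfolding bipoly_def
      proof (rule sum.mono_neutral_right)
        show "\<forall>p\<in>{..N} \<times> {..N} - {(0, 0)}. (case p of (i, j) \<Rightarrow> cst (c i j) * X ^ i * Y ^ j) = 0"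
        proof (rule ballI)
          fix p assume p: "p \<in> {..N} \<times> {..N} - {(0, 0)}"
          obtain i j where ij: "p = (i, j)" by (cases p)
          have "c i j = 0" using * p unfolding ij by auto
          thus "(case p of (i, j) \<Rightarrow> cst (c i j) * X ^ i * Y ^ j) = 0" by (simp add: ij)
        qed
      qed auto
      hence "cst (c 0 0) = fls_const fls_X" using bi by simp
      hence "cst (c 0 0) $$ 0 $$ 1 = fls_const fls_X $$ 0 $$ 1" by simp
      thus False by simp
    qed
    then obtain i0 j0 where ij: "i0 \<le> N" "j0 \<le> N" "i0 + j0 > 0" "c i0 j0 \<noteq> 0" by blast
    have val: "bipoly c N X Y \<noteq> 0" "fls_subdegree (bipoly c N X Y) \<ge> 0" unfolding bi by auto
    obtain \<beta> n where \<beta>: "\<beta> \<noteq> 0" "n > 0"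
      "fls_subdegree (Y - cst \<beta> * X ^ n) > fls_subdegree Y \<or> fls_subdegree (X - cst \<beta> * Y ^ n) > fls_subdegree X"
      by (rule leading_terms_dependent[OF 3 J J2 ij val])
    have step: ?thesis if l: "{l, l'} = {a, b}" "l \<noteq> l'"
        "fls_subdegree (laurent a b (F (Var l))) < 0"
        "fls_subdegree (laurent a b (F (Var l)) - cst \<beta> * laurent a b (F (Var l')) ^ n) > fls_subdegree (laurent a b (F (Var l)))" for l l'
    proof -
      define E where "E = shear l 1 (- Const \<beta> * Var l' ^ n)"
      have q: "- Const \<beta> * Var l' ^ n \<in> polys_in {l'}" by (auto intro!: polys_in_intros)
      have E: "plane_aut a b E" unfolding E_def
        by (rule plane_aut_shear[OF one_neq_zero _ polys_in_mono[OF _ q]]) (use l in auto)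
      have ET: "E \<in> Tame" unfolding E_def
        by (rule shear_in_Tame[OF one_neq_zero polys_in_mono[OF _ q]]) (use l in auto)
      have El: "(F \<circ> E) (Var l) = F (Var l) - Const \<beta> * F (Var l') ^ n" "(F \<circ> E) (Var l') = F (Var l')"
        using l(2) by (simp_all add: E_def shear_Var alg_end_hom[OF FD(1)] Const_simps)
      have "nat (- fls_subdegree (laurent a b ((F \<circ> E) (Var l)))) + nat (- fls_subdegree (laurent a b ((F \<circ> E) (Var l'))))
        < nat (- fls_subdegree (laurent a b (F (Var l)))) + nat (- fls_subdegree (laurent a b (F (Var l'))))"
        unfolding El laurent_hom using l(3,4) by linarith
      moreover have "l = a \<and> l' = b \<or> l = b \<and> l' = a" using l(1,2) by (auto simp: doubleton_eq_iff)
      ultimately have "F \<circ> E \<in> Tame"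
        using plane_aut_comp[OF F E] by (intro less.hyps) (auto simp: add.commute)
      thus ?thesis by (rule Tame_cancel_right[OF ET])
    qed
    from \<beta>(3) show ?thesis
    proof
      assume "fls_subdegree (Y - cst \<beta> * X ^ n) > fls_subdegree Y"
      thus ?thesis using 3 ab by (intro step[of b a]) (auto simp: X_def Y_def)
    next
      assume "fls_subdegree (X - cst \<beta> * Y ^ n) > fls_subdegree X"
      thus ?thesis using 3 ab by (intro step[of a b]) (auto simp: X_def Y_def)
    qed
  qed
qed

section \<open>Algebraic dependence modulo a polynomial\<close>

text \<open>
  Gaussian elimination of one unknown with the help of one equation.
\<close>

lemma homogeneous_system_solution:
  fixes A :: "'s \<Rightarrow> 'i \<Rightarrow> 'k::field"
  assumes "finite S" "finite I" "card S < card I"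
  shows "\<exists>c. (\<exists>i\<in>I. c i \<noteq> 0) \<and> (\<forall>s\<in>S. (\<Sum>i\<in>I. c i * A s i) = 0)"
  using assms
proof (induction S arbitrary: I A rule: finite_induct)
  case empty
  hence "I \<noteq> {}" by auto
  thus ?case by (intro exI[of _ "\<lambda>_. 1"]) auto
next
  case (insert s S)
  show ?case
  proof (cases "\<exists>i0\<in>I. A s i0 \<noteq> 0")
    case False
    have "card S < card I" using insert by simp
    then obtain c where "\<exists>i\<in>I. c i \<noteq> 0" "\<forall>s\<in>S. (\<Sum>i\<in>I. c i * A s i) = 0"
      using insert.IH[of I A] insert.prems by blast
    thus ?thesis using False by (intro exI[of _ c]) auto
  next
    case True
    then obtain i0 where i0: "i0 \<in> I" "A s i0 \<noteq> 0" by blast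
    define J where "J = I - {i0}"
    define B where "B t i = A t i - A t i0 * A s i / A s i0" for t i
    have J: "finite J" "I = insert i0 J" "i0 \<notin> J" using i0 insert.prems by (auto simp: J_def)
    have "card S < card J" using insert J by simp
    then obtain c where c: "\<exists>i\<in>J. c i \<noteq> 0" "\<forall>t\<in>S. (\<Sum>i\<in>J. c i * B t i) = 0"
      using insert.IH[of J B] J by blast
    define x where "x = - (\<Sum>i\<in>J. c i * A s i) / A s i0"
    define c' where "c' = c(i0 := x)"
    have sum: "(\<Sum>i\<in>I. c' i * A t i) = x * A t i0 + (\<Sum>i\<in>J. c i * A t i)" for t
    proof -
      have "(\<Sum>i\<in>J. c' i * A t i) = (\<Sum>i\<in>J. c i * A t i)"
        using J(3) by (intro sum.cong refl) (auto simp: c'_def)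
      thus ?thesis using J by (simp add: c'_def)
    qed
    have "(\<Sum>i\<in>I. c' i * A t i) = 0" if "t \<in> insert s S" for t
    proof (cases "t = s")
      case True
      thus ?thesis unfolding sum using i0 by (simp add: x_def)
    next
      case False
      have "(\<Sum>i\<in>J. c i * B t i) = (\<Sum>i\<in>J. c i * A t i) - A t i0 / A s i0 * (\<Sum>i\<in>J. c i * A s i)"
        by (simp add: B_def sum_distrib_left sum_subtractf[symmetric] algebra_simps)
      also have "\<dots> = (\<Sum>i\<in>I. c' i * A t i)" unfolding sum by (simp add: x_def)
      finally show ?thesis using c(2) False that by simp
    qed
    moreover have "\<exists>i\<in>I. c' i \<noteq> 0" using c(1) J by (auto simp: c'_def)
    ultimately show ?thesis by blast
  qed
qed

lemma lookup_Const_mult: "lookup (Const c * p) m = c * lookup p m"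
  for p :: "('n, 'k::field) mpol"
proof (induction p rule: mpol_induct)
  case (single m' c')
  show ?case by (simp add: Const_def mult_single lookup_single when_def)
qed (simp add: distrib_left lookup_add)

text \<open>
  A bound for each exponent separately; the polynomials with this bound form a space of known
  finite dimension.
\<close>

definition expo_le :: "nat \<Rightarrow> ('n, 'k::field) mpol \<Rightarrow> bool" where
  "expo_le N p \<longleftrightarrow> (\<forall>m\<in>keys p. \<forall>i. lookup m i \<le> N)"

lemma expo_le_mult: "expo_le A p \<Longrightarrow> expo_le B q \<Longrightarrow> expo_le (A + B) (p * q)"
  unfolding expo_le_def using keys_mult[of p q] by (fastforce simp: lookup_add intro: add_mono)

lemma expo_le_power: "expo_le A p \<Longrightarrow> expo_le (n * A) (p ^ n)"
proof (induction n)
  case 0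
  show ?case by (simp add: expo_le_def)
next
  case (Suc n)
  thus ?case using expo_le_mult[of A p "n * A" "p ^ n"] by simp
qed

lemma expo_le_mono: "expo_le A p \<Longrightarrow> A \<le> B \<Longrightarrow> expo_le B p"
  unfolding expo_le_def by (meson order_trans)

lemma expo_le_exists:
  fixes p :: "('n::finite, 'k::field) mpol"
  shows "\<exists>N. expo_le N p"
  using exponents_bounded[of UNIV p] by (auto simp: expo_le_def)

lemma single_two_variables: "single (single x i + single y j) c = Const c * Var x ^ i * Var y ^ j"
  for c :: "'k::field" and x y :: 'n
  by (simp add: Var_power Const_def mult_single)

lemma two_variable_sum_neq_0:
  fixes c :: "nat \<times> nat \<Rightarrow> 'k::field"
  assumes "x \<noteq> y" "finite S" "z \<in> S" "c z \<noteq> 0"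
  shows "(\<Sum>(i, j)\<in>S. Const (c (i, j)) * Var x ^ i * Var y ^ j) \<noteq> (0 :: ('n, 'k) mpol)"
proof
  define g where "g = (\<lambda>(i, j). single x i + single y j :: 'n \<Rightarrow>\<^sub>0 nat)"
  assume "(\<Sum>(i, j)\<in>S. Const (c (i, j)) * Var x ^ i * Var y ^ j) = (0 :: ('n, 'k) mpol)"
  hence "(\<Sum>p\<in>S. single (g p) (c p)) = 0"
    by (simp add: g_def case_prod_unfold single_two_variables)
  hence "(\<Sum>p\<in>S. lookup (single (g p) (c p)) (g z)) = 0" by (metis lookup_sum lookup_zero)
  moreover have "(\<Sum>p\<in>S. lookup (single (g p) (c p)) (g z)) = (\<Sum>p\<in>S. if p = z then c z else 0)"
    using inj_two_exponents[OF assms(1)] unfolding g_def[symmetric]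
    by (intro sum.cong refl) (auto simp: lookup_single when_def inj_eq)
  ultimately show False using assms by simp
qed

text \<open>
  A dimension count. The products \<open>p\<^sup>i q\<^sup>j\<close> with \<open>i, j < M\<close>
  and the multiples of \<open>g\<close> by monomials with exponents up to \<open>K = 2 D M\<close>
  all lie in the span of the \<open>(K + d + 1)\<^sup>2\<close> monomials with exponents up to
  \<open>K + d\<close>, where \<open>D\<close> bounds the exponents in \<open>p\<close> and
  \<open>q\<close> and \<open>d\<close> those in \<open>g\<close>. There are \<open>M\<^sup>2 + (K
  + 1)\<^sup>2\<close> of them, which is more as soon as \<open>M\<close> is large, because
  \<open>(K + d + 1)\<^sup>2 - (K + 1)\<^sup>2\<close> is linear in \<open>M\<close>. A linear
  relation must involve some \<open>p\<^sup>i q\<^sup>j\<close> because \<open>g\<close> is not a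
  zero divisor.
\<close>

lemma dependent_modulo:
  fixes p q g :: "('n::{finite, linorder}, 'k::field) mpol"
  assumes ab: "a \<noteq> b" and pqg: "p \<in> polys_in {a, b}" "q \<in> polys_in {a, b}" "g \<in> polys_in {a, b}" and g0: "g \<noteq> 0"
  obtains S c z where "finite S" "z \<in> S" "c z \<noteq> (0::'k)" "g dvd (\<Sum>(i, j)\<in>S. Const (c (i, j)) * p ^ i * q ^ j)"
proof -
  obtain D1 D2 d where "expo_le D1 p" "expo_le D2 q" and d: "expo_le d g" using expo_le_exists by metis
  then obtain D where D: "expo_le D p" "expo_le D q" 
    using expo_le_mono[of D1 p "max D1 D2"] expo_le_mono[of D2 q "max D1 D2"] by auto
  \<comment> \<open>\<open>M * M\<close> has to exceed \<open>(K + d + 1)\<^sup>2 - (K + 1)\<^sup>2 = 2 * d * K + 2 * d + d * d\<close>, where \<open>K = 2 * D * M\<close>\<close>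
  define M where "M = 4 * d * D + 2 * d + d * d + 1"
  define K where "K = 2 * D * M"
  define N where "N = K + d"
  define S T U where "S = {..<M} \<times> {..<M}" and "T = {..K} \<times> {..K}" and "U = {..N} \<times> {..N}"
  define mon where "mon = (\<lambda>(i, j). single a i + single b j :: 'n \<Rightarrow>\<^sub>0 nat)"
  define v where "v = case_sum (\<lambda>(i, j). p ^ i * q ^ j) (\<lambda>x. g * single (mon x) 1)"
  have fin: "finite S" "finite T" "finite U" by (auto simp: S_def T_def U_def)
  have "(N + 1) * (N + 1) < M * M + (K + 1) * (K + 1)"
  proof -
    have "(N + 1) * (N + 1) = (K + 1) * (K + 1) + (2 * d * K + 2 * d + d * d)" by (simp add: N_def algebra_simps)
    moreover have "M * M = 2 * d * K + M * (2 * d + d * d + 1)" by (subst (2) M_def) (simp add: K_def algebra_simps)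
    moreover have "M * (2 * d + d * d + 1) \<ge> 2 * d + d * d + 1"
      using mult_le_mono1[of 1 M "2 * d + d * d + 1"] by (simp add: M_def)
    moreover have "n < m + k" if "n = k + (x + y)" "m = x + z" "y + 1 \<le> z" for n m k x y z :: nat
      using that by linarith
    ultimately show ?thesis by (metis add.assoc)
  qed
  hence "card (mon ` U) < card (S <+> T)"
    using card_image_le[OF fin(3), of mon] fin by (simp add: card_Plus) (simp add: S_def T_def U_def)
  then obtain c where c: "\<exists>x\<in>S <+> T. c x \<noteq> 0" "\<And>m. m \<in> mon ` U \<Longrightarrow> (\<Sum>x\<in>S <+> T. c x * lookup (v x) m) = 0"
    using homogeneous_system_solution[of "mon ` U" "S <+> T" "\<lambda>m x. lookup (v x) m"] fin by auto
  have mem: "m \<in> mon ` U" if "f \<in> polys_in {a, b}" "expo_le N f" "m \<in> keys f" for m and f :: "('n, 'k) mpol"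
  proof -
    have "m = mon (lookup m a, lookup m b)"
      using exponents_two_variables[OF ab that(1,3)] by (simp add: mon_def)
    moreover have "(lookup m a, lookup m b) \<in> U" using that(2,3) by (auto simp: U_def expo_le_def)
    ultimately show ?thesis by blast
  qed
  have vbox: "v x \<in> polys_in {a, b} \<and> expo_le N (v x)" if "x \<in> S <+> T" for x
  proof (cases x)
    case (Inl y)
    obtain i j where y: "y = (i, j)" by (cases y)
    have ij: "i < M" "j < M" using that by (auto simp: Inl y S_def)
    have "expo_le (i * D + j * D) (p ^ i * q ^ j)" by (intro expo_le_mult expo_le_power D)
    moreover have "i * D + j * D \<le> N"
    proof -
      have "i * D \<le> M * D" "j * D \<le> M * D" using ij by simp_all
      moreover have "N = M * D + M * D + d" by (simp add: N_def K_def)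
      ultimately show ?thesis by linarith
    qed
    ultimately show ?thesis using pqg by (auto simp: v_def Inl y intro!: polys_in_intros intro: expo_le_mono)
  next
    case (Inr y)
    obtain i j where y: "y = (i, j)" by (cases y)
    have ij: "i \<le> K" "j \<le> K" using that by (auto simp: Inr y T_def)
    have "expo_le K (single (mon y) (1::'k))" using ij ab
      by (auto simp: expo_le_def y mon_def lookup_add lookup_single when_def)
    hence "expo_le (d + K) (g * single (mon y) 1)" by (intro expo_le_mult d)
    moreover have "single (mon y) (1::'k) \<in> polys_in {a, b}"
      by (auto simp: polys_in_iff y mon_def lookup_add lookup_single when_def)
    ultimately show ?thesis using pqg by (auto simp: v_def Inr N_def add.commute intro!: polys_in_mult)
  qed
  have zero: "(\<Sum>x\<in>S <+> T. Const (c x) * v x) = 0"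
  proof (rule poly_mapping_eqI)
    fix m
    have "(\<Sum>x\<in>S <+> T. c x * lookup (v x) m) = 0"
    proof (cases "m \<in> mon ` U")
      case False
      have "lookup (v x) m = 0" if "x \<in> S <+> T" for x
        using mem[of "v x" m] vbox[OF that] False by (auto simp: in_keys_iff)
      thus ?thesis by simp
    qed (rule c(2))
    thus "lookup (\<Sum>x\<in>S <+> T. Const (c x) * v x) m = lookup 0 m"
      by (simp add: lookup_sum lookup_Const_mult)
  qed
  define h where "h = (\<Sum>x\<in>T. Const (c (Inr x)) * single (mon x) 1)"
  define P where "P = (\<Sum>(i, j)\<in>S. Const (c (Inl (i, j))) * p ^ i * q ^ j)"
  have "(\<Sum>x\<in>S <+> T. Const (c x) * v x) = P + g * h"
    using fin by (simp add: sum.Plus P_def h_def v_def sum_distrib_left case_prod_unfold mult_ac)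
  hence eq: "P = g * - h" using zero by (simp add: eq_neg_iff_add_eq_0)
  have "\<exists>z\<in>S. c (Inl z) \<noteq> 0"
  proof (rule ccontr)
    assume *: "\<not> ?thesis"
    hence "P = 0" unfolding P_def by (intro sum.neutral) (auto simp: Const_simps)
    hence "h = 0" using eq g0 by simp
    obtain z where z: "z \<in> T" "c (Inr z) \<noteq> 0" using c(1) * by auto
    have "h = (\<Sum>(i, j)\<in>T. Const (c (Inr (i, j))) * Var a ^ i * Var b ^ j)"
      by (simp add: h_def mon_def case_prod_unfold single_two_variables Const_simps mult.assoc)
    thus False using two_variable_sum_neq_0[OF ab fin(2) z(1), of "\<lambda>x. c (Inr x)"] z(2) \<open>h = 0\<close> by simp
  qed
  then obtain z where "z \<in> S" "c (Inl z) \<noteq> 0" by blast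
  moreover have "g dvd (\<Sum>(i, j)\<in>S. Const (c (Inl (i, j))) * p ^ i * q ^ j)"
    using eq unfolding P_def by (metis dvd_triv_left)
  ultimately show thesis using that[of S z "\<lambda>x. c (Inl x)"] fin(1) by blast
qed

text \<open>
  The last property relates degrees in \<open>g\<^sub>1\<close> to degrees in \<open>f\<close>: no
  cancellation takes place between \<open>g\<^sub>1 x\<close> and \<open>g\<^sub>0\<close>.
\<close>

lemma linear_in_variable:
  fixes f :: "('n::finite, 'k::field) mpol"
  assumes "\<And>m. m \<in> keys f \<Longrightarrow> lookup m x \<le> 1"
  obtains g0 g1 where "g0 \<in> polys_in (- {x})" "g1 \<in> polys_in (- {x})" "f = g1 * Var x + g0"
    "\<And>m. m \<in> keys g1 \<Longrightarrow> m + single x 1 \<in> keys f"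
proof -
  define g0 where "g0 = (\<Sum>m\<in>{m\<in>keys f. lookup m x = 0}. single m (lookup f m))"
  define g1 where "g1 = (\<Sum>m\<in>{m\<in>keys f. lookup m x = 1}. single (m - single x 1) (lookup f m))"
  have unshift: "m - single x 1 + single x 1 = m" if "lookup m x = 1" for m :: "'n \<Rightarrow>\<^sub>0 nat"
    by (rule poly_mapping_eqI) (use that in \<open>auto simp: lookup_add lookup_minus lookup_single when_def\<close>)
  have k1: "\<exists>m'\<in>keys f. lookup m' x = 1 \<and> m = m' - single x 1" if m: "m \<in> keys g1" for m
  proof -
    obtain m' where "m' \<in> {m\<in>keys f. lookup m x = 1}" "m \<in> keys (single (m' - single x 1) (lookup f m'))"
      using subsetD[OF keys_sum m[unfolded g1_def]] by blast
    thus ?thesis by (auto split: if_splits)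
  qed
  have "g0 \<in> polys_in (- {x})" unfolding g0_def
    by (rule polys_in_sum) (auto simp: polys_in_iff)
  moreover have "g1 \<in> polys_in (- {x})" unfolding g1_def
    by (rule polys_in_sum) (auto simp: polys_in_iff lookup_minus)
  moreover have "f = g1 * Var x + g0"
  proof -
    have "g1 * Var x = (\<Sum>m\<in>{m\<in>keys f. lookup m x = 1}. single m (lookup f m))"
      unfolding g1_def sum_distrib_right Var_def
      by (intro sum.cong refl) (use unshift in \<open>simp add: mult_single\<close>)
    moreover have "keys f = {m\<in>keys f. lookup m x = 1} \<union> {m\<in>keys f. lookup m x = 0}"
    proof -
      have "m \<in> {m\<in>keys f. lookup m x = 1} \<union> {m\<in>keys f. lookup m x = 0}" if "m \<in> keys f" for m
      proof -
        have "lookup m x = 1 \<or> lookup m x = 0" using assms[OF that] by linarith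
        thus ?thesis using that by simp
      qed
      thus ?thesis by blast
    qed
    moreover have "(\<Sum>m\<in>{m\<in>keys f. lookup m x = 1} \<union> {m\<in>keys f. lookup m x = 0}. single m (lookup f m))
        = (\<Sum>m\<in>{m\<in>keys f. lookup m x = 1}. single m (lookup f m)) + g0"
      unfolding g0_def by (rule sum.union_disjoint) auto
    ultimately show ?thesis using mpol_sum_singles[of f] by simp
  qed
  moreover have "m + single x 1 \<in> keys f" if "m \<in> keys g1" for m
    using k1[OF that] unshift by auto
  ultimately show thesis by (rule that)
qed

section \<open>Automorphisms in three variables\<close>

lemma mdeg_ge_exponent:
  assumes "\<And>i. w i \<ge> (0::'g::linordered_ab_group_add)" "k \<le> lookup m x"
  shows "(\<Sum>j<k. w x) \<le> mdeg w m"
proof -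
  have "(\<Sum>j<k. w x) \<le> (\<Sum>j<lookup m x. w x)"
    using assms by (intro sum_mono2) auto
  also have "\<dots> = (\<Sum>i\<in>{x}. \<Sum>j<lookup m i. w i)" by simp
  also have "\<dots> \<le> mdeg w m"
    unfolding mdeg_def by (rule sum_mono2) (auto intro: sum_nonneg assms(1))
  finally show ?thesis .
qed

lemma UNIV_3_distinct:
  fixes a b m :: 3
  assumes "a \<noteq> b" "a \<noteq> m" "b \<noteq> m"
  shows "UNIV = {a, b, m}"
proof -
  have "card {a, b, m} = card (UNIV :: 3 set)" using assms by simp
  thus ?thesis using card_subset_eq[of "UNIV :: 3 set" "{a, b, m}"] by auto
qed

lemma Compl_3:
  fixes a b m :: 3
  assumes "a \<noteq> b" "a \<noteq> m" "b \<noteq> m"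
  shows "- {m} = {a, b}" "UNIV = insert m {a, b}"
  using UNIV_3_distinct[OF assms] assms by auto

text \<open>
  After a permutation the automorphism fixes \<open>x\<^sub>a\<close> and
  \<open>x\<^sub>b\<close>; over \<open>k[x\<^sub>a, x\<^sub>b]\<close> it is then an automorphism
  in one variable, which is affine with a unit of the polynomial ring as leading coefficient.
\<close>

lemma fixing_two_variables_in_Tame:
  fixes F :: "(3, 'k::field) mpol \<Rightarrow> (3, 'k) mpol"
  assumes F: "alg_aut F" and i: "i1 \<noteq> i2" "i1 \<noteq> i3" "i2 \<noteq> i3"
    and ab: "a \<noteq> b" "a \<noteq> m" "b \<noteq> m" and F12: "F (Var i1) = Var a" "F (Var i2) = Var b"
  shows "F \<in> Tame"
proof -
  define f where "f = (\<lambda>i. if i = a then i1 else if i = b then i2 else i3)"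
  have "inj f"
  proof (rule injI)
    fix x y
    have "x \<in> {a, b, m}" "y \<in> {a, b, m}" using UNIV_3_distinct[OF ab] by auto
    moreover assume "f x = f y"
    ultimately show "x = y" using i ab by (auto simp: f_def)
  qed
  hence "bij f" by (simp add: bij_def finite_UNIV_inj_surj)
  hence T: "permute f \<in> (Tame :: ((3, 'k) mpol \<Rightarrow> _) set)" by (rule permute_in_Tame)
  define G where "G = F \<circ> permute f"
  have "alg_end G" "bij G"
    using F Tame_carrier[OF T] unfolding alg_aut_iff G_def by (simp_all add: alg_end_comp bij_comp)
  hence G: "alg_end G" "surj G" by (simp_all add: bij_is_surj)
  have GV: "G (Var a) = Var a" "G (Var b) = Var b" using F12 ab by (simp_all add: G_def f_def)
  note C = Compl_3[OF ab]
  obtain P where P: "G P = Var m" using G(2) by (metis surjD)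
  obtain \<alpha> q where q: "\<alpha> \<noteq> 0" "q \<in> polys_in {a, b}" "G (Var m) = Const \<alpha> * Var m + q"
  proof (rule triangular_endomorphism[OF G(1), of m "{a, b}" "{a, b}" m P])
    show "i \<in> {a, b} \<Longrightarrow> G (Var i) \<in> polys_in {a, b}" for i using GV by auto
    show "G (Var m) \<in> polys_in (insert m {a, b})" "P \<in> polys_in (insert m {a, b})"
      unfolding C(2)[symmetric] by simp_all
  qed (use ab P in auto)
  have "G = shear m \<alpha> q"
  proof (rule alg_end_ext[OF G(1) alg_end_shear])
    fix i :: 3
    have "i \<in> {a, b, m}" using UNIV_3_distinct[OF ab] by auto
    thus "G (Var i) = shear m \<alpha> q (Var i)" using GV q ab by (auto simp: shear_Var)
  qed
  hence "G \<in> Tame" using shear_in_Tame[OF q(1), of q m] q(2) by (simp add: C)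
  thus ?thesis unfolding G_def by (rule Tame_cancel_right[OF T])
qed

text \<open>
  The coordinate \<open>F(x\<^sub>i\<^sub>1) \<in> k[x\<^sub>a, x\<^sub>b]\<close> is completed to
  a generating pair of \<open>k[x\<^sub>a, x\<^sub>b]\<close>: by
  \<open>F(x\<^sub>i\<^sub>2)\<close> if that is free of \<open>x\<^sub>m\<close>, and otherwise,
  once \<open>F(x\<^sub>i\<^sub>2)\<close> has been moved to \<open>x\<^sub>m\<close>, by the
  third coordinate at \<open>x\<^sub>m = 0\<close>. The inverse of the corresponding tame plane
  automorphism straightens two coordinates to variables.
\<close>

lemma coordinate_pair_in_Tame:
  fixes F :: "(3, 'k::field) mpol \<Rightarrow> (3, 'k) mpol"
  assumes F: "alg_aut F" and i: "i1 \<noteq> i2" "i1 \<noteq> i3" "i2 \<noteq> i3"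
    and ab: "a \<noteq> b" "a \<noteq> m" "b \<noteq> m"
    and f1: "F (Var i1) \<in> polys_in {a, b}" and f2: "F (Var i2) = Const c * Var m + q" "q \<in> polys_in {a, b}"
  shows "F \<in> Tame"
proof -
  note C = Compl_3[OF ab] and Ci = Compl_3[OF i]
  have Fe: "alg_end F" and Fs: "surj F" using F by (auto simp: alg_aut_iff bij_is_surj)
  define T where "T u v = subst (\<lambda>i. if i = a then u else if i = b then v else Var i)" for u v :: "(3, 'k) mpol"
  have TV: "T u v (Var a) = u" "T u v (Var b) = v" "T u v (Var m) = Var m" for u v
    using ab by (simp_all add: T_def)
  have Te: "alg_end (T u v)" for u v by (simp add: T_def alg_end_subst)
  have plane: "T u v \<in> Tame" if uv: "u \<in> polys_in {a, b}" "v \<in> polys_in {a, b}"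
    and onto: "\<And>p. p \<in> polys_in {a, b} \<Longrightarrow> \<exists>P\<in>polys_in {a, b}. T u v P = p" for u v
  proof (rule plane_aut_in_Tame[OF ab(1)])
    have "T u v p \<in> polys_in {a, b}" if "p \<in> polys_in {a, b}" for p
      by (rule alg_end_polys_in[OF Te that]) (use uv TV in auto)
    thus "plane_aut a b (T u v)"
      unfolding plane_aut_def using onto Te by (auto simp: T_def) 
  qed
  show ?thesis
  proof (cases "c = 0")
    case True
    define u v where "u = F (Var i1)" and "v = F (Var i2)"
    have uv: "u \<in> polys_in {a, b}" "v \<in> polys_in {a, b}" using f1 f2 True by (auto simp: u_def v_def Const_simps)
    have F3: "F (Var i3) \<notin> polys_in (- {m})"
    proof
      assume *: "F (Var i3) \<in> polys_in (- {m})"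
      obtain P where P: "F P = Var m" using Fs by (metis surjD)
      have "F P \<in> polys_in (- {m})"
      proof (rule alg_end_polys_in[OF Fe polys_in_UNIV])
        fix i :: 3
        have "i \<in> {i1, i2, i3}" using UNIV_3_distinct[OF i] by auto
        thus "F (Var i) \<in> polys_in (- {m})" using uv * by (auto simp: u_def v_def C(1))
      qed
      thus False by (simp add: P)
    qed
    have onto: "\<exists>P\<in>polys_in {a, b}. T u v P = p" if p: "p \<in> polys_in {a, b}" for p
    proof -
      obtain P where P: "F P = p" using Fs by (metis surjD)
      have Pin: "P \<in> polys_in (insert i3 {i1, i2})" by (simp only: Ci(2)[symmetric] polys_in_UNIV)
      obtain P0 where P0: "P0 \<in> polys_in {i1, i2}" "F P0 = p"
      proof (rule endomorphism_image_free_of_variable[OF Fe _ _ F3 Pin])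
        show "i3 \<notin> {i1, i2}" using i by auto
        show "i \<in> {i1, i2} \<Longrightarrow> F (Var i) \<in> polys_in (- {m})" for i
          using uv by (auto simp: u_def v_def C(1))
        show "F P \<in> polys_in (- {m})" using p P by (simp add: C(1))
      qed (use that P in auto)
      define g where "g i = (if i = i1 then a else b)" for i
      have "(T u v \<circ> permute g) P0 = F P0"
        by (rule alg_end_cong[OF alg_end_comp[OF Te alg_end_permute] Fe P0(1)])
           (use i in \<open>auto simp: g_def TV u_def v_def\<close>)
      moreover have "permute g P0 \<in> polys_in {a, b}"
        by (rule alg_end_polys_in[OF alg_end_permute P0(1)]) (auto simp: g_def)
      ultimately show ?thesis using P0(2) by auto
    qed
    obtain T' where T': "T' \<in> Tame" "T' \<circ> T u v = id" using Tame_inverse[OF plane[OF uv onto]] by blast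
    have inv: "T' (T u v p) = p" for p using T'(2) by (metis comp_apply id_apply)
    have "T' \<circ> F \<in> Tame"
    proof (rule fixing_two_variables_in_Tame[OF _ i ab])
      show "alg_aut (T' \<circ> F)" using F Tame_carrier[OF T'(1)] by (auto simp: alg_aut_iff bij_comp alg_end_comp)
      show "(T' \<circ> F) (Var i1) = Var a" "(T' \<circ> F) (Var i2) = Var b"
        using inv[of "Var a"] inv[of "Var b"] by (simp_all add: TV u_def v_def)
    qed
    thus ?thesis by (rule Tame_cancel_left[OF T'(1)])
  next
    case False
    define E where "E = shear m (1 / c) (- Const (1 / c) * q)"
    have cc: "Const c * Const (1 / c) = (1 :: (3, 'k) mpol)"
      using False by (simp add: Const_simps(4)[symmetric] Const_simps(2))
    have ET: "E \<in> Tame" unfolding E_def using False f2(2)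
      by (intro shear_in_Tame) (auto simp: C(1) intro!: polys_in_intros)
    have Efix: "E p = p" if "p \<in> polys_in {a, b}" for p
      unfolding E_def using that by (intro shear_fix) (simp add: C(1))
    define F1 where "F1 = E \<circ> F"
    have F1: "alg_aut F1" using F Tame_carrier[OF ET] by (auto simp: F1_def alg_aut_iff bij_comp alg_end_comp)
    have F1e: "alg_end F1" and F1s: "surj F1" using F1 by (auto simp: alg_aut_iff bij_is_surj)
    have Ee: "alg_end E" by (simp add: E_def alg_end_shear)
    have F1V: "F1 (Var i1) = F (Var i1)" "F1 (Var i2) = Var m"
    proof -
      show "F1 (Var i1) = F (Var i1)" by (simp add: F1_def Efix[OF f1])
      have "E (Var m) = Const (1 / c) * Var m - Const (1 / c) * q" by (simp add: E_def shear_Var)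
      hence "F1 (Var i2) = Const c * (Const (1 / c) * Var m - Const (1 / c) * q) + q"
        by (simp add: F1_def f2(1) alg_end_hom[OF Ee] Efix[OF f2(2)])
      also have "\<dots> = (Const c * Const (1 / c)) * Var m - (Const c * Const (1 / c)) * q + q"
        by (simp add: algebra_simps)
      finally show "F1 (Var i2) = Var m" unfolding cc by simp
    qed
    \<comment> \<open>restriction to \<open>x\<^sub>m = 0\<close>\<close>
    define K where "K = subst (\<lambda>i. if i = m then 0 else Var i :: (3, 'k) mpol)"
    have Ke: "alg_end K" by (simp add: K_def alg_end_subst)
    have Kin: "K p \<in> polys_in {a, b}" for p
    proof (rule alg_end_polys_in[OF Ke polys_in_UNIV])
      show "K (Var i) \<in> polys_in {a, b}" for i using C(1) by (auto simp: K_def)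
    qed
    have Kfix: "K p = p" if "p \<in> polys_in {a, b}" for p
    proof -
      have "K (Var j) = id (Var j)" if "j \<in> {a, b}" for j using ab that by (auto simp: K_def)
      thus ?thesis using alg_end_cong[OF Ke alg_end_id that] by simp
    qed
    define u v where "u = F (Var i1)" and "v = K (F1 (Var i3))"
    have uv: "u \<in> polys_in {a, b}" "v \<in> polys_in {a, b}" using f1 Kin by (auto simp: u_def v_def)
    define S where "S = subst (\<lambda>i. if i = i1 then Var a else if i = i2 then 0 else Var b :: (3, 'k) mpol)"
    have Se: "alg_end S" by (simp add: S_def alg_end_subst)
    have KS: "K \<circ> F1 = T u v \<circ> S"
    proof (rule alg_end_ext[OF alg_end_comp[OF Ke F1e] alg_end_comp[OF Te Se]])
      fix j :: 3
      have "j \<in> {i1, i2, i3}" using UNIV_3_distinct[OF i] by auto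
      moreover have "K (Var m) = 0" by (simp add: K_def)
      ultimately show "(K \<circ> F1) (Var j) = (T u v \<circ> S) (Var j)"
        using i by (auto simp: F1V S_def TV alg_end_hom[OF Te] Kfix[OF f1] u_def v_def)
    qed
    have onto: "\<exists>P\<in>polys_in {a, b}. T u v P = p" if p: "p \<in> polys_in {a, b}" for p
    proof -
      obtain P where P: "F1 P = p" using F1s by (metis surjD)
      have "T u v (S P) = p" using fun_cong[OF KS, of P] P Kfix[OF p] by simp
      moreover have "S P \<in> polys_in {a, b}"
        by (rule alg_end_polys_in[OF Se polys_in_UNIV]) (auto simp: S_def)
      ultimately show ?thesis by blast
    qed
    obtain T' where T': "T' \<in> Tame" "T' \<circ> T u v = id" using Tame_inverse[OF plane[OF uv onto]] by blast
    have inv: "T' (T u v p) = p" for p using T'(2) by (metis comp_apply id_apply)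
    have "T' \<circ> F1 \<in> Tame"
    proof (rule fixing_two_variables_in_Tame[OF _ i, where a = a and b = m and m = b])
      show "alg_aut (T' \<circ> F1)" using F1 Tame_carrier[OF T'(1)] by (auto simp: alg_aut_iff bij_comp alg_end_comp)
      show "(T' \<circ> F1) (Var i1) = Var a" "(T' \<circ> F1) (Var i2) = Var m"
        using inv[of "Var a"] inv[of "Var m"] by (simp_all add: TV F1V u_def)
    qed (use ab in auto)
    hence "F1 \<in> Tame" by (rule Tame_cancel_left[OF T'(1)])
    thus ?thesis unfolding F1_def by (rule Tame_cancel_left[OF ET])
  qed
qed

lemma power_diff_dvd: "x - y dvd x ^ n - y ^ n" for x y :: "'a::comm_ring_1"
  unfolding power_diff_sumr2 by (rule dvd_triv_left)

text \<open>
  The polynomials \<open>F(x\<^sub>i\<^sub>1)\<close> and \<open>g\<^sub>0\<close> are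
  algebraically dependent modulo \<open>g\<^sub>1\<close>, and \<open>g\<^sub>0\<close> is
  congruent to \<open>F(x\<^sub>i\<^sub>2)\<close> modulo \<open>g\<^sub>1\<close>. So the
  preimage of \<open>g\<^sub>1\<close> divides a nonzero polynomial in
  \<open>x\<^sub>i\<^sub>1\<close>, \<open>x\<^sub>i\<^sub>2\<close> and involves no other
  variable; since \<open>g\<^sub>1\<close> is free of \<open>x\<^sub>m\<close> while
  \<open>F(x\<^sub>i\<^sub>2)\<close> is not, it does not involve \<open>x\<^sub>i\<^sub>2\<close>
  either.
\<close>

lemma coefficient_in_coordinate_subring:
  fixes F :: "(3, 'k::field) mpol \<Rightarrow> (3, 'k) mpol"
  assumes F: "alg_aut F" and i: "i1 \<noteq> i2" and ab: "a \<noteq> b" "a \<noteq> m" "b \<noteq> m"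
    and f1: "F (Var i1) \<in> polys_in {a, b}"
    and f2: "F (Var i2) = g1 * Var m + g0" "g0 \<in> polys_in {a, b}" "g1 \<in> polys_in {a, b}" "g1 \<noteq> 0"
  obtains Q where "Q \<in> polys_in {i1}" "F Q = g1"
proof -
  note C = Compl_3[OF ab]
  have Fe: "alg_end F" and Fs: "surj F" and Fi: "inj F" using F by (auto simp: alg_aut_iff bij_is_surj bij_is_inj)
  obtain S c z where S: "finite S" "z \<in> S" "c z \<noteq> (0::'k)"
    and dvd: "g1 dvd (\<Sum>(i, j)\<in>S. Const (c (i, j)) * F (Var i1) ^ i * g0 ^ j)"
    by (rule dependent_modulo[OF ab(1) f1 f2(2,3,4)])
  define P where "P = (\<Sum>(i, j)\<in>S. Const (c (i, j)) * Var i1 ^ i * Var i2 ^ j :: (3, 'k) mpol)"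
  have P0: "P \<noteq> 0" unfolding P_def using two_variable_sum_neq_0[of i1 i2 S z c, OF i S] .
  have Pin: "P \<in> polys_in {i1, i2}" unfolding P_def
    by (rule polys_in_sum) (auto intro!: polys_in_intros)
  have "g1 dvd F P"
  proof -
    have "g1 dvd F (Var i2) ^ j - g0 ^ j" for j
    proof -
      have "g1 dvd F (Var i2) - g0" by (simp add: f2(1))
      thus ?thesis using power_diff_dvd[of "F (Var i2)" g0 j] by (rule dvd_trans)
    qed
    hence "g1 dvd (\<Sum>(i, j)\<in>S. Const (c (i, j)) * F (Var i1) ^ i * (F (Var i2) ^ j - g0 ^ j))"
      by (intro dvd_sum) (simp add: case_prod_unfold dvd_mult)
    also have "\<dots> = F P - (\<Sum>(i, j)\<in>S. Const (c (i, j)) * F (Var i1) ^ i * g0 ^ j)"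
      by (simp add: P_def alg_end_hom[OF Fe] case_prod_unfold right_diff_distrib sum_subtractf)
    finally show ?thesis using dvd_add[OF _ dvd, of "F P - (\<Sum>(i, j)\<in>S. Const (c (i, j)) * F (Var i1) ^ i * g0 ^ j)"]
      by simp
  qed
  then obtain h where h: "F P = g1 * h" by (auto simp: dvd_def)
  obtain G H where GH: "F G = g1" "F H = h" using Fs by (metis surjD)
  have "F P = F (G * H)" by (simp add: h GH alg_end_hom[OF Fe])
  hence PGH: "P = G * H" using Fi by (simp add: inj_eq)
  have Gin: "G \<in> polys_in (insert i2 {i1})"
  proof -
    have "G \<noteq> 0" "H \<noteq> 0" using P0 PGH by auto
    hence "G \<in> polys_in {i1, i2}" using polys_in_factor[of G H "{i1, i2}"] Pin PGH by simp
    thus ?thesis by (simp only: insert_commute[of i2 i1])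
  qed
  have f2m: "F (Var i2) \<notin> polys_in (- {m})"
  proof
    assume "F (Var i2) \<in> polys_in (- {m})"
    hence "Var m * g1 \<in> polys_in {a, b}"
      using polys_in_diff[of "F (Var i2)" "{a, b}" g0] f2 by (simp add: C(1) mult.commute)
    hence "Var m \<in> (polys_in {a, b} :: (3, 'k) mpol set)" by (rule polys_in_factor[OF _ Var_neq_0 f2(4)])
    thus False using ab by simp
  qed
  obtain Q where "Q \<in> polys_in {i1}" "F Q = F G"
  proof (rule endomorphism_image_free_of_variable[OF Fe _ _ f2m Gin])
    show "i2 \<notin> {i1}" using i by simp
    show "j \<in> {i1} \<Longrightarrow> F (Var j) \<in> polys_in (- {m})" for j using f1 by (simp add: C(1))
    show "F G \<in> polys_in (- {m})" using f2(3) by (simp add: GH C(1))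
  qed
  thus thesis using that[of Q] GH(1) by simp
qed

theorem theorem1p7:
  fixes F :: "(3, 'k::field) mpol \<Rightarrow> (3, 'k) mpol"
    and w :: "3 \<Rightarrow> 'g::linordered_ab_group_add"
  assumes "F \<in> carrier Aut"
    and "\<forall>i. w i > 0"
    and "(wdeg w (F (Var 1)) \<le> Max {w 1, w 2, w 3} \<and> wdeg w (F (Var 2)) \<le> Max {w 1, w 2, w 3})
       \<or> (wdeg w (F (Var 2)) - Max {w 1, w 2, w 3} < wdeg w (F (Var 1))
          \<and> wdeg w (F (Var 1)) < Max {w 1, w 2, w 3})"
  shows "F \<in> Tame"
proof -
  have F: "alg_aut F" using assms(1) by (simp add: Aut_def)
  have Fe: "alg_end F" and Fi: "inj F" using F by (auto simp: alg_aut_iff bij_is_inj)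
  have w: "w i > 0" "w i \<ge> 0" for i using assms(2) by (auto simp: less_imp_le)
  have i123: "(1::3) \<noteq> 2" "(1::3) \<noteq> 3" "(2::3) \<noteq> 3" by simp_all
  have "Max {w 1, w 2, w 3} \<in> {w 1, w 2, w 3}" by (rule Max_in) auto
  then obtain m where m: "Max {w 1, w 2, w 3} = w m" by auto
  obtain a b where ab: "a \<noteq> b" "a \<noteq> m" "b \<noteq> m"
  proof -
    have "m \<in> {1, 2, 3}" using UNIV_3_distinct[OF i123] by auto
    thus thesis using that[of 1 2] that[of 1 3] that[of 2 3] i123 by auto
  qed
  note C = Compl_3[OF ab]
  have nz: "F (Var i) \<noteq> 0" for i using Fi alg_end_hom(4)[OF Fe] Var_neq_0 by (metis inj_eq)
  have two: "w m + w m \<le> mdeg w \<mu>" if "lookup \<mu> m \<ge> 2" for \<mu>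
    using mdeg_ge_exponent[of w 2 \<mu> m] w that by (simp add: numeral_2_eq_2)
  show ?thesis
  proof (cases "wdeg w (F (Var 1)) \<le> w m \<and> wdeg w (F (Var 2)) \<le> w m")
    case True
    have lin: "\<exists>c q. q \<in> polys_in {a, b} \<and> F (Var i) = Const c * Var m + q" if i: "i = 1 \<or> i = 2" for i
    proof -
      have le: "mdeg w \<mu> \<le> w m" if "\<mu> \<in> keys (F (Var i))" for \<mu>
        using mdeg_le_wdeg[OF that, of w] True i by auto
      have "lookup \<mu> m \<le> 1" if "\<mu> \<in> keys (F (Var i))" for \<mu>
      proof (rule ccontr)
        assume "\<not> lookup \<mu> m \<le> 1"
        hence "w m + w m \<le> w m" using order_trans[OF two[of \<mu>] le[OF that]] by simp
        thus False using w(1)[of m] by simp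
      qed
      then obtain g0 g1 where g: "g0 \<in> polys_in (- {m})" "g1 \<in> polys_in (- {m})" "F (Var i) = g1 * Var m + g0"
        "\<And>\<mu>. \<mu> \<in> keys g1 \<Longrightarrow> \<mu> + single m 1 \<in> keys (F (Var i))"
        using linear_in_variable[of "F (Var i)" m] by blast
      have "lookup \<mu> x = 0" if "\<mu> \<in> keys g1" for \<mu> x
      proof (rule ccontr)
        assume "lookup \<mu> x \<noteq> 0"
        hence "w x \<le> mdeg w \<mu>" using mdeg_ge_exponent[of w 1 \<mu> x] w by simp
        moreover have "mdeg w \<mu> + w m \<le> w m"
          using le[OF g(4)[OF that]] by (simp add: mdeg_add mdeg_single)
        ultimately show False using w(1)[of x] by simp
      qed
      hence "g1 \<in> polys_in {}" by (simp add: polys_in_iff)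
      then obtain c where "g1 = Const c" by (rule polys_in_empty)
      thus ?thesis using g by (auto simp: C(1))
    qed
    obtain c1 q1 where 1: "q1 \<in> polys_in {a, b}" "F (Var 1) = Const c1 * Var m + q1" using lin[of 1] by blast
    obtain c2 q2 where 2: "q2 \<in> polys_in {a, b}" "F (Var 2) = Const c2 * Var m + q2" using lin[of 2] by blast
    show ?thesis
    proof (cases "c1 = 0")
      case True
      thus ?thesis using 1 2 by (intro coordinate_pair_in_Tame[OF F i123 ab _ 2(2,1)]) (simp add: Const_simps)
    next
      case False
      \<comment> \<open>cancel \<open>x\<^sub>m\<close> in the second coordinate, then exchange the roles of the first two coordinates\<close>
      define E where "E = shear (2::3) 1 (- Const (c2 / c1) * Var 1)"
      have ET: "E \<in> Tame" unfolding E_def by (rule shear_in_Tame) (auto intro!: polys_in_intros)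
      have "(F \<circ> E) (Var 2) = F (Var 2) - Const (c2 / c1) * F (Var 1)"
        by (simp add: E_def shear_Var alg_end_hom[OF Fe] Const_simps)
      also have "\<dots> = q2 - Const (c2 / c1) * q1 + (Const c2 - Const (c2 / c1) * Const c1) * Var m"
        by (simp add: 1 2 algebra_simps)
      also have "Const (c2 / c1) * Const c1 = (Const c2 :: (3, 'k) mpol)"
        using False by (simp add: Const_simps(4)[symmetric])
      finally have FE2: "(F \<circ> E) (Var 2) \<in> polys_in {a, b}" using 1 2 by (auto intro!: polys_in_intros)
      have FE1: "(F \<circ> E) (Var 1) = Const c1 * Var m + q1" by (simp add: E_def shear_Var 1)
      have "alg_aut (F \<circ> E)" using F Tame_carrier[OF ET] by (auto simp: alg_aut_iff bij_comp alg_end_comp)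
      hence "F \<circ> E \<in> Tame"
        by (rule coordinate_pair_in_Tame[OF _ _ _ _ ab FE2 FE1 1(1), of 3]) auto
      thus ?thesis by (rule Tame_cancel_right[OF ET])
    qed
  next
    case False
    hence d: "wdeg w (F (Var 2)) < wdeg w (F (Var 1)) + w m" "wdeg w (F (Var 1)) < w m"
      using assms(3) by (auto simp: m algebra_simps)
    have "lookup \<mu> m = 0" if "\<mu> \<in> keys (F (Var 1))" for \<mu>
    proof (rule ccontr)
      assume "lookup \<mu> m \<noteq> 0"
      hence "w m \<le> mdeg w \<mu>" using mdeg_ge_exponent[of w 1 \<mu> m] w by simp
      thus False using mdeg_le_wdeg[OF that, of w] d(2) by simp
    qed
    hence f1: "F (Var 1) \<in> polys_in {a, b}" unfolding C(1)[symmetric] polys_in_iff by auto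
    have "lookup \<mu> m \<le> 1" if "\<mu> \<in> keys (F (Var 2))" for \<mu>
    proof (rule ccontr)
      assume "\<not> lookup \<mu> m \<le> 1"
      hence "w m + w m \<le> mdeg w \<mu>" using two[of \<mu>] by simp
      also have "\<dots> \<le> wdeg w (F (Var 2))" by (rule mdeg_le_wdeg[OF that])
      also have "\<dots> < wdeg w (F (Var 1)) + w m" by (rule d)
      also have "\<dots> < w m + w m" using d(2) by simp
      finally show False .
    qed
    then obtain g0 g1 where g: "g0 \<in> polys_in (- {m})" "g1 \<in> polys_in (- {m})" "F (Var 2) = g1 * Var m + g0"
      "\<And>\<mu>. \<mu> \<in> keys g1 \<Longrightarrow> \<mu> + single m 1 \<in> keys (F (Var 2))"
      using linear_in_variable[of "F (Var 2)" m] by blast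
    have g0: "g0 \<in> polys_in {a, b}" and g1: "g1 \<in> polys_in {a, b}" using g by (simp_all add: C(1))
    \<comment> \<open>\<open>g1\<close> is a polynomial in \<open>F (Var 1)\<close> of smaller degree than \<open>F (Var 1)\<close>\<close>
    have "\<exists>c. g1 = Const c"
    proof (cases "g1 = 0")
      case True
      thus ?thesis by (intro exI[of _ 0]) (simp add: Const_simps)
    next
      case nz1: False
      obtain \<mu> where \<mu>: "\<mu> \<in> keys g1" "mdeg w \<mu> = wdeg w g1" using wdeg_attained[OF nz1] by blast
      have "wdeg w g1 + w m \<le> wdeg w (F (Var 2))"
        using mdeg_le_wdeg[OF g(4)[OF \<mu>(1)], of w] \<mu>(2) by (simp add: mdeg_add mdeg_single)
      hence less: "wdeg w g1 < wdeg w (F (Var 1))" using d(1) by (meson add_less_cancel_right le_less_trans)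
      have "0 \<le> wdeg w g1" using \<mu>(2) mdeg_nonneg[of w \<mu>] w by simp
      hence pos: "wdeg w (F (Var 1)) > 0" using less by simp
      obtain Q where Q: "Q \<in> polys_in {1}" "F Q = g1"
        by (rule coefficient_in_coordinate_subring[OF F i123(1) ab f1 g(3) g0 g1 nz1])
      obtain r N where r: "\<And>i. r i \<in> polys_in ({1} - {1::3})" "Q = (\<Sum>i\<le>N. r i * Var 1 ^ i)"
        using expand_in_variable[of Q 1 "{1}"] Q(1) by auto
      have rc: "\<exists>c. F (r i) = Const c" for i
      proof -
        obtain c where "r i = Const c" using r(1)[of i] polys_in_empty[of "r i"] by auto
        thus ?thesis by (auto simp: alg_end_hom[OF Fe])
      qed
      have gs: "g1 = (\<Sum>i\<le>N. F (r i) * F (Var 1) ^ i)" unfolding Q(2)[symmetric] by (simp add: r(2) alg_end_hom[OF Fe])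
      have r0: "wdeg w (F (r i)) = 0" if "F (r i) \<noteq> 0" for i using rc[of i] that by auto
      obtain n where n: "wdeg w g1 = (\<Sum>j<n. wdeg w (F (Var 1)))" "g1 = (\<Sum>i\<le>n. F (r i) * F (Var 1) ^ i)"
        using wdeg_power_sum[OF nz pos r0 gs nz1] by blast
      have "n = 0"
      proof (rule ccontr)
        assume "n \<noteq> 0"
        hence "(\<Sum>j<1::nat. wdeg w (F (Var 1))) \<le> (\<Sum>j<n. wdeg w (F (Var 1)))"
          using pos by (intro sum_mono2) auto
        thus False using n(1) less by simp
      qed
      thus ?thesis using n(2) rc[of 0] by simp
    qed
    then obtain c where "g1 = Const c" by blast
    thus ?thesis using g(3) by (intro coordinate_pair_in_Tame[OF F i123 ab f1 _ g0]) simp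
  qed
qed

end
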